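(* For the last-passage model with exponential distributions with i.i.d. random rates described in the context, the limit $\Psi_G$ has the following asymptotics close to the $x$-axis. Case 1: Suppose $\int_{[c,\infty)}(\xi-c)^{-2}\,m(d\xi)<\infty$. Then there exists $\alpha_0>0$ such that $$\Psi_G(1,\alpha)=c^{-1}+\alpha\int_{[c,\infty)}\frac1{\xi-c}\,m(d\xi)\qquad\text{for }\alpha\in(0,\alpha_0].$$ Case 2: Suppose there exist $\nu\in[-1,1]$ and $\kappa>0$ such that $\lim_{\xi\searrow c}\dfrac{m[c,\xi)}{(\xi-c)^{\nu+1}}=\kappa$ (so that, in particular, $\int_{[c,\infty)}(\xi-c)^{-2}\,m(d\xi)=\infty$). Then as $\alpha\searrow0$: \begin{itemize} \item if $\nu\in(0,1]$, then $\Psi_G(1,\alpha)=c^{-1}+\alpha\int_{[c,\infty)}\frac1{\xi-c}\,m(d\xi)+o(\alpha)$; \item if $\nu=0$, then $\Psi_G(1,\alpha)=c^{-1}-\kappa\alpha\log\alpha+o(\alpha\log\alpha)$; \item if $\nu\in[-1,0)$, then $\Psi_G(1,\alpha)=c^{-1}+B\alpha^{\frac1{1-\nu}}+o(\alpha^{\frac1{1-\nu}})$, where $B=B_0c^{-2}+\kappa B_0^{\nu}A_{\nu,2}$ with $$B_0=(2\kappa c^2A_\nu)^{\frac1{1-\nu}},\quad A_\nu=\sum_{k=0}^\infty\binom{\nu+1}{k}\frac{(-1)^k}{k-\nu+1},\quad A_{\nu,2}=\sum_{k=0}^\infty\binom{\nu+1}{k}\frac{(-1)^k}{k-\nu}.$$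 \end{itemize}
   Context: Let $c>0$ and let $\{\xi_j\}_{j\in\mathbb Z_+}$ be i.i.d. random variables with $\xi_j\ge c$ and common distribution $m$, where $c$ is the exact lower bound: $m[c,c+\varepsilon)>0$ for each $\varepsilon>0$. Let $G_j(x)=1-e^{-\xi_jx}$, $x>0$, be the exponential distribution with rate $\xi_j$. Given $\{\xi_j\}$, the weights $\{X(i,j):(i,j)\in\mathbb Z_+^2\}$ are independent with $X(i,j)\sim G_j$. $T(k,\ell)$ is the maximum of $\sum_{z\in\pi}X(z)$ over all nearest-neighbor lattice paths $\pi$ from $(0,0)$ to $(k,\ell)$ with steps $(1,0)$ or $(0,1)$, the endpoint $(k,\ell)$ excluded. $\Psi_G(x,y)=\lim_{n\to\infty}\frac1nT(\lfloor nx\rfloor,\lfloor ny\rfloor)$ for $(x,y)\in(0,\infty)^2$ is the almost sure deterministic limit. Binomial coefficients $\binom{\nu+1}{k}$ are the generalized ones, $\binom{s}{k}=s(s-1)\cdots(s-k+1)/k!$. *)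

theory Defs
  imports "HOL-Probability.Probability" "HOL-Library.Landau_Symbols"
begin

definition lattice_step :: "nat \<times> nat \<Rightarrow> nat \<times> nat \<Rightarrow> bool" where
  "lattice_step p q \<longleftrightarrow> q = (fst p + 1, snd p) \<or> q = (fst p, snd p + 1)"

definition lattice_paths :: "nat \<Rightarrow> nat \<Rightarrow> (nat \<times> nat) list set" where
  "lattice_paths k l =
     {\<pi>. \<pi> \<noteq> [] \<and> hd \<pi> = (0, 0) \<and> last \<pi> = (k, l) \<and> successively lattice_step \<pi>}"

text \<open>Here \<open>butlast\<close> removes the endpoint \<open>(k, l)\<close>, whose weight is not counted.\<close>

definition last_passage :: "(nat \<times> nat \<Rightarrow> real) \<Rightarrow> nat \<Rightarrow> nat \<Rightarrow> real" where
  "last_passage w k l = Max ((\<lambda>\<pi>. \<Sum>z\<leftarrow>butlast \<pi>. w z) ` lattice_paths k l)"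

text \<open>The maximum above is over a finite nonempty set.\<close>

lemma lattice_path_bounds:
  assumes "successively lattice_step \<pi>" "\<pi> \<noteq> []"
  shows "set \<pi> \<subseteq> {..fst (last \<pi>)} \<times> {..snd (last \<pi>)} \<and>
         length \<pi> + fst (hd \<pi>) + snd (hd \<pi>) = Suc (fst (last \<pi>) + snd (last \<pi>))"
  using assms
proof (induction \<pi>)
  case (Cons p \<pi>)
  show ?case
  proof (cases "\<pi> = []")
    case False
    with Cons have IH: "set \<pi> \<subseteq> {..fst (last \<pi>)} \<times> {..snd (last \<pi>)}"
      "length \<pi> + fst (hd \<pi>) + snd (hd \<pi>) = Suc (fst (last \<pi>) + snd (last \<pi>))"
      and st: "lattice_step p (hd \<pi>)"
      by (auto simp: successively_Cons)
    have "hd \<pi> \<in> {..fst (last \<pi>)} \<times> {..snd (last \<pi>)}"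
      using IH(1) False hd_in_set by blast
    with IH st False show ?thesis
      by (cases p; cases "hd \<pi>") (auto simp: lattice_step_def)
  qed (cases p; auto)
qed simp

lemma finite_lattice_paths: "finite (lattice_paths k l)"
proof (rule finite_subset)
  show "lattice_paths k l \<subseteq> {\<pi>. set \<pi> \<subseteq> {..k} \<times> {..l} \<and> length \<pi> \<le> Suc (k + l)}"
    using lattice_path_bounds by (fastforce simp: lattice_paths_def)
qed (auto intro: finite_lists_length_le)

lemma lattice_paths_nonempty: "lattice_paths k l \<noteq> {}"
proof -
  have extend: "\<pi> @ [q] \<in> lattice_paths (fst q) (snd q)"
    if "\<pi> \<in> lattice_paths i j" "lattice_step (i, j) q" for \<pi> i j q
    using that by (auto simp: lattice_paths_def successively_append_iff)
  have x: "lattice_paths k 0 \<noteq> {}"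
  proof (induction k)
    case 0
    have "[(0, 0)] \<in> lattice_paths 0 0" by (simp add: lattice_paths_def)
    then show ?case by blast
  next
    case (Suc k)
    then obtain \<pi> where "\<pi> \<in> lattice_paths k 0" by blast
    from extend[OF this, of "(Suc k, 0)"] show ?case by (auto simp: lattice_step_def)
  qed
  show ?thesis
  proof (induction l)
    case (Suc l)
    then obtain \<pi> where "\<pi> \<in> lattice_paths k l" by blast
    from extend[OF this, of "(k, Suc l)"] show ?case by (auto simp: lattice_step_def)
  qed (rule x)
qed

text \<open>The law with distribution function \<open>1 - exp (- r * x)\<close>, \<open>x > 0\<close>, when \<open>r > 0\<close>.\<close>

definition exp_law :: "real \<Rightarrow> real measure" where
  "exp_law r = density lborel (\<lambda>x. ennreal (exponential_density r x))"

definition rate_algebra :: "'a measure \<Rightarrow> (nat \<Rightarrow> 'a \<Rightarrow> real) \<Rightarrow> 'a measure" where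
  "rate_algebra M \<xi> =
     vimage_algebra (space M) (\<lambda>\<omega> j. \<xi> j \<omega>) (Pi\<^sub>M UNIV (\<lambda>_. borel))"

text \<open>
  The rate of the weight at \<open>(i, j)\<close> is \<open>\<xi> j\<close>, so a rate is shared along each horizontal row.
  The assumption \<open>conditional_law\<close> says that, given all rates, the weights are
  independent with \<open>X (i, j)\<close> exponential of rate \<open>\<xi> j\<close>: it prescribes the conditional
  finite-dimensional distributions on measurable rectangles.
\<close>

locale random_rate_exponential_model = prob_space M
  for M :: "'a measure" +
  fixes c :: real
    and m :: "real measure"
    and \<xi> :: "nat \<Rightarrow> 'a \<Rightarrow> real"
    and X :: "nat \<times> nat \<Rightarrow> 'a \<Rightarrow> real"
  assumes c_pos: "c > 0"
    and rates_indep: "indep_vars (\<lambda>_. borel) \<xi> UNIV"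
    and rates_distr: "\<And>j. distr M borel (\<xi> j) = m"
    and rates_ge: "\<And>j. AE \<omega> in M. c \<le> \<xi> j \<omega>"
    and c_exact: "\<And>\<epsilon>. \<epsilon> > 0 \<Longrightarrow> measure m {c..<c + \<epsilon>} > 0"
    and weights_measurable: "\<And>z. X z \<in> borel_measurable M"
    and conditional_law:
      "\<And>I B. finite I \<Longrightarrow> (\<And>z. z \<in> I \<Longrightarrow> B z \<in> sets borel) \<Longrightarrow>
         AE \<omega> in M.
           real_cond_exp M (rate_algebra M \<xi>)
             (indicator {\<omega> \<in> space M. \<forall>z\<in>I. X z \<omega> \<in> B z}) \<omega> =
           (\<Prod>z\<in>I. measure (exp_law (\<xi> (snd z) \<omega>)) (B z))"

definition is_limit_shape ::
  "'a measure \<Rightarrow> (nat \<times> nat \<Rightarrow> 'a \<Rightarrow> real) \<Rightarrow> (real \<Rightarrow> real \<Rightarrow> real) \<Rightarrow> bool" where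
  "is_limit_shape M X \<Psi> \<longleftrightarrow>
     (\<forall>x>0. \<forall>y>0. AE \<omega> in M.
        (\<lambda>n. last_passage (\<lambda>z. X z \<omega>) (nat \<lfloor>real n * x\<rfloor>) (nat \<lfloor>real n * y\<rfloor>) / real n)
          \<longlonglongrightarrow> \<Psi> x y)"

text \<open>
  Extended-real-valued, because an atom of \<open>m\<close> at \<open>c\<close> has to make this infinite:
  \<open>1 / 0 = \<infinity>\<close> in \<^typ>\<open>ennreal\<close>, whereas \<open>1 / 0 = 0\<close> in \<^typ>\<open>real\<close>.
\<close>

definition inverse_square_moment :: "real \<Rightarrow> real measure \<Rightarrow> ennreal" where
  "inverse_square_moment c m = (\<integral>\<^sup>+ t \<in> {c..}. 1 / ennreal ((t - c)\<^sup>2) \<partial>m)"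

text \<open>
  Only used when \<open>m\<close> has no atom at \<open>c\<close> and the integrand is integrable, so neither
  \<open>1 / 0 = 0\<close> nor the zero default of a divergent integral plays a role.
\<close>

definition inverse_moment :: "real \<Rightarrow> real measure \<Rightarrow> real" where
  "inverse_moment c m = (LINT t:{c..}|m. 1 / (t - c))"

definition A1_const :: "real \<Rightarrow> real" where
  "A1_const \<nu> = (\<Sum>k. ((\<nu> + 1) gchoose k) * ((-1) ^ k / (real k - \<nu> + 1)))"

definition A2_const :: "real \<Rightarrow> real" where
  "A2_const \<nu> = (\<Sum>k. ((\<nu> + 1) gchoose k) * ((-1) ^ k / (real k - \<nu>)))"

definition B0_const :: "real \<Rightarrow> real \<Rightarrow> real \<Rightarrow> real" where
  "B0_const c \<kappa> \<nu> = (2 * \<kappa> * c\<^sup>2 * A1_const \<nu>) powr (1 / (1 - \<nu>))"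

definition B_const :: "real \<Rightarrow> real \<Rightarrow> real \<Rightarrow> real" where
  "B_const c \<kappa> \<nu> = B0_const c \<kappa> \<nu> / c\<^sup>2 + \<kappa> * B0_const c \<kappa> \<nu> powr \<nu> * A2_const \<nu>"

end

theory Submission
  imports Defs "HOL-Real_Asymp.Real_Asymp"
begin

text \<open>
  With \<open>g z\<close> denoting the mean of \<open>1 / (\<xi> - z)\<close>, the limit satisfies the variational formula
  \<open>\<Psi>(1, \<alpha>) = inf {1 / z + \<alpha> * g z | 0 < z < c}\<close>. For each \<open>z\<close> put independent exponential weights of
  rate \<open>z\<close> on the horizontal axis and of rate \<open>\<xi> j - z\<close> in row \<open>j\<close> of the vertical axis. By Burke's
  theorem the horizontal increments of the resulting passage time are independent exponential variables of
  rate \<open>z\<close> along every row, so that this passage time obeys a weak law of large numbers; as it dominates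
  the bulk passage time, \<open>\<Psi>(x, y) \<le> x / z + y * g z\<close>. Looking at where its optimal path leaves the
  boundary gives \<open>sup {\<Psi>(x, 1) - x / z | x > 0} = g z\<close>, and concavity of \<open>x \<mapsto> \<Psi>(x, 1)\<close> turns this
  duality into the lower bound.

  The asymptotics come from \<open>u = c - z \<rightarrow> 0\<close>: the layer cake formula
  \<open>u * g (c - u) = (\<integral>\<tau>\<in>{0<..<1}. m [c, c + u * (1 - \<tau>) / \<tau>) d\<tau>)\<close> converts the tail of \<open>m\<close> at \<open>c\<close> into
  the behaviour of \<open>g\<close> at \<open>c\<close>, with a Beta integral as the constant, and \<open>A1_const\<close> and \<open>A2_const\<close> are
  the binomial expansions of such integrals.
\<close>

section \<open>Last-passage times with and without boundary weights\<close>

text \<open>The limit is assumed almost surely for each fixed direction, but the argument needs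
  passage times whose starting point moves with \<open>n\<close>. These keep the law of the unmoved
  ones and lose the almost sure limit. Random statements are therefore phrased as events of
  probability tending to one (\<open>whp\<close>), which transport along maps preserving the law; as
  the conclusions compare constants, one sample point at which finitely many such events hold is
  enough.

  The space \<open>M\<close> carries no boundary weights. The law of the bulk weights is reproduced
  on a product of independent rows that has room for them; the conditional law of the model is used
  only for this.

  The rate \<open>r - z\<close> on the vertical axis is forced: the minimum of the two incoming
  increments then has rate \<open>z + (r - z) = r\<close>, that of the bulk weight, while the
  horizontal rate \<open>z\<close> is the same in all rows.

  In the asymptotics an upper bound needs one good \<open>z\<close>, but a lower bound must hold for
  every \<open>z\<close>. It is split by the distance to \<open>c\<close>: near \<open>c\<close> the
  behaviour of \<open>g\<close> decides, far from \<open>c\<close> the tangent bound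
  \<open>1 / z - 1 / c \<ge> (c - z) / c^2\<close>.\<close>

lemma lattice_paths_snoc:
  assumes "\<pi> \<in> lattice_paths i j" "lattice_step (i, j) (k, l)"
  shows "\<pi> @ [(k, l)] \<in> lattice_paths k l"
  using assms by (auto simp: lattice_paths_def successively_append_iff)

lemma lattice_paths_cases:
  assumes "\<pi> \<in> lattice_paths k l" "(k, l) \<noteq> (0, 0)"
  obtains i j \<pi>' where "\<pi> = \<pi>' @ [(k, l)]" "\<pi>' \<in> lattice_paths i j" "lattice_step (i, j) (k, l)"
proof -
  from assms have ne: "\<pi> \<noteq> []" "last \<pi> = (k, l)" "hd \<pi> = (0, 0)" "successively lattice_step \<pi>"
    by (auto simp: lattice_paths_def)
  then have eq: "\<pi> = butlast \<pi> @ [(k, l)]" by (metis append_butlast_last_id)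
  have ne': "butlast \<pi> \<noteq> []" using eq ne assms(2) by (metis append_Nil list.sel(1))
  obtain i j where ij: "last (butlast \<pi>) = (i, j)" by fastforce
  have "successively lattice_step (butlast \<pi> @ [(k, l)])" using eq ne by metis
  then have s: "successively lattice_step (butlast \<pi>)" "lattice_step (i, j) (k, l)"
    using ne' ij by (auto simp: successively_append_iff)
  have "hd (butlast \<pi>) = (0, 0)" using ne ne' eq by (metis hd_append2)
  then have "butlast \<pi> \<in> lattice_paths i j"
    using ne' ij s by (auto simp: lattice_paths_def)
  with eq s(2) that show thesis by blast
qed

lemma last_passage_ge:
  "\<pi> \<in> lattice_paths k l \<Longrightarrow> (\<Sum>z\<leftarrow>butlast \<pi>. w z) \<le> last_passage w k l"
  unfolding last_passage_def by (intro Max_ge finite_imageI finite_lattice_paths imageI)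

lemma last_passage_attained:
  obtains \<pi> where "\<pi> \<in> lattice_paths k l" "last_passage w k l = (\<Sum>z\<leftarrow>butlast \<pi>. w z)"
proof -
  have "last_passage w k l \<in> (\<lambda>\<pi>. \<Sum>z\<leftarrow>butlast \<pi>. w z) ` lattice_paths k l"
    unfolding last_passage_def
    by (intro Max_in finite_imageI finite_lattice_paths) (simp add: lattice_paths_nonempty)
  then show thesis using that by blast
qed

lemma sum_path_snoc:
  assumes "\<pi> \<in> lattice_paths i j"
  shows "(\<Sum>z\<leftarrow>\<pi>. w z) = (\<Sum>z\<leftarrow>butlast \<pi>. w z) + (w (i, j) :: real)"
proof -
  have "butlast \<pi> @ [(i, j)] = \<pi>"
    using assms by (auto simp: lattice_paths_def dest: append_butlast_last_id)
  then have "(\<Sum>z\<leftarrow>\<pi>. w z) = (\<Sum>z\<leftarrow>butlast \<pi> @ [(i, j)]. w z)" by (rule arg_cong[OF sym])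
  also have "\<dots> = (\<Sum>z\<leftarrow>butlast \<pi>. w z) + w (i, j)" by (simp del: append_butlast_last_id)
  finally show ?thesis .
qed

lemma last_passage_step:
  assumes "lattice_step (i, j) (k, l)"
  shows "last_passage w i j + w (i, j) \<le> last_passage w k l"
proof -
  obtain \<pi> where \<pi>: "\<pi> \<in> lattice_paths i j" "last_passage w i j = (\<Sum>z\<leftarrow>butlast \<pi>. w z)"
    by (rule last_passage_attained)
  from last_passage_ge[OF lattice_paths_snoc[OF \<pi>(1) assms], of w] \<pi>(2) sum_path_snoc[OF \<pi>(1), of w]
  show ?thesis by simp
qed

text \<open>Paired with \<open>last_passage_step\<close> this is the dynamic programming recursion.
  Except for the value at the origin, later facts about passage times follow from these two by
  induction on the endpoint, without returning to lists of vertices.\<close>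

lemma last_passage_pred:
  assumes "(k, l) \<noteq> (0, 0)"
  obtains i j where "lattice_step (i, j) (k, l)" "last_passage w k l \<le> last_passage w i j + w (i, j)"
proof -
  obtain \<pi> where \<pi>: "\<pi> \<in> lattice_paths k l" "last_passage w k l = (\<Sum>z\<leftarrow>butlast \<pi>. w z)"
    by (rule last_passage_attained)
  from lattice_paths_cases[OF \<pi>(1) assms] obtain i j \<pi>' where
    p: "\<pi> = \<pi>' @ [(k, l)]" "\<pi>' \<in> lattice_paths i j" "lattice_step (i, j) (k, l)" by blast
  from last_passage_ge[OF p(2), of w] sum_path_snoc[OF p(2), of w] \<pi>(2) p(1) p(3)
  show thesis by (intro that) auto
qed

lemma last_passage_origin [simp]: "last_passage w 0 0 = 0"
proof -
  obtain \<pi> where \<pi>: "\<pi> \<in> lattice_paths 0 0" "last_passage w 0 0 = (\<Sum>z\<leftarrow>butlast \<pi>. w z)"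
    by (rule last_passage_attained)
  then have "length \<pi> = 1"
    using lattice_path_bounds[of \<pi>] by (auto simp: lattice_paths_def)
  with \<pi> show ?thesis by (auto simp: length_Suc_conv)
qed

lemma last_passage_Suc_0 [simp]: "last_passage w (Suc k) 0 = last_passage w k 0 + w (k, 0)"
proof (rule antisym)
  from last_passage_pred[of "Suc k" 0 w] show "last_passage w (Suc k) 0 \<le> last_passage w k 0 + w (k, 0)"
    by (auto simp: lattice_step_def)
  show "last_passage w k 0 + w (k, 0) \<le> last_passage w (Suc k) 0"
    by (rule last_passage_step) (simp add: lattice_step_def)
qed

lemma last_passage_0_Suc [simp]: "last_passage w 0 (Suc l) = last_passage w 0 l + w (0, l)"
proof (rule antisym)
  from last_passage_pred[of 0 "Suc l" w] show "last_passage w 0 (Suc l) \<le> last_passage w 0 l + w (0, l)"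
    by (auto simp: lattice_step_def)
  show "last_passage w 0 l + w (0, l) \<le> last_passage w 0 (Suc l)"
    by (rule last_passage_step) (simp add: lattice_step_def)
qed

lemma last_passage_Suc_Suc [simp]:
  "last_passage w (Suc k) (Suc l) =
     max (last_passage w k (Suc l) + w (k, Suc l)) (last_passage w (Suc k) l + w (Suc k, l))"
proof (rule antisym)
  from last_passage_pred[of "Suc k" "Suc l" w]
  show "last_passage w (Suc k) (Suc l) \<le>
     max (last_passage w k (Suc l) + w (k, Suc l)) (last_passage w (Suc k) l + w (Suc k, l))"
    by (auto simp: lattice_step_def le_max_iff_disj)
  show "max (last_passage w k (Suc l) + w (k, Suc l)) (last_passage w (Suc k) l + w (Suc k, l))
      \<le> last_passage w (Suc k) (Suc l)"
    by (intro max.boundedI last_passage_step) (simp_all add: lattice_step_def)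
qed

lemma last_passage_measurable [measurable]:
  "(\<lambda>w. last_passage w k l) \<in> borel_measurable (Pi\<^sub>M UNIV (\<lambda>_. borel))"
proof (induction "k + l" arbitrary: k l rule: less_induct)
  case less
  have IH [measurable]: "(\<lambda>w. last_passage w k' l') \<in> borel_measurable (Pi\<^sub>M UNIV (\<lambda>_. borel))"
    if "k' + l' < k + l" for k' l'
    using less that by blast
  show ?case
  proof (cases k)
    case 0
    show ?thesis
    proof (cases l)
      case (Suc l')
      then have [measurable]: "(\<lambda>w. last_passage w 0 l') \<in> borel_measurable (Pi\<^sub>M UNIV (\<lambda>_. borel))"
        using 0 by (intro IH) simp
      show ?thesis unfolding 0 Suc last_passage_0_Suc by measurable
    qed (simp add: 0)
  next
    case k: (Suc k')
    show ?thesis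
    proof (cases l)
      case 0
      then have [measurable]: "(\<lambda>w. last_passage w k' 0) \<in> borel_measurable (Pi\<^sub>M UNIV (\<lambda>_. borel))"
        using k by (intro IH) simp
      show ?thesis unfolding 0 k last_passage_Suc_0 by measurable
    next
      case (Suc l')
      then have [measurable]: "(\<lambda>w. last_passage w k' (Suc l')) \<in> borel_measurable (Pi\<^sub>M UNIV (\<lambda>_. borel))"
        "(\<lambda>w. last_passage w (Suc k') l') \<in> borel_measurable (Pi\<^sub>M UNIV (\<lambda>_. borel))"
        using k by (auto intro!: IH simp del: last_passage_Suc_Suc)
      show ?thesis unfolding k Suc last_passage_Suc_Suc by measurable
    qed
  qed
qed

lemma last_passage_mono:
  assumes w: "\<And>z. 0 \<le> w z" and "k \<le> k'" "l \<le> l'"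
  shows "last_passage w k l \<le> last_passage w k' l'"
proof -
  have 1: "last_passage w k l \<le> last_passage w (Suc k) l" for k l
    using last_passage_step[of k l "Suc k" l w] w[of "(k, l)"] by (simp add: lattice_step_def)
  have 2: "last_passage w k l \<le> last_passage w k (Suc l)" for k l
    using last_passage_step[of k l k "Suc l" w] w[of "(k, l)"] by (simp add: lattice_step_def)
  have "last_passage w k l \<le> last_passage w k' l"
    by (rule lift_Suc_mono_le[of "\<lambda>k. last_passage w k l", OF 1 assms(2)])
  also have "\<dots> \<le> last_passage w k' l'"
    by (rule lift_Suc_mono_le[of "\<lambda>l. last_passage w k' l", OF 2 assms(3)])
  finally show ?thesis .
qed

lemma last_passage_nonneg: "(\<And>z. 0 \<le> w z) \<Longrightarrow> 0 \<le> last_passage w k l"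
  using last_passage_mono[of w 0 k 0 l] by simp

text \<open>Concatenation at \<open>(k, l)\<close>: the first path omits the weight of its endpoint
  and the second counts that of its starting point, so no weight is counted twice.\<close>

lemma last_passage_superadditive:
  "last_passage w k l + last_passage (\<lambda>(i, j). w (k + i, l + j)) k' l' \<le> last_passage w (k + k') (l + l')"
proof (induction "k' + l'" arbitrary: k' l' rule: less_induct)
  case less
  show ?case
  proof (cases "(k', l') = (0, 0)")
    case False
    then obtain i j where ij: "lattice_step (i, j) (k', l')"
      "last_passage (\<lambda>(i, j). w (k + i, l + j)) k' l' \<le>
         last_passage (\<lambda>(i, j). w (k + i, l + j)) i j + w (k + i, l + j)"
      using last_passage_pred[of k' l' "\<lambda>(i, j). w (k + i, l + j)"] by (metis (no_types, lifting) case_prod_conv)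
    have "last_passage w (k + i) (l + j) + w (k + i, l + j) \<le> last_passage w (k + k') (l + l')"
      using ij(1) by (intro last_passage_step) (auto simp: lattice_step_def)
    moreover have "last_passage w k l + last_passage (\<lambda>(i, j). w (k + i, l + j)) i j
        \<le> last_passage w (k + i) (l + j)"
      using ij(1) by (intro less) (auto simp: lattice_step_def)
    ultimately show ?thesis using ij(2) by linarith
  qed simp
qed

text \<open>The witness path reaches row \<open>j\<close>, follows it, and climbs afterwards;
  nonnegative weights allow everything outside the row to be dropped. Applied to a row of nearly
  minimal rate it gives the bound \<open>x / c\<close>.\<close>

lemma row_sum_le_last_passage:
  assumes w: "\<And>z. 0 \<le> w z" and "j \<le> l"
  shows "(\<Sum>i<k. w (i, j)) \<le> last_passage w k l"
proof -
  have "(\<Sum>i<k. w (i, j)) \<le> last_passage w k j"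
  proof (induction k)
    case (Suc k)
    have "last_passage w k j + w (k, j) \<le> last_passage w (Suc k) j"
      by (rule last_passage_step) (simp add: lattice_step_def)
    with Suc show ?case by simp
  qed (simp add: last_passage_nonneg w)
  also have "\<dots> \<le> last_passage w k l" using assms by (intro last_passage_mono) auto
  finally show ?thesis .
qed

text \<open>\<open>corner_passage w k l\<close> counts the weights of the box \<open>{..<k} \<times> {..<l}\<close>, its last corner included.\<close>

fun corner_passage :: "(nat \<times> nat \<Rightarrow> real) \<Rightarrow> nat \<Rightarrow> nat \<Rightarrow> real" where
  "corner_passage w 0 l = 0"
| "corner_passage w (Suc k) 0 = 0"
| "corner_passage w (Suc k) (Suc l) =
     w (k, l) + max (corner_passage w k (Suc l)) (corner_passage w (Suc k) l)"

lemma corner_passage_0_right [simp]: "corner_passage w k 0 = 0"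
  by (cases k) auto

lemma corner_passage_le_last_passage:
  assumes w: "\<And>z. 0 \<le> w z"
  shows "corner_passage w k l \<le> last_passage w k l"
proof -
  \<comment> \<open>The last corner of this box is the cell \<open>(k, l)\<close>, whose weight
    \<open>last_passage w k l\<close> leaves out.\<close>
  have "corner_passage w (Suc k) (Suc l) \<le> last_passage w k l + w (k, l)" for k l
  proof (induction "k + l" arbitrary: k l rule: less_induct)
    case less
    have 1: "corner_passage w k (Suc l) \<le> last_passage w k l"
    proof (cases k)
      case (Suc k')
      with less[of k' l] last_passage_step[of k' l k l w] show ?thesis
        by (auto simp: lattice_step_def)
    qed (simp add: last_passage_nonneg w)
    have 2: "corner_passage w (Suc k) l \<le> last_passage w k l"
    proof (cases l)
      case (Suc l')
      with less[of k l'] last_passage_step[of k l' k l w] show ?thesis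
        by (auto simp: lattice_step_def)
    qed (simp add: last_passage_nonneg w)
    from 1 2 show ?case by simp
  qed note * = this
  show ?thesis
  proof (cases k; cases l)
    fix k' l' assume [simp]: "k = Suc k'" "l = Suc l'"
    have "last_passage w k' l' + w (k', l') \<le> last_passage w (Suc k') l'"
      by (rule last_passage_step) (simp add: lattice_step_def)
    also have "\<dots> \<le> last_passage w (Suc k') (Suc l')" by (intro last_passage_mono w) auto
    finally show ?thesis
      using *[of k' l'] by (simp del: last_passage_Suc_Suc corner_passage.simps)
  qed (simp_all add: last_passage_nonneg w del: last_passage_Suc_Suc)
qed

lemma corner_passage_nonneg: "(\<And>z. 0 \<le> w z) \<Longrightarrow> 0 \<le> corner_passage w k l"
  by (induction w k l rule: corner_passage.induct) (auto simp: add_nonneg_nonneg le_max_iff_disj)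

text \<open>Deleting the first \<open>a\<close> columns only removes paths, and nonnegative weights
  make longer paths no worse. This permits rounding an exit point down to the start of its
  block.\<close>

lemma corner_passage_mono_shift:
  assumes w: "\<And>z. 0 \<le> w z"
  shows "corner_passage (\<lambda>(i, j). w (i + a, j)) k l \<le> corner_passage w (k + a) l"
  using w
proof (induction "\<lambda>(i, j). w (i + a, j)" k l rule: corner_passage.induct)
  case (3 k l)
  then show ?case by auto
qed (auto intro: corner_passage_nonneg)

text \<open>Bulk cell \<open>(i, j)\<close> sits at the lattice point \<open>(i + 1, j + 1)\<close>,
  the axes carry \<open>u\<close> and \<open>v\<close>, and the origin weighs nothing. Unlike in
  \<open>last_passage\<close>, the weight of the endpoint is counted, so that the increments along
  the axes are exactly \<open>u\<close> and \<open>v\<close>.\<close>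

fun boundary_passage :: "(nat \<Rightarrow> real) \<Rightarrow> (nat \<Rightarrow> real) \<Rightarrow> (nat \<times> nat \<Rightarrow> real) \<Rightarrow> nat \<Rightarrow> nat \<Rightarrow> real"
where
  "boundary_passage u v w k 0 = (\<Sum>i<k. u i)"
| "boundary_passage u v w 0 (Suc l) = (\<Sum>j<Suc l. v j)"
| "boundary_passage u v w (Suc k) (Suc l) =
     w (k, l) + max (boundary_passage u v w k (Suc l)) (boundary_passage u v w (Suc k) l)"

lemma boundary_passage_0_left [simp]: "boundary_passage u v w 0 l = (\<Sum>j<l. v j)"
  by (cases l) auto

text \<open>A bulk path is reproduced in the boundary model after one step along an axis; the
  nonnegative boundary weight collected there only helps.\<close>

lemma last_passage_le_boundary_passage:
  assumes u: "\<And>i. 0 \<le> u i" and v: "\<And>j. 0 \<le> v j" and w: "\<And>z. 0 \<le> w z"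
  shows "last_passage w k l + w (k, l) \<le> boundary_passage u v w (Suc k) (Suc l)"
proof (induction "k + l" arbitrary: k l rule: less_induct)
  case less
  have "last_passage w k l \<le> max (boundary_passage u v w k (Suc l)) (boundary_passage u v w (Suc k) l)"
  proof (cases "(k, l) = (0, 0)")
    case True
    then show ?thesis using u v by (auto simp: le_max_iff_disj)
  next
    case False
    then obtain i j where ij: "lattice_step (i, j) (k, l)"
      "last_passage w k l \<le> last_passage w i j + w (i, j)"
      using last_passage_pred[of k l w] by blast
    with less[of i j] show ?thesis by (fastforce simp: lattice_step_def le_max_iff_disj)
  qed
  then show ?case by simp
qed

text \<open>Split by the axis along which an optimal path starts. A path leaving the horizontal axis
  over column \<open>a\<close> has collected \<open>u 0\<close> up to \<open>u a\<close> and still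
  has columns \<open>a\<close>, \<open>a + 1\<close>, ... of the bulk before it. An exit from the
  vertical axis is charged crudely with all of \<open>v\<close> and the whole bulk, which suffices
  because such exits will lead to a contradiction.\<close>

lemma boundary_passage_exit:
  assumes v: "\<And>j. 0 \<le> v j"
  shows "boundary_passage u v w k l \<le> (\<Sum>j<l. v j) + corner_passage w k l \<or>
    (\<exists>a<k. boundary_passage u v w k l \<le>
       (\<Sum>i<Suc a. u i) + corner_passage (\<lambda>(i, j). w (i + a, j)) (k - a) l)"
  using v
proof (induction u v w k l rule: boundary_passage.induct)
  case (1 u v w k)
  then show ?case by (cases k) auto
next
  case (2 u v w l)
  then show ?case by simp
next
  case (3 u v w k l)
  let ?c = "\<lambda>a. corner_passage (\<lambda>(i, j). w (i + a, j))"
  have step: "w (k, l) + ?c a (k - a) (Suc l) \<le> ?c a (Suc k - a) (Suc l)"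
    "w (k, l) + ?c a (Suc k - a) l \<le> ?c a (Suc k - a) (Suc l)" if "a \<le> k" for a
    using that by (auto simp: Suc_diff_le)
  have step0: "w (k, l) + corner_passage w k (Suc l) \<le> corner_passage w (Suc k) (Suc l)"
    "w (k, l) + corner_passage w (Suc k) l \<le> corner_passage w (Suc k) (Suc l)" by auto
  let ?b = "boundary_passage u v w"
  let ?V = "\<Sum>j<Suc l. v j"
  consider "?b (Suc k) (Suc l) = w (k, l) + ?b k (Suc l)" | "?b (Suc k) (Suc l) = w (k, l) + ?b (Suc k) l"
    by (simp add: max_def) metis
  then show ?case
  proof cases
    case 1
    from "3.IH"(1)[OF "3.prems"] show ?thesis
    proof (elim disjE exE conjE)
      assume "?b k (Suc l) \<le> ?V + corner_passage w k (Suc l)"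
      with 1 step0(1) have "?b (Suc k) (Suc l) \<le> ?V + corner_passage w (Suc k) (Suc l)" by linarith
      then show ?thesis ..
    next
      fix a assume a: "a < k" "?b k (Suc l) \<le> (\<Sum>i<Suc a. u i) + ?c a (k - a) (Suc l)"
      with 1 step(1)[of a] have "?b (Suc k) (Suc l) \<le> (\<Sum>i<Suc a. u i) + ?c a (Suc k - a) (Suc l)"
        by linarith
      with a(1) show ?thesis by (intro disjI2 exI[of _ a]) simp
    qed
  next
    case 2
    from "3.IH"(2)[OF "3.prems"] show ?thesis
    proof (elim disjE exE conjE)
      assume "?b (Suc k) l \<le> (\<Sum>j<l. v j) + corner_passage w (Suc k) l"
      moreover have "0 \<le> v l" by (rule "3.prems")
      ultimately have "?b (Suc k) (Suc l) \<le> ?V + corner_passage w (Suc k) (Suc l)"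
        using 2 step0(2) by simp
      then show ?thesis ..
    next
      fix a assume a: "a < Suc k" "?b (Suc k) l \<le> (\<Sum>i<Suc a. u i) + ?c a (Suc k - a) l"
      with 2 step(2)[of a] have "?b (Suc k) (Suc l) \<le> (\<Sum>i<Suc a. u i) + ?c a (Suc k - a) (Suc l)"
        by linarith
      with a(1) show ?thesis by (intro disjI2 exI[of _ a]) simp
    qed
  qed
qed

section \<open>Burke's theorem\<close>

abbreviation iid :: "'a measure \<Rightarrow> (nat \<Rightarrow> 'a) measure" where
  "iid K \<equiv> Pi\<^sub>M UNIV (\<lambda>_. K)"

lemma sets_exp_law [measurable_cong, simp]: "sets (exp_law r) = sets borel"
  by (simp add: exp_law_def)

lemma space_exp_law [simp]: "space (exp_law r) = UNIV"
  by (simp add: exp_law_def)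

lemma prob_space_exp_law: "0 < r \<Longrightarrow> prob_space (exp_law r)"
  unfolding exp_law_def by (rule prob_space_exponential_density)

lemma sets_iid_exp_law [measurable_cong, simp]: "sets (iid (exp_law r)) = sets (iid borel)"
  by (intro sets_PiM_cong) auto

lemma sequence_space_iid: "prob_space K \<Longrightarrow> sequence_space K"
  by (simp add: sequence_space_def product_prob_spaceI)

lemma prob_space_iid: "prob_space K \<Longrightarrow> prob_space (iid K)"
  by (rule prob_space_PiM)

lemma nn_integral_iid_iter:
  assumes K: "prob_space K" and [measurable]: "f \<in> borel_measurable (iid K)"
  shows "(\<integral>\<^sup>+\<omega>. f \<omega> \<partial>iid K) = (\<integral>\<^sup>+s. \<integral>\<^sup>+\<omega>. f (case_nat s \<omega>) \<partial>iid K \<partial>K)"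
proof -
  interpret sequence_space K using K by (rule sequence_space_iid)
  have "(\<integral>\<^sup>+\<omega>. f \<omega> \<partial>iid K) = (\<integral>\<^sup>+\<omega>. f \<omega> \<partial>distr (K \<Otimes>\<^sub>M iid K) (iid K) (\<lambda>(s, \<omega>). case_nat s \<omega>))"
    by (simp add: PiM_iter)
  also have "\<dots> = (\<integral>\<^sup>+p. f (case_nat (fst p) (snd p)) \<partial>(K \<Otimes>\<^sub>M iid K))"
    by (subst nn_integral_distr) (auto simp: split_beta')
  also have "\<dots> = (\<integral>\<^sup>+s. \<integral>\<^sup>+\<omega>. f (case_nat s \<omega>) \<partial>iid K \<partial>K)"
    by (subst P.nn_integral_fst[symmetric]) auto
  finally show ?thesis .
qed

lemma distr_iid:
  assumes K: "prob_space K" and [measurable]: "f \<in> K \<rightarrow>\<^sub>M N"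
  shows "distr (iid K) (iid N) (\<lambda>\<omega> i. f (\<omega> i)) = iid (distr K N f)"
proof -
  interpret K: prob_space K by fact
  interpret D: prob_space "distr K N f" by (rule K.prob_space_distr) simp
  interpret P: product_prob_space "\<lambda>_::nat. distr K N f" UNIV by unfold_locales
  interpret Q: product_prob_space "\<lambda>_::nat. K" UNIV by unfold_locales
  have s: "sets (iid (distr K N f)) = sets (iid N)" by (intro sets_PiM_cong) auto
  show ?thesis
  proof (rule P.PiM_eq)
    fix J :: "nat set" and F assume J: "finite J" "\<And>j. j \<in> J \<Longrightarrow> F j \<in> sets (distr K N f)"
    have [measurable]: "F j \<in> sets N" if "j \<in> J" for j using J(2)[OF that] by simp
    let ?X = "prod_emb UNIV (\<lambda>_. distr K N f) J (Pi\<^sub>E J F)"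
    have X: "?X \<in> sets (iid N)" using J unfolding s[symmetric] by (intro sets_PiM_I) auto
    have "emeasure (distr (iid K) (iid N) (\<lambda>\<omega> i. f (\<omega> i))) ?X
        = emeasure (iid K) ((\<lambda>\<omega> i. f (\<omega> i)) -` ?X \<inter> space (iid K))"
    proof (rule emeasure_distr[OF _ X])
      have "(\<lambda>\<omega>. f (\<omega> i)) \<in> iid K \<rightarrow>\<^sub>M N" for i by measurable
      then show "(\<lambda>\<omega> i. f (\<omega> i)) \<in> iid K \<rightarrow>\<^sub>M iid N"
        by (intro measurable_PiM_single') (auto simp: measurable_def space_PiM)
    qed
    also have "(\<lambda>\<omega> i. f (\<omega> i)) -` ?X \<inter> space (iid K)
        = {\<omega> \<in> space (iid K). \<forall>j\<in>J. \<omega> j \<in> f -` F j \<inter> space K}"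
      using measurable_space[OF assms(2)]
      by (auto simp: prod_emb_def space_PiM PiE_iff)
    also have "emeasure (iid K) \<dots> = (\<Prod>j\<in>J. emeasure K (f -` F j \<inter> space K))"
      using J by (intro Q.emeasure_PiM_Collect) auto
    also have "\<dots> = (\<Prod>j\<in>J. emeasure (distr K N f) (F j))"
      using J by (intro prod.cong refl emeasure_distr[symmetric]) auto
    finally show "emeasure (distr (iid K) (iid N) (\<lambda>\<omega> i. f (\<omega> i))) ?X
      = (\<Prod>j\<in>J. emeasure (distr K N f) (F j))" .
  qed (simp add: s)
qed

lemma exp_law_scale:
  assumes r: "0 < r" shows "distr (exp_law 1) borel (\<lambda>x. x / r) = exp_law r"
proof (rule measure_eqI)
  fix A assume "A \<in> sets (distr (exp_law 1) borel (\<lambda>x. x / r))"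
  then have [measurable]: "A \<in> sets borel" by simp
  have "emeasure (exp_law r) A = (\<integral>\<^sup>+x. ennreal (exponential_density r x) * indicator A x \<partial>lborel)"
    unfolding exp_law_def by (subst emeasure_density) auto
  also have "\<dots> = ennreal (1 / r) *
      (\<integral>\<^sup>+x. ennreal (exponential_density r (x / r)) * indicator A (x / r) \<partial>lborel)"
    using r by (subst nn_integral_real_affine[of _ "1 / r" 0]) auto
  also have "\<dots> = (\<integral>\<^sup>+x. ennreal (1 / r) *
      (ennreal (exponential_density r (x / r)) * indicator A (x / r)) \<partial>lborel)"
    by (rule nn_integral_cmult[symmetric]) measurable
  also have "\<dots> = (\<integral>\<^sup>+x. ennreal (exponential_density 1 x) * indicator A (x / r) \<partial>lborel)"
  proof (rule nn_integral_cong)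
    fix x :: real
    have "ennreal (1 / r) * ennreal (exponential_density r (x / r)) = ennreal (exponential_density 1 x)"
      using r by (subst ennreal_mult[symmetric])
        (auto simp: exponential_density_def exponential_density_nonneg divide_less_0_iff)
    then show "ennreal (1 / r) * (ennreal (exponential_density r (x / r)) * indicator A (x / r))
      = ennreal (exponential_density 1 x) * indicator A (x / r)"
      by (simp add: mult.assoc[symmetric])
  qed
  also have "\<dots> = (\<integral>\<^sup>+x. indicator A (x / r) \<partial>exp_law 1)"
    unfolding exp_law_def by (subst nn_integral_density) auto
  also have "\<dots> = (\<integral>\<^sup>+x. indicator A x \<partial>distr (exp_law 1) borel (\<lambda>x. x / r))"
    by (subst nn_integral_distr) auto
  also have "\<dots> = emeasure (distr (exp_law 1) borel (\<lambda>x. x / r)) A"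
    by (rule nn_integral_indicator) simp
  finally show "emeasure (distr (exp_law 1) borel (\<lambda>x. x / r)) A = emeasure (exp_law r) A" by simp
qed simp

lemma nn_integral_exp_law:
  assumes [measurable]: "f \<in> borel_measurable borel"
  shows "(\<integral>\<^sup>+x. f x \<partial>exp_law r) = (\<integral>\<^sup>+x. ennreal (exponential_density r x) * f x \<partial>lborel)"
  unfolding exp_law_def by (subst nn_integral_density) auto

lemma exp_law_moment:
  assumes r: "0 < r"
  shows "(\<integral>\<^sup>+v. ennreal (v ^ i) \<partial>exp_law r) = ennreal (fact i / r ^ i)"
proof -
  have "(\<integral>\<^sup>+v. ennreal (v ^ i) \<partial>exp_law r) = (\<integral>\<^sup>+x. ennreal (erlang_density 0 r x * x ^ i) \<partial>lborel)"
    by (simp add: nn_integral_exp_law ennreal_mult'[OF exponential_density_nonneg[OF r]])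
  then show ?thesis using r by (simp add: nn_integral_erlang_ith_moment)
qed

lemma AE_exp_law_nonneg: "AE v in exp_law r. 0 \<le> v"
  unfolding exp_law_def by (subst AE_density) (auto simp: exponential_density_def)

text \<open>The asymmetric Laplace density: the law of \<open>u - v\<close> for independent
  exponential \<open>u\<close> of rate \<open>z\<close> and \<open>v\<close> of rate
  \<open>s\<close>.\<close>

definition diff_density :: "real \<Rightarrow> real \<Rightarrow> real \<Rightarrow> real" where
  "diff_density z s d = z * s / (z + s) * exp (if 0 \<le> d then - z * d else s * d)"

lemma diff_density_measurable [measurable]: "diff_density z s \<in> borel_measurable borel"
  unfolding diff_density_def[abs_def] by measurable

text \<open>Memorylessness: the minimum of two independent exponentials is exponential with the
  summed rate and independent of their difference. In the variables minimum and difference the joint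
  density factorises, on each sign of the difference separately.\<close>

lemma nn_integral_min_diff:
  assumes z: "0 < z" and s: "0 < s" and [measurable]: "F \<in> borel_measurable (borel \<Otimes>\<^sub>M borel)"
  shows "(\<integral>\<^sup>+u. \<integral>\<^sup>+v. F (min u v, u - v) \<partial>exp_law s \<partial>exp_law z) =
    (\<integral>\<^sup>+w. \<integral>\<^sup>+d. ennreal (diff_density z s d) * F (w, d) \<partial>lborel \<partial>exp_law (z + s))"
proof -
  let ?e = "exponential_density"
  have swap: "(\<integral>\<^sup>+x. \<integral>\<^sup>+y. f (x, y) \<partial>lborel \<partial>lborel) = (\<integral>\<^sup>+y. \<integral>\<^sup>+x. f (x, y) \<partial>lborel \<partial>lborel)"
    if "f \<in> borel_measurable (borel \<Otimes>\<^sub>M borel)" for f :: "real \<times> real \<Rightarrow> ennreal"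
    using lborel_pair.Fubini'[of "\<lambda>x y. f (x, y)"] that by (simp add: split_beta')
  have nn: "0 \<le> ?e z x" "0 \<le> ?e s x" "0 \<le> ?e (z + s) x" "0 \<le> diff_density z s d" for x d
    using z s by (auto simp: exponential_density_nonneg diff_density_def)
  have "(\<integral>\<^sup>+u. \<integral>\<^sup>+v. F (min u v, u - v) \<partial>exp_law s \<partial>exp_law z) =
      (\<integral>\<^sup>+u. ennreal (?e z u) * (\<integral>\<^sup>+v. ennreal (?e s v) * F (min u v, u - v) \<partial>lborel) \<partial>lborel)"
    by (simp add: nn_integral_exp_law)
  also have "\<dots> = (\<integral>\<^sup>+u. \<integral>\<^sup>+v. ennreal (?e z u) * (ennreal (?e s v) * F (min u v, u - v)) \<partial>lborel \<partial>lborel)"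
    by (intro nn_integral_cong nn_integral_cmult[symmetric]) measurable
  also have "\<dots> = (\<integral>\<^sup>+v. \<integral>\<^sup>+u. ennreal (?e z u) * (ennreal (?e s v) * F (min u v, u - v)) \<partial>lborel \<partial>lborel)"
    by (rule swap[of "\<lambda>(u, v). ennreal (?e z u) * (ennreal (?e s v) * F (min u v, u - v))", simplified])
  also have "\<dots> = (\<integral>\<^sup>+v. \<integral>\<^sup>+d. ennreal (?e z (v + d)) * (ennreal (?e s v) * F (min (v + d) v, d)) \<partial>lborel \<partial>lborel)"
  proof (rule nn_integral_cong)
    fix v :: real
    show "(\<integral>\<^sup>+u. ennreal (?e z u) * (ennreal (?e s v) * F (min u v, u - v)) \<partial>lborel)
      = (\<integral>\<^sup>+d. ennreal (?e z (v + d)) * (ennreal (?e s v) * F (min (v + d) v, d)) \<partial>lborel)"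
      by (subst nn_integral_real_affine[where c = 1 and t = v]) auto
  qed
  also have "\<dots> = (\<integral>\<^sup>+d. \<integral>\<^sup>+v. ennreal (?e z (v + d)) * (ennreal (?e s v) * F (min (v + d) v, d)) \<partial>lborel \<partial>lborel)"
    by (rule swap[of "\<lambda>(v, d). ennreal (?e z (v + d)) * (ennreal (?e s v) * F (min (v + d) v, d))", simplified])
  also have "\<dots> = (\<integral>\<^sup>+d. \<integral>\<^sup>+w. ennreal (?e (z + s) w) * (ennreal (diff_density z s d) * F (w, d)) \<partial>lborel \<partial>lborel)"
  proof (rule nn_integral_cong)
    fix d :: real
    let ?R = "\<lambda>w. ennreal (?e (z + s) w) * (ennreal (diff_density z s d) * F (w, d))"
    show "(\<integral>\<^sup>+v. ennreal (?e z (v + d)) * (ennreal (?e s v) * F (min (v + d) v, d)) \<partial>lborel) = (\<integral>\<^sup>+w. ?R w \<partial>lborel)"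
    proof (cases "0 \<le> d")
      case True
      have "ennreal (?e z (v + d)) * (ennreal (?e s v) * F (min (v + d) v, d)) = ?R v" for v
      proof -
        have "?e z (v + d) * ?e s v = ?e (z + s) v * diff_density z s d"
          using True z s by (auto simp: exponential_density_def diff_density_def exp_add[symmetric] field_simps)
        then have "ennreal (?e z (v + d)) * ennreal (?e s v) = ennreal (?e (z + s) v) * ennreal (diff_density z s d)"
          using nn by (simp add: ennreal_mult[symmetric])
        with True show ?thesis by (simp add: mult.assoc[symmetric] min_def)
      qed
      then show ?thesis by simp
    next
      case False
      \<comment> \<open>For negative \<open>d\<close> the minimum is \<open>v + d\<close>, and the
        translation makes it the variable of integration.\<close>
      have "(\<integral>\<^sup>+v. ennreal (?e z (v + d)) * (ennreal (?e s v) * F (min (v + d) v, d)) \<partial>lborel)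
        = (\<integral>\<^sup>+w. ennreal (?e z w) * (ennreal (?e s (w - d)) * F (min w (w - d), d)) \<partial>lborel)"
        by (subst nn_integral_real_affine[of _ 1 "- d"]) auto
      also have "\<dots> = (\<integral>\<^sup>+w. ?R w \<partial>lborel)"
      proof (rule nn_integral_cong)
        fix w
        have "?e z w * ?e s (w - d) = ?e (z + s) w * diff_density z s d"
          using False z s by (auto simp: exponential_density_def diff_density_def exp_add[symmetric] field_simps)
        then have "ennreal (?e z w) * ennreal (?e s (w - d)) = ennreal (?e (z + s) w) * ennreal (diff_density z s d)"
          using nn by (simp add: ennreal_mult[symmetric])
        with False show "ennreal (?e z w) * (ennreal (?e s (w - d)) * F (min w (w - d), d)) = ?R w"
          by (simp add: mult.assoc[symmetric] min_def)
      qed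
      finally show ?thesis .
    qed
  qed
  also have "\<dots> = (\<integral>\<^sup>+w. \<integral>\<^sup>+d. ennreal (?e (z + s) w) * (ennreal (diff_density z s d) * F (w, d)) \<partial>lborel \<partial>lborel)"
    by (rule swap[of "\<lambda>(d, w). ennreal (?e (z + s) w) * (ennreal (diff_density z s d) * F (w, d))", simplified])
  also have "\<dots> = (\<integral>\<^sup>+w. ennreal (?e (z + s) w) * (\<integral>\<^sup>+d. ennreal (diff_density z s d) * F (w, d) \<partial>lborel) \<partial>lborel)"
    by (intro nn_integral_cong nn_integral_cmult) measurable
  also have "\<dots> = (\<integral>\<^sup>+w. \<integral>\<^sup>+d. ennreal (diff_density z s d) * F (w, d) \<partial>lborel \<partial>exp_law (z + s))"
    by (simp add: nn_integral_exp_law)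
  finally show ?thesis .
qed

text \<open>Here \<open>u = min u v + max (u - v) 0\<close> and
  \<open>v = min u v + max (v - u) 0\<close>, where \<open>min u v\<close> has rate \<open>r\<close>
  and is independent of \<open>u - v\<close>. The fresh weight \<open>x\<close> has the same two
  properties, so it may replace the minimum without changing the joint law.\<close>

lemma burke_cell:
  assumes z: "0 < z" and r: "z < r" and f [measurable]: "f \<in> borel_measurable (borel \<Otimes>\<^sub>M borel)"
  shows "(\<integral>\<^sup>+x. \<integral>\<^sup>+u. \<integral>\<^sup>+v. f (x + max (u - v) 0, x + max (v - u) 0) \<partial>exp_law (r - z) \<partial>exp_law z \<partial>exp_law r)
    = (\<integral>\<^sup>+u. \<integral>\<^sup>+v. f (u, v) \<partial>exp_law (r - z) \<partial>exp_law z)"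
proof -
  interpret R: prob_space "exp_law r" using z r by (intro prob_space_exp_law) simp
  let ?F = "\<lambda>(w, d). f (w + max d 0, w + max (- d) 0)"
  have rz: "0 < r - z" "z + (r - z) = r" using r by auto
  have "(\<integral>\<^sup>+u. \<integral>\<^sup>+v. f (x + max (u - v) 0, x + max (v - u) 0) \<partial>exp_law (r - z) \<partial>exp_law z)
      = (\<integral>\<^sup>+d. ennreal (diff_density z (r - z) d) * ?F (x, d) \<partial>lborel)" for x
    using nn_integral_min_diff[OF z rz(1), of "\<lambda>(w, d). ?F (x, d)"] unfolding rz(2)
    by (simp add: R.emeasure_space_1[simplified])
  then have "(\<integral>\<^sup>+x. \<integral>\<^sup>+u. \<integral>\<^sup>+v. f (x + max (u - v) 0, x + max (v - u) 0) \<partial>exp_law (r - z) \<partial>exp_law z \<partial>exp_law r)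
      = (\<integral>\<^sup>+x. \<integral>\<^sup>+d. ennreal (diff_density z (r - z) d) * ?F (x, d) \<partial>lborel \<partial>exp_law r)"
    by simp
  also have "\<dots> = (\<integral>\<^sup>+u. \<integral>\<^sup>+v. ?F (min u v, u - v) \<partial>exp_law (r - z) \<partial>exp_law z)"
    using nn_integral_min_diff[OF z rz(1), of ?F] unfolding rz(2) by simp
  also have "\<dots> = (\<integral>\<^sup>+u. \<integral>\<^sup>+v. f (u, v) \<partial>exp_law (r - z) \<partial>exp_law z)"
  proof -
    have "min u v + max (u - v) 0 = u" "min u v + max (- (u - v)) 0 = v" for u v :: real by auto
    then show ?thesis by (simp only: prod.case)
  qed
  finally show ?thesis .
qed

lemma nn_integral_swap:
  assumes "prob_space M" "prob_space N" "(\<lambda>(x, y). f x y) \<in> borel_measurable (M \<Otimes>\<^sub>M N)"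
  shows "(\<integral>\<^sup>+x. \<integral>\<^sup>+y. f x y \<partial>N \<partial>M) = (\<integral>\<^sup>+y. \<integral>\<^sup>+x. f x y \<partial>M \<partial>N)"
proof -
  interpret M: prob_space M by fact
  interpret N: prob_space N by fact
  interpret pair_sigma_finite M N ..
  show ?thesis using Fubini'[OF assms(3)] by simp
qed

text \<open>The order of integration met in the induction along a row, where the left increment is
  passed on from cell to cell and stays outermost.\<close>

lemma burke_cell':
  assumes z: "0 < z" and r: "z < r" and f [measurable]: "f \<in> borel_measurable (borel \<Otimes>\<^sub>M borel)"
  shows "(\<integral>\<^sup>+v. \<integral>\<^sup>+u. \<integral>\<^sup>+x. f (x + max (u - v) 0, x + max (v - u) 0) \<partial>exp_law r \<partial>exp_law z \<partial>exp_law (r - z))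
    = (\<integral>\<^sup>+u. \<integral>\<^sup>+v. f (u, v) \<partial>exp_law (r - z) \<partial>exp_law z)"
proof -
  have p: "prob_space (exp_law r)" "prob_space (exp_law z)" "prob_space (exp_law (r - z))"
    using z r by (auto intro: prob_space_exp_law)
  interpret R: prob_space "exp_law r" by fact
  interpret Z: prob_space "exp_law z" by fact
  interpret V: prob_space "exp_law (r - z)" by fact
  let ?f = "\<lambda>v u x. f (x + max (u - v) 0, x + max (v - u) 0)"
  have "(\<integral>\<^sup>+v. \<integral>\<^sup>+u. \<integral>\<^sup>+x. ?f v u x \<partial>exp_law r \<partial>exp_law z \<partial>exp_law (r - z))
    = (\<integral>\<^sup>+v. \<integral>\<^sup>+x. \<integral>\<^sup>+u. ?f v u x \<partial>exp_law z \<partial>exp_law r \<partial>exp_law (r - z))"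
    by (intro nn_integral_cong nn_integral_swap p) measurable
  also have "\<dots> = (\<integral>\<^sup>+x. \<integral>\<^sup>+v. \<integral>\<^sup>+u. ?f v u x \<partial>exp_law z \<partial>exp_law (r - z) \<partial>exp_law r)"
    by (intro nn_integral_swap p) measurable
  also have "\<dots> = (\<integral>\<^sup>+x. \<integral>\<^sup>+u. \<integral>\<^sup>+v. ?f v u x \<partial>exp_law (r - z) \<partial>exp_law z \<partial>exp_law r)"
    by (intro nn_integral_cong nn_integral_swap p) measurable
  also have "\<dots> = (\<integral>\<^sup>+u. \<integral>\<^sup>+v. f (u, v) \<partial>exp_law (r - z) \<partial>exp_law z)"
    by (rule burke_cell[OF assms])
  finally show ?thesis .
qed

text \<open>One row of the recursion: \<open>u\<close> are the horizontal increments below it, \<open>v\<close> is the increment on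
  its left end and \<open>x\<close> are its weights; \<open>departures v u x\<close> are the horizontal increments above it.\<close>

primrec vertical_increment :: "real \<Rightarrow> (nat \<Rightarrow> real) \<Rightarrow> (nat \<Rightarrow> real) \<Rightarrow> nat \<Rightarrow> real" where
  "vertical_increment v u x 0 = v"
| "vertical_increment v u x (Suc i) = x i + max (vertical_increment v u x i - u i) 0"

definition departures :: "real \<Rightarrow> (nat \<Rightarrow> real) \<Rightarrow> (nat \<Rightarrow> real) \<Rightarrow> nat \<Rightarrow> real" where
  "departures v u x i = x i + max (u i - vertical_increment v u x i) 0"

text \<open>The definition recurses at the right end of the row, whereas a product measure is peeled
  at its first coordinate. After the first cell is removed, the remaining row starts from the
  vertical increment behind that cell.\<close>

lemma vertical_increment_case_nat:
  "vertical_increment v (case_nat a u) (case_nat b x) (Suc i)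
    = vertical_increment (b + max (v - a) 0) u x i"
  by (induction i) auto

lemma departures_case_nat:
  "departures v (case_nat a u) (case_nat b x)
    = case_nat (b + max (a - v) 0) (departures (b + max (v - a) 0) u x)"
  by (auto simp: departures_def fun_eq_iff vertical_increment_case_nat split: nat.split
      simp del: vertical_increment.simps(2))

lemma vertical_increment_measurable [measurable (raw)]:
  assumes a: "a \<in> borel_measurable M" and U: "U \<in> M \<rightarrow>\<^sub>M iid borel" and X: "X \<in> M \<rightarrow>\<^sub>M iid borel"
  shows "(\<lambda>\<omega>. vertical_increment (a \<omega>) (U \<omega>) (X \<omega>) i) \<in> borel_measurable M"
proof (induction i)
  case (Suc i)
  have [measurable]: "(\<lambda>\<omega>. U \<omega> i) \<in> borel_measurable M" "(\<lambda>\<omega>. X \<omega> i) \<in> borel_measurable M"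
    using measurable_compose[OF U measurable_component_singleton[of i UNIV]]
      measurable_compose[OF X measurable_component_singleton[of i UNIV]] by auto
  note [measurable] = Suc
  show ?case by simp
qed (simp add: a)

lemma departures_measurable [measurable (raw)]:
  assumes a [measurable]: "a \<in> borel_measurable M" and U [measurable]: "U \<in> M \<rightarrow>\<^sub>M iid borel"
    and X [measurable]: "X \<in> M \<rightarrow>\<^sub>M iid borel"
  shows "(\<lambda>\<omega>. departures (a \<omega>) (U \<omega>) (X \<omega>)) \<in> M \<rightarrow>\<^sub>M iid borel"
proof (rule measurable_PiM_single')
  fix i
  have [measurable]: "(\<lambda>\<omega>. U \<omega> i) \<in> borel_measurable M" "(\<lambda>\<omega>. X \<omega> i) \<in> borel_measurable M"
    using measurable_compose[OF U measurable_component_singleton[of i UNIV]]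
      measurable_compose[OF X measurable_component_singleton[of i UNIV]] by auto
  show "(\<lambda>\<omega>. departures (a \<omega>) (U \<omega>) (X \<omega>) i) \<in> borel_measurable M"
    unfolding departures_def by measurable
qed auto

text \<open>Filling up with zeros gives a function of the first \<open>n\<close> coordinates without
  leaving the sequence space, so the induction on \<open>n\<close> keeps one type and one product
  measure.\<close>

definition truncate_seq :: "nat \<Rightarrow> (nat \<Rightarrow> real) \<Rightarrow> nat \<Rightarrow> real" where
  "truncate_seq n \<omega> i = (if i < n then \<omega> i else 0)"

lemma truncate_seq_measurable [measurable]: "truncate_seq n \<in> iid borel \<rightarrow>\<^sub>M iid borel"
  by (rule measurable_PiM_single') (auto simp: truncate_seq_def)

lemma truncate_seq_case_nat: "truncate_seq (Suc n) (case_nat a \<omega>) = case_nat a (truncate_seq n \<omega>)"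
  by (auto simp: truncate_seq_def fun_eq_iff split: nat.split)

text \<open>The first cell turns its two incoming increments into a pair of the same law. Its
  horizontal member is the first departure, and its vertical member is an independent left increment
  for the rest of the row, to which the induction hypothesis applies.\<close>

lemma burke_row_truncated:
  assumes z: "0 < z" and r: "z < r" and f: "f \<in> borel_measurable (iid borel)"
  shows "(\<integral>\<^sup>+v. \<integral>\<^sup>+u. \<integral>\<^sup>+x. f (truncate_seq n (departures v u x)) \<partial>iid (exp_law r) \<partial>iid (exp_law z) \<partial>exp_law (r - z))
    = (\<integral>\<^sup>+u. f (truncate_seq n u) \<partial>iid (exp_law z))"
  using f
proof (induction n arbitrary: f)
  have p: "prob_space (exp_law r)" "prob_space (exp_law z)" "prob_space (exp_law (r - z))"
    using z r by (auto intro: prob_space_exp_law)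
  interpret R: prob_space "exp_law r" by fact
  interpret Z: prob_space "exp_law z" by fact
  interpret V: prob_space "exp_law (r - z)" by fact
  have ps: "prob_space (iid (exp_law r))" "prob_space (iid (exp_law z))"
    using p by (auto intro: prob_space_iid)
  interpret RS: prob_space "iid (exp_law r)" by fact
  interpret ZS: prob_space "iid (exp_law z)" by fact
  {
    case 0
    show ?case
      using RS.emeasure_space_1 ZS.emeasure_space_1 V.emeasure_space_1
      by (simp add: truncate_seq_def[abs_def])
  next
    case (Suc n)
    note f [measurable] = Suc.prems
    have [simp]: "\<omega> \<in> space (iid borel)" for \<omega> :: "nat \<Rightarrow> real" by (simp add: space_PiM)
    have [measurable]: "(\<lambda>\<omega>. \<omega>) \<in> iid (exp_law r) \<rightarrow>\<^sub>M iid borel" by (rule measurable_ident_sets) simp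
    let ?e = exp_law
    have "(\<integral>\<^sup>+v. \<integral>\<^sup>+u. \<integral>\<^sup>+x. f (truncate_seq (Suc n) (departures v u x)) \<partial>iid (?e r) \<partial>iid (?e z) \<partial>?e (r - z))
      = (\<integral>\<^sup>+v. \<integral>\<^sup>+a. \<integral>\<^sup>+u. \<integral>\<^sup>+b. \<integral>\<^sup>+x. f (truncate_seq (Suc n) (departures v (case_nat a u) (case_nat b x)))
          \<partial>iid (?e r) \<partial>?e r \<partial>iid (?e z) \<partial>?e z \<partial>?e (r - z))"
      by (intro nn_integral_cong trans[OF nn_integral_iid_iter[OF p(2)]] nn_integral_iid_iter[OF p(1)]) measurable
    also have "\<dots> = (\<integral>\<^sup>+v. \<integral>\<^sup>+a. \<integral>\<^sup>+b. \<integral>\<^sup>+u. \<integral>\<^sup>+x. f (truncate_seq (Suc n) (departures v (case_nat a u) (case_nat b x)))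
          \<partial>iid (?e r) \<partial>iid (?e z) \<partial>?e r \<partial>?e z \<partial>?e (r - z))"
      by (intro nn_integral_cong nn_integral_swap ps p) measurable
    \<comment> \<open>The integrand depends on the first cell only through its two outgoing
      increments, which is the form required by \<open>burke_cell'\<close>.\<close>
    also have "\<dots> = (\<integral>\<^sup>+v. \<integral>\<^sup>+a. \<integral>\<^sup>+b. (\<lambda>(s, t). \<integral>\<^sup>+u. \<integral>\<^sup>+x. f (case_nat s (truncate_seq n (departures t u x)))
          \<partial>iid (?e r) \<partial>iid (?e z)) (b + max (a - v) 0, b + max (v - a) 0) \<partial>?e r \<partial>?e z \<partial>?e (r - z))"
      by (simp add: departures_case_nat truncate_seq_case_nat)
    also have "\<dots> = (\<integral>\<^sup>+a. \<integral>\<^sup>+v. \<integral>\<^sup>+u. \<integral>\<^sup>+x. f (case_nat a (truncate_seq n (departures v u x)))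
          \<partial>iid (?e r) \<partial>iid (?e z) \<partial>?e (r - z) \<partial>?e z)"
      by (subst burke_cell'[OF z r]) auto
    \<comment> \<open>The induction hypothesis is used for the function obtained by freezing the
      first departure \<open>a\<close>.\<close>
    also have "\<dots> = (\<integral>\<^sup>+a. \<integral>\<^sup>+u. f (case_nat a (truncate_seq n u)) \<partial>iid (?e z) \<partial>?e z)"
      by (intro nn_integral_cong Suc.IH[of "\<lambda>\<omega>. f (case_nat _ \<omega>)"]) measurable
    also have "\<dots> = (\<integral>\<^sup>+u. f (truncate_seq (Suc n) u) \<partial>iid (?e z))"
      by (subst (2) nn_integral_iid_iter[OF p(2)]) (auto simp: truncate_seq_case_nat)
    finally show ?case .
  }
qed

text \<open>Cylinder sets determine a finite measure on the infinite product, and each of them is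
  unaffected by truncation beyond its finitely many coordinates.\<close>

lemma burke_row:
  assumes z: "0 < z" and r: "z < r" and f [measurable]: "f \<in> borel_measurable (iid borel)"
  shows "(\<integral>\<^sup>+v. \<integral>\<^sup>+u. \<integral>\<^sup>+x. f (departures v u x) \<partial>iid (exp_law r) \<partial>iid (exp_law z) \<partial>exp_law (r - z))
    = (\<integral>\<^sup>+u. f u \<partial>iid (exp_law z))"
proof -
  have p: "prob_space (exp_law r)" "prob_space (exp_law z)" "prob_space (exp_law (r - z))"
    using z r by (auto intro: prob_space_exp_law)
  interpret V: prob_space "exp_law (r - z)" by fact
  have ps: "prob_space (iid (exp_law r))" "prob_space (iid (exp_law z))"
    using p by (auto intro: prob_space_iid)
  interpret RS: prob_space "iid (exp_law r)" by fact
  interpret ZS: prob_space "iid (exp_law z)" by fact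
  let ?P = "exp_law (r - z) \<Otimes>\<^sub>M (iid (exp_law z) \<Otimes>\<^sub>M iid (exp_law r))"
  interpret ZR: pair_prob_space "iid (exp_law z)" "iid (exp_law r)" ..
  interpret P: pair_prob_space "exp_law (r - z)" "iid (exp_law z) \<Otimes>\<^sub>M iid (exp_law r)" ..
  let ?d = "\<lambda>(v, u, x). departures v u x"
  have d [measurable]: "?d \<in> ?P \<rightarrow>\<^sub>M iid borel" by (simp add: split_beta')
  have int: "(\<integral>\<^sup>+\<omega>. g \<omega> \<partial>distr ?P (iid borel) ?d)
     = (\<integral>\<^sup>+v. \<integral>\<^sup>+u. \<integral>\<^sup>+x. g (departures v u x) \<partial>iid (exp_law r) \<partial>iid (exp_law z) \<partial>exp_law (r - z))"
    if [measurable]: "g \<in> borel_measurable (iid borel)" for g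
  proof -
    have "(\<integral>\<^sup>+\<omega>. g \<omega> \<partial>distr ?P (iid borel) ?d) = (\<integral>\<^sup>+p. g (?d p) \<partial>?P)"
      by (rule nn_integral_distr) measurable
    also have "\<dots> = (\<integral>\<^sup>+v. \<integral>\<^sup>+q. g (?d (v, q)) \<partial>(iid (exp_law z) \<Otimes>\<^sub>M iid (exp_law r)) \<partial>exp_law (r - z))"
      by (rule ZR.nn_integral_fst[symmetric]) measurable
    also have "\<dots> = (\<integral>\<^sup>+v. \<integral>\<^sup>+u. \<integral>\<^sup>+x. g (?d (v, u, x)) \<partial>iid (exp_law r) \<partial>iid (exp_law z) \<partial>exp_law (r - z))"
      by (intro nn_integral_cong RS.nn_integral_fst[symmetric]) measurable
    finally show ?thesis by simp
  qed
  have "iid (exp_law z) = distr ?P (iid borel) ?d"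
  proof (rule measure_eqI_PiM_infinite[where I = UNIV and M = "\<lambda>_. borel"])
    show "finite_measure (iid (exp_law z))" by (rule ZS.finite_measure)
    fix A and J :: "nat set" assume J: "finite J" "\<And>i. i \<in> J \<Longrightarrow> A i \<in> sets (borel :: real measure)"
    let ?X = "prod_emb UNIV (\<lambda>_. borel) J (Pi\<^sub>E J A)"
    have X [measurable]: "?X \<in> sets (iid borel)" using J by (intro sets_PiM_I) auto
    obtain n where n: "\<forall>j\<in>J. j < n" using finite_nat_bounded[OF J(1)] by blast
    have eq: "indicator ?X (truncate_seq n \<omega>) = (indicator ?X \<omega> :: ennreal)" for \<omega>
      using n by (auto simp: indicator_def prod_emb_def PiE_iff truncate_seq_def)
    have "emeasure (iid (exp_law z)) ?X = (\<integral>\<^sup>+u. indicator ?X u \<partial>iid (exp_law z))"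
      by (simp add: nn_integral_indicator)
    also have "\<dots> = (\<integral>\<^sup>+v. \<integral>\<^sup>+u. \<integral>\<^sup>+x. indicator ?X (departures v u x) \<partial>iid (exp_law r) \<partial>iid (exp_law z) \<partial>exp_law (r - z))"
      using burke_row_truncated[OF z r, of "indicator ?X" n] by (simp add: eq)
    also have "\<dots> = emeasure (distr ?P (iid borel) ?d) ?X"
      by (subst int[symmetric]) auto
    finally show "emeasure (iid (exp_law z)) ?X = emeasure (distr ?P (iid borel) ?d) ?X" .
  qed auto
  with int[OF f] show ?thesis by simp
qed

section \<open>Events of probability tending to one\<close>

text \<open>The inner sets \<open>A n\<close> carry the measurability, so \<open>P n\<close> itself
  may be an arbitrary predicate and weakening it costs nothing.\<close>

definition whp :: "'a measure \<Rightarrow> (nat \<Rightarrow> 'a \<Rightarrow> bool) \<Rightarrow> bool" where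
  "whp N P \<longleftrightarrow> (\<exists>A. (\<forall>n. A n \<in> sets N \<and> (\<forall>\<omega>\<in>A n. P n \<omega>)) \<and> (\<lambda>n. measure N (A n)) \<longlonglongrightarrow> 1)"

lemma whpI:
  "(\<And>n. A n \<in> sets N) \<Longrightarrow> (\<And>n \<omega>. \<omega> \<in> A n \<Longrightarrow> P n \<omega>) \<Longrightarrow> (\<lambda>n. measure N (A n)) \<longlonglongrightarrow> 1 \<Longrightarrow> whp N P"
  unfolding whp_def by blast

lemma whp_mono: "whp N P \<Longrightarrow> (\<And>n \<omega>. P n \<omega> \<Longrightarrow> Q n \<omega>) \<Longrightarrow> whp N Q"
  unfolding whp_def by blast

lemma whp_subseq:
  assumes "whp N P" "filterlim g at_top sequentially"
  shows "whp N (\<lambda>n. P (g n))"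
proof -
  obtain A where A: "\<And>n. A n \<in> sets N" "\<And>n \<omega>. \<omega> \<in> A n \<Longrightarrow> P n \<omega>" "(\<lambda>n. measure N (A n)) \<longlonglongrightarrow> 1"
    using assms(1) unfolding whp_def by blast
  show ?thesis
    using A filterlim_compose[OF A(3) assms(2)] by (intro whpI[of "\<lambda>n. A (g n)"]) auto
qed

context prob_space begin

lemma whp_conj:
  assumes "whp M P" "whp M Q"
  shows "whp M (\<lambda>n \<omega>. P n \<omega> \<and> Q n \<omega>)"
proof -
  obtain A where A: "\<And>n. A n \<in> sets M" "\<And>n \<omega>. \<omega> \<in> A n \<Longrightarrow> P n \<omega>" "(\<lambda>n. measure M (A n)) \<longlonglongrightarrow> 1"
    using assms(1) unfolding whp_def by blast
  obtain B where B: "\<And>n. B n \<in> sets M" "\<And>n \<omega>. \<omega> \<in> B n \<Longrightarrow> Q n \<omega>" "(\<lambda>n. measure M (B n)) \<longlonglongrightarrow> 1"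
    using assms(2) unfolding whp_def by blast
  have "prob (A n) + prob (B n) - 1 \<le> prob (A n \<inter> B n)" for n
  proof -
    have "prob (A n \<union> B n) = prob (A n) + prob (B n) - prob (A n \<inter> B n)"
      using A(1) B(1) by (intro measure_Un3) (auto simp: fmeasurable_eq_sets)
    with prob_le_1[of "A n \<union> B n"] show ?thesis by linarith
  qed
  then have 1: "eventually (\<lambda>n. prob (A n) + prob (B n) - 1 \<le> prob (A n \<inter> B n)) sequentially"
    by (intro always_eventually allI)
  have 2: "(\<lambda>n. prob (A n) + prob (B n) - 1) \<longlonglongrightarrow> 1"
    using tendsto_diff[OF tendsto_add[OF A(3) B(3)] tendsto_const[of 1]] by simp
  have 3: "eventually (\<lambda>n. prob (A n \<inter> B n) \<le> 1) sequentially"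
    by (intro always_eventually allI prob_le_1)
  show ?thesis
  proof (rule whpI[of "\<lambda>n. A n \<inter> B n"])
    show "(\<lambda>n. prob (A n \<inter> B n)) \<longlonglongrightarrow> 1" by (rule tendsto_sandwich[OF 1 3 2 tendsto_const])
  qed (use A(1,2) B(1,2) in \<open>auto intro: sets.Int\<close>)
qed

lemma whp_AE:
  assumes "AE \<omega> in M. P \<omega>"
  shows "whp M (\<lambda>n. P)"
proof -
  obtain N where N: "{\<omega> \<in> space M. \<not> P \<omega>} \<subseteq> N" "emeasure M N = 0" "N \<in> sets M"
    using AE_E[OF assms] by blast
  have "prob (space M - N) = 1"
    using N by (subst prob_compl) (auto simp: measure_def)
  with N show ?thesis by (intro whpI[of "\<lambda>_. space M - N"]) auto
qed

lemma whp_ball: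
  assumes "finite I" "\<And>i. i \<in> I \<Longrightarrow> whp M (P i)"
  shows "whp M (\<lambda>n \<omega>. \<forall>i\<in>I. P i n \<omega>)"
  using assms
proof (induction I)
  case empty
  then show ?case using whp_AE[of "\<lambda>_. True"] by simp
next
  case (insert i I)
  then show ?case using whp_conj[of "P i" "\<lambda>n \<omega>. \<forall>i\<in>I. P i n \<omega>"] by (simp add: conj_commute)
qed

lemma whp_witness:
  assumes "whp M P"
  shows "eventually (\<lambda>n. \<exists>\<omega>\<in>space M. P n \<omega>) sequentially"
proof -
  obtain A where A: "\<And>n. A n \<in> sets M" "\<And>n \<omega>. \<omega> \<in> A n \<Longrightarrow> P n \<omega>" "(\<lambda>n. measure M (A n)) \<longlonglongrightarrow> 1"
    using assms unfolding whp_def by blast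
  have "eventually (\<lambda>n. 0 < prob (A n)) sequentially"
    using order_tendstoD(1)[OF A(3), of 0] by simp
  then show ?thesis
  proof eventually_elim
    case (elim n)
    then have "A n \<noteq> {}" by auto
    then show ?case using A(2)[of _ n] sets.sets_into_space[OF A(1)[of n]] by blast
  qed
qed

text \<open>The map may depend on \<open>n\<close> as long as each one has image law
  \<open>N\<close>. This is what lets the origin of a passage time, or the height of a row, move
  with \<open>n\<close>.\<close>

lemma whp_distr:
  assumes "whp N P" "\<And>n. f n \<in> M \<rightarrow>\<^sub>M N" "\<And>n. distr M N (f n) = N"
  shows "whp M (\<lambda>n \<omega>. P n (f n \<omega>))"
proof -
  obtain A where A: "\<And>n. A n \<in> sets N" "\<And>n \<omega>. \<omega> \<in> A n \<Longrightarrow> P n \<omega>" "(\<lambda>n. measure N (A n)) \<longlonglongrightarrow> 1"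
    using assms(1) unfolding whp_def by blast
  have "prob (f n -` A n \<inter> space M) = measure N (A n)" for n
    using measure_distr[OF assms(2) A(1), of n n] assms(3)[of n] by simp
  with A assms(2) show ?thesis
    by (intro whpI[of "\<lambda>n. f n -` A n \<inter> space M"]) (auto intro: measurable_sets)
qed

text \<open>Almost sure convergence implies convergence in probability, by dominated convergence of
  the indicators.\<close>

lemma whp_tendsto:
  fixes Z :: "nat \<Rightarrow> 'a \<Rightarrow> real"
  assumes [measurable]: "\<And>n. Z n \<in> borel_measurable M"
    and lim: "AE \<omega> in M. (\<lambda>n. Z n \<omega>) \<longlonglongrightarrow> a" and e: "0 < e"
  shows "whp M (\<lambda>n \<omega>. \<bar>Z n \<omega> - a\<bar> < e)"
proof (rule whpI)
  let ?A = "\<lambda>n. {\<omega> \<in> space M. \<bar>Z n \<omega> - a\<bar> < e}"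
  show "?A n \<in> sets M" for n by measurable
  have "(\<lambda>n. \<integral>\<omega>. indicator (?A n) \<omega> \<partial>M) \<longlonglongrightarrow> (\<integral>\<omega>. (1 :: real) \<partial>M)"
  proof (rule integral_dominated_convergence[where w = "\<lambda>_. 1"])
    show "AE \<omega> in M. (\<lambda>n. indicator (?A n) \<omega> :: real) \<longlonglongrightarrow> 1"
      using lim AE_space
    proof eventually_elim
      case (elim \<omega>)
      have "eventually (\<lambda>n. dist (Z n \<omega>) a < e) sequentially" using elim(1) e by (rule tendstoD)
      then have "eventually (\<lambda>n. indicator (?A n) \<omega> = (1 :: real)) sequentially"
        by eventually_elim (simp add: elim dist_real_def)
      then show ?case by (rule tendsto_eventually)
    qed
  qed (auto simp: indicator_def)
  then show "(\<lambda>n. prob (?A n)) \<longlonglongrightarrow> 1" by (simp add: prob_space)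
qed auto

end

text \<open>Chebyshev's inequality: the centred variables are orthogonal, so their sum has second
  moment \<open>n * V\<close> and the exceptional event has probability at most
  \<open>V / e^2 / n\<close>.\<close>

lemma weak_law_of_large_numbers:
  fixes h :: "'a \<Rightarrow> real"
  assumes K: "prob_space K" and [measurable]: "h \<in> borel_measurable K"
    and sq: "integrable K (\<lambda>x. (h x)\<^sup>2)" and e: "0 < e"
  shows "whp (iid K) (\<lambda>n \<omega>. \<bar>(\<Sum>i<n. h (\<omega> i)) - real n * integral\<^sup>L K h\<bar> \<le> e * real n)"
proof -
  interpret K: prob_space K by fact
  interpret S: prob_space "iid K" using K by (rule prob_space_iid)
  interpret P: product_prob_space "\<lambda>_::nat. K" UNIV by unfold_locales
  define \<mu> where "\<mu> = integral\<^sup>L K h"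
  define Y where "Y = (\<lambda>i (\<omega> :: nat \<Rightarrow> 'a). h (\<omega> i) - \<mu>)"
  have int: "integrable K h" by (rule K.square_integrable_imp_integrable[OF _ sq]) measurable
  have Ym [measurable]: "Y i \<in> borel_measurable (iid K)" for i unfolding Y_def by measurable
  have comp: "distr (iid K) K (\<lambda>\<omega>. \<omega> i) = K" for i using P.PiM_component[of i] by simp
  have intg: "integrable (iid K) (\<lambda>\<omega>. g (\<omega> i)) \<longleftrightarrow> integrable K g"
    and exp: "(\<integral>\<omega>. g (\<omega> i) \<partial>iid K) = integral\<^sup>L K g"
    if [measurable]: "g \<in> borel_measurable K" for g :: "'a \<Rightarrow> real" and i
    using integrable_distr_eq[of "\<lambda>\<omega>. \<omega> i" "iid K" K g] integral_distr[of "\<lambda>\<omega>. \<omega> i" "iid K" K g]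
    by (simp_all add: comp)
  have "S.indep_vars (\<lambda>_. K) (\<lambda>i \<omega>. \<omega> i) UNIV"
    using S.indep_vars_iff_distr_eq_PiM[where I = "UNIV :: nat set" and M' = "\<lambda>_. K" and X = "\<lambda>i \<omega>. \<omega> i"]
    by (simp add: comp restrict_UNIV distr_id2)
  then have "S.indep_vars (\<lambda>_. borel) Y UNIV"
    unfolding Y_def by (rule S.indep_vars_compose2) auto
  then have ind: "S.indep_vars (\<lambda>_. borel) Y I" for I by (rule S.indep_vars_subset) auto
  have intY: "integrable (iid K) (Y i)" for i unfolding Y_def using int intg[of h i] by simp
  have EY: "(\<integral>\<omega>. Y i \<omega> \<partial>iid K) = 0" for i
    unfolding Y_def using int intg[of h i] exp[of h i] S.prob_space by (simp add: \<mu>_def)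
  have sq': "integrable K (\<lambda>x. (h x - \<mu>)\<^sup>2)"
    using sq int by (simp add: power2_diff)
  have prod: "integrable (iid K) (\<lambda>\<omega>. Y i \<omega> * Y j \<omega>) \<and>
    (\<integral>\<omega>. Y i \<omega> * Y j \<omega> \<partial>iid K) = (if i = j then (\<integral>x. (h x - \<mu>)\<^sup>2 \<partial>K) else 0)" for i j
  proof (cases "i = j")
    case True
    then show ?thesis
      using sq' intg[of "\<lambda>x. (h x - \<mu>)\<^sup>2" j] exp[of "\<lambda>x. (h x - \<mu>)\<^sup>2" j]
      by (simp add: Y_def power2_eq_square)
  next
    case False
    then show ?thesis
      using S.indep_vars_integrable[of "{i, j}" Y] S.indep_vars_lebesgue_integral[of "{i, j}" Y] ind intY EY
      by simp
  qed
  define V where "V = (\<integral>x. (h x - \<mu>)\<^sup>2 \<partial>K)"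
  have V: "0 \<le> V" unfolding V_def by simp
  have sum_sq: "(\<Sum>i<n. Y i \<omega>)\<^sup>2 = (\<Sum>i<n. \<Sum>j<n. Y i \<omega> * Y j \<omega>)" for n \<omega>
    by (simp add: power2_eq_square sum_product)
  have int_sum: "integrable (iid K) (\<lambda>\<omega>. (\<Sum>i<n. Y i \<omega>)\<^sup>2)" for n
    unfolding sum_sq using prod by auto
  have var: "(\<integral>\<omega>. (\<Sum>i<n. Y i \<omega>)\<^sup>2 \<partial>iid K) = real n * V" for n
    unfolding sum_sq using prod by (simp add: Bochner_Integration.integral_sum V_def)
  let ?A = "\<lambda>n. {\<omega> \<in> space (iid K). \<bar>\<Sum>i<n. Y i \<omega>\<bar> \<le> e * real n}"
  let ?B = "\<lambda>n. {\<omega> \<in> space (iid K). (e * real n)\<^sup>2 \<le> (\<Sum>i<n. Y i \<omega>)\<^sup>2}"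
  have bound: "1 - V / e\<^sup>2 / real n \<le> S.prob (?A n)" if n: "0 < n" for n
  proof -
    have "S.prob (?B n) \<le> (\<integral>\<omega>. (\<Sum>i<n. Y i \<omega>)\<^sup>2 \<partial>iid K) / (e * real n)\<^sup>2"
      using int_sum e n by (intro integral_Markov_inequality_measure[where A = "{}"]) auto
    also have "\<dots> = V / e\<^sup>2 / real n" unfolding var using n by (simp add: power2_eq_square)
    finally have B: "S.prob (?B n) \<le> V / e\<^sup>2 / real n" .
    have "space (iid K) - ?A n \<subseteq> ?B n"
      using e n by (auto simp: abs_le_square_iff[symmetric] not_le abs_mult)
    then have "S.prob (space (iid K) - ?A n) \<le> S.prob (?B n)" by (intro S.finite_measure_mono) auto
    moreover have "S.prob (space (iid K) - ?A n) = 1 - S.prob (?A n)" by (intro S.prob_compl) measurable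
    ultimately show ?thesis using B by linarith
  qed
  have "whp (iid K) (\<lambda>n \<omega>. \<bar>\<Sum>i<n. Y i \<omega>\<bar> \<le> e * real n)"
  proof (rule whpI[of ?A])
    have "(\<lambda>n. 1 - V / e\<^sup>2 / real n) \<longlonglongrightarrow> 1 - 0"
      by (intro tendsto_diff tendsto_const tendsto_divide_0[OF tendsto_const] filterlim_at_top_imp_at_infinity filterlim_real_sequentially)
    then have lim: "(\<lambda>n. 1 - V / e\<^sup>2 / real n) \<longlonglongrightarrow> 1" by simp
    show "(\<lambda>n. S.prob (?A n)) \<longlonglongrightarrow> 1"
    proof (rule tendsto_sandwich[OF _ _ lim tendsto_const])
      show "eventually (\<lambda>n. 1 - V / e\<^sup>2 / real n \<le> S.prob (?A n)) sequentially"
        using eventually_gt_at_top[of 0] by eventually_elim (rule bound)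
    qed (simp add: S.prob_le_1)
  qed auto
  moreover have "(\<Sum>i<n. Y i \<omega>) = (\<Sum>i<n. h (\<omega> i)) - real n * \<mu>" for n \<omega>
    by (simp add: Y_def sum_subtractf)
  ultimately show ?thesis by (simp add: \<mu>_def)
qed

section \<open>The boundary model as a stack of independent rows\<close>

type_synonym row = "real \<times> real \<times> (nat \<Rightarrow> real)"

abbreviation row_tail_space :: "(real \<times> (nat \<Rightarrow> real)) measure" where
  "row_tail_space \<equiv> borel \<Otimes>\<^sub>M iid borel"

abbreviation row_space :: "row measure" where
  "row_space \<equiv> borel \<Otimes>\<^sub>M row_tail_space"

text \<open>A row carries its rate, the exponential variable behind its boundary weight and those behind its
  bulk weights; all are standard, and are divided by the actual rate when used.\<close>

definition row_law :: "real measure \<Rightarrow> row measure" where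
  "row_law m = m \<Otimes>\<^sub>M (exp_law 1 \<Otimes>\<^sub>M iid (exp_law 1))"

definition row_weight :: "(nat \<Rightarrow> row) \<Rightarrow> nat \<times> nat \<Rightarrow> real" where
  "row_weight \<rho> = (\<lambda>(i, j). snd (snd (\<rho> j)) i / fst (\<rho> j))"

definition left_weight :: "real \<Rightarrow> row \<Rightarrow> real" where
  "left_weight z = (\<lambda>(r, v, x). v / (r - z))"

definition row_step :: "real \<Rightarrow> row \<Rightarrow> (nat \<Rightarrow> real) \<Rightarrow> nat \<Rightarrow> real" where
  "row_step z = (\<lambda>(r, v, x) u. departures (v / (r - z)) u (\<lambda>i. x i / r))"

primrec level :: "real \<Rightarrow> (nat \<Rightarrow> row) \<Rightarrow> (nat \<Rightarrow> real) \<Rightarrow> nat \<Rightarrow> nat \<Rightarrow> real" where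
  "level z \<rho> u 0 = u"
| "level z \<rho> u (Suc l) = row_step z (\<rho> l) (level z \<rho> u l)"

text \<open>The definition adds rows on top; here the bottom row is peeled off, so that it acts
  directly on the stationary input.\<close>

lemma level_case_nat: "level z (case_nat s \<rho>) u (Suc l) = level z \<rho> (row_step z s u) l"
  by (induction l) auto

text \<open>With \<open>u\<close> the increment below a cell and \<open>v\<close> the one to its
  left, the recursion for passage times yields \<open>x + max (u - v) 0\<close> above and
  \<open>x + max (v - u) 0\<close> to the right. This is the rule defining \<open>departures\<close>
  and \<open>vertical_increment\<close>.\<close>

lemma boundary_passage_increments:
  defines "B \<equiv> \<lambda>\<rho> z u. boundary_passage u (\<lambda>j. left_weight z (\<rho> j)) (row_weight \<rho>)"
  shows "B \<rho> z u (Suc k) l - B \<rho> z u k l = level z \<rho> u l k"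
proof (induction l arbitrary: k)
  case 0
  then show ?case by (simp add: B_def)
next
  case (Suc l)
  let ?v = "vertical_increment (left_weight z (\<rho> l)) (level z \<rho> u l) (\<lambda>i. row_weight \<rho> (i, l))"
  have rec: "B \<rho> z u (Suc k) (Suc l) = row_weight \<rho> (k, l) + max (B \<rho> z u k (Suc l)) (B \<rho> z u (Suc k) l)" for k
    by (simp add: B_def)
  \<comment> \<open>The vertical increments of the new row come from an inner induction along the
    row, fed by the outer hypothesis on the horizontal increments below it.\<close>
  have v: "B \<rho> z u k (Suc l) - B \<rho> z u k l = ?v k" for k
  proof (induction k)
    case 0
    then show ?case by (simp add: B_def)
  next
    case (Suc k)
    with Suc.IH rec[of k] \<open>\<And>k. B \<rho> z u (Suc k) l - B \<rho> z u k l = level z \<rho> u l k\<close>[of k]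
    show ?case by (simp add: max_def)
  qed
  have "row_step z (\<rho> l) (level z \<rho> u l) k = row_weight \<rho> (k, l) + max (level z \<rho> u l k - ?v k) 0"
    by (simp add: row_step_def departures_def left_weight_def row_weight_def split: prod.split)
  with v[of k] Suc.IH[of k] rec[of k] show ?case by (simp add: max_def)
qed

text \<open>Telescoping up the vertical axis and then along height \<open>l\<close>. The maximum
  over paths has disappeared: what remains are two sums, each obeying a weak law, whatever the
  dependence between them.\<close>

lemma boundary_passage_eq_sum_level:
  "boundary_passage u (\<lambda>j. left_weight z (\<rho> j)) (row_weight \<rho>) n l
     = (\<Sum>j<l. left_weight z (\<rho> j)) + (\<Sum>k<n. level z \<rho> u l k)"
proof (induction n)
  case (Suc n)
  with boundary_passage_increments[of u z \<rho> n l] show ?case by simp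
qed simp

lemma scale_measurable: "(\<lambda>x i. x i / r) \<in> iid (exp_law 1) \<rightarrow>\<^sub>M iid borel" for r :: real
  by (rule measurable_PiM_single') auto

lemma distr_iid_exp_law_scale:
  assumes r: "0 < r"
  shows "distr (iid (exp_law 1)) (iid borel) (\<lambda>x i. x i / r) = iid (exp_law r)"
proof -
  have p: "prob_space (exp_law 1)" by (rule prob_space_exp_law) simp
  have 1: "(\<lambda>x. x / r) \<in> exp_law 1 \<rightarrow>\<^sub>M borel" by measurable
  show ?thesis using distr_iid[OF p 1] unfolding exp_law_scale[OF r] .
qed

lemma nn_integral_iid_exp_law_scale:
  assumes r: "0 < r" and [measurable]: "g \<in> borel_measurable (iid borel)"
  shows "(\<integral>\<^sup>+x. g (\<lambda>i. x i / r) \<partial>iid (exp_law 1)) = (\<integral>\<^sup>+x. g x \<partial>iid (exp_law r))"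
  unfolding distr_iid_exp_law_scale[OF r, symmetric]
  by (rule nn_integral_distr[symmetric, OF scale_measurable]) simp

lemma nn_integral_exp_law_scale:
  assumes r: "0 < r" and [measurable]: "g \<in> borel_measurable borel"
  shows "(\<integral>\<^sup>+x. g (x / r) \<partial>exp_law 1) = (\<integral>\<^sup>+x. g x \<partial>exp_law r)"
  unfolding exp_law_scale[OF r, symmetric]
  by (rule nn_integral_distr[symmetric]) measurable

locale rate_law = prob_space m for m :: "real measure" +
  fixes c :: real
  assumes sets_m [measurable_cong, simp]: "sets m = sets borel"
    and c_pos: "0 < c" and rate_ge: "AE r in m. c \<le> r"
begin

lemma space_m [simp]: "space m = UNIV"
  using sets_eq_imp_space_eq[OF sets_m] by simp

lemma prob_space_row_law: "prob_space (row_law m)"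
proof -
  interpret E: prob_space "exp_law 1" by (rule prob_space_exp_law) simp
  interpret S: prob_space "iid (exp_law 1)" by (rule prob_space_iid) unfold_locales
  interpret ES: pair_prob_space "exp_law 1" "iid (exp_law 1)" ..
  interpret P: pair_prob_space m "exp_law 1 \<Otimes>\<^sub>M iid (exp_law 1)" ..
  show ?thesis unfolding row_law_def by unfold_locales
qed

lemma sets_row_law [measurable_cong, simp]:
  "sets (row_law m) = sets row_space"
  unfolding row_law_def by (intro sets_pair_measure_cong) auto

lemma sets_iid_row_law [measurable_cong, simp]:
  "sets (iid (row_law m)) = sets (iid row_space)"
  by (intro sets_PiM_cong) auto

lemma nn_integral_row_law:
  assumes [measurable]: "f \<in> borel_measurable row_space"
  shows "(\<integral>\<^sup>+s. f s \<partial>row_law m) = (\<integral>\<^sup>+r. \<integral>\<^sup>+v. \<integral>\<^sup>+x. f (r, v, x) \<partial>iid (exp_law 1) \<partial>exp_law 1 \<partial>m)"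
proof -
  interpret E: prob_space "exp_law 1" by (rule prob_space_exp_law) simp
  interpret S: prob_space "iid (exp_law 1)" by (rule prob_space_iid) unfold_locales
  interpret ES: pair_prob_space "exp_law 1" "iid (exp_law 1)" ..
  have "(\<integral>\<^sup>+s. f s \<partial>row_law m)
      = (\<integral>\<^sup>+r. \<integral>\<^sup>+q. f (r, q) \<partial>(exp_law 1 \<Otimes>\<^sub>M iid (exp_law 1)) \<partial>m)"
    unfolding row_law_def by (rule ES.nn_integral_fst[symmetric]) measurable
  also have "\<dots> = (\<integral>\<^sup>+r. \<integral>\<^sup>+v. \<integral>\<^sup>+x. f (r, v, x) \<partial>iid (exp_law 1) \<partial>exp_law 1 \<partial>m)"
    by (intro nn_integral_cong S.nn_integral_fst[symmetric]) measurable
  finally show ?thesis .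
qed

lemma row_step_measurable [measurable (raw)]:
  assumes [measurable]: "s \<in> N \<rightarrow>\<^sub>M row_space" "u \<in> N \<rightarrow>\<^sub>M iid borel"
  shows "(\<lambda>\<omega>. row_step z (s \<omega>) (u \<omega>)) \<in> N \<rightarrow>\<^sub>M iid borel"
proof -
  have "(\<lambda>\<omega>. snd (snd (s \<omega>)) i) \<in> borel_measurable N" for i
    by (rule measurable_compose[OF _ measurable_component_singleton[of i UNIV]]) auto
  then have [measurable]: "(\<lambda>\<omega> i. snd (snd (s \<omega>)) i / fst (s \<omega>)) \<in> N \<rightarrow>\<^sub>M iid borel"
    by (intro measurable_PiM_single') auto
  show ?thesis unfolding row_step_def split_beta' by measurable
qed

text \<open>For a fixed rate \<open>r\<close> the standard variables rescale to the laws of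
  \<open>burke_row\<close>. The output law does not depend on \<open>r\<close>, so averaging over
  the random rate preserves it.\<close>

lemma nn_integral_row_step:
  assumes z: "0 < z" "z < c" and f [measurable]: "f \<in> borel_measurable (iid borel)"
  shows "(\<integral>\<^sup>+s. \<integral>\<^sup>+u. f (row_step z s u) \<partial>iid (exp_law z) \<partial>row_law m) = (\<integral>\<^sup>+u. f u \<partial>iid (exp_law z))"
proof -
  have pz: "prob_space (iid (exp_law z))" "prob_space (iid (exp_law 1))"
    using z by (simp_all add: prob_space_iid prob_space_exp_law)
  interpret Z: prob_space "iid (exp_law z)" by fact
  interpret S: prob_space "iid (exp_law 1)" by fact
  have [measurable]: "(\<lambda>\<omega>. \<omega>) \<in> iid (exp_law r) \<rightarrow>\<^sub>M iid borel" for r by (rule measurable_ident_sets) simp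
  have [simp]: "\<omega> \<in> space (iid borel)" for \<omega> :: "nat \<Rightarrow> real" by (simp add: space_PiM)
  have "(\<integral>\<^sup>+s. \<integral>\<^sup>+u. f (row_step z s u) \<partial>iid (exp_law z) \<partial>row_law m)
    = (\<integral>\<^sup>+r. \<integral>\<^sup>+v. \<integral>\<^sup>+x. \<integral>\<^sup>+u. f (row_step z (r, v, x) u) \<partial>iid (exp_law z) \<partial>iid (exp_law 1) \<partial>exp_law 1 \<partial>m)"
    by (rule nn_integral_row_law) measurable
  also have "\<dots> = (\<integral>\<^sup>+r. (\<integral>\<^sup>+u. f u \<partial>iid (exp_law z)) \<partial>m)"
  proof (rule nn_integral_cong_AE)
    show "AE r in m. (\<integral>\<^sup>+v. \<integral>\<^sup>+x. \<integral>\<^sup>+u. f (row_step z (r, v, x) u) \<partial>iid (exp_law z) \<partial>iid (exp_law 1) \<partial>exp_law 1)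
      = (\<integral>\<^sup>+u. f u \<partial>iid (exp_law z))"
      using rate_ge
    proof eventually_elim
      case (elim r)
      then have r: "z < r" "0 < r" "0 < r - z" using z by auto
      have pr: "prob_space (iid (exp_law r))" "prob_space (exp_law 1)" "prob_space (exp_law r)"
        using r by (auto intro: prob_space_iid prob_space_exp_law)
      interpret R: prob_space "iid (exp_law r)" by fact
      have "(\<integral>\<^sup>+v. \<integral>\<^sup>+x. \<integral>\<^sup>+u. f (row_step z (r, v, x) u) \<partial>iid (exp_law z) \<partial>iid (exp_law 1) \<partial>exp_law 1)
        = (\<integral>\<^sup>+v. \<integral>\<^sup>+x. \<integral>\<^sup>+u. f (departures (v / (r - z)) u (\<lambda>i. x i / r)) \<partial>iid (exp_law z) \<partial>iid (exp_law 1) \<partial>exp_law 1)"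
        by (simp add: row_step_def)
      also have "\<dots> = (\<integral>\<^sup>+v. \<integral>\<^sup>+x. \<integral>\<^sup>+u. f (departures (v / (r - z)) u x) \<partial>iid (exp_law z) \<partial>iid (exp_law r) \<partial>exp_law 1)"
        by (rule nn_integral_cong, rule nn_integral_iid_exp_law_scale[OF r(2),
              of "\<lambda>x. \<integral>\<^sup>+u. f (departures (_ / (r - z)) u x) \<partial>iid (exp_law z)"]) measurable
      also have "\<dots> = (\<integral>\<^sup>+v. \<integral>\<^sup>+x. \<integral>\<^sup>+u. f (departures v u x) \<partial>iid (exp_law z) \<partial>iid (exp_law r) \<partial>exp_law (r - z))"
        by (rule nn_integral_exp_law_scale[OF r(3),
              of "\<lambda>v. \<integral>\<^sup>+x. \<integral>\<^sup>+u. f (departures v u x) \<partial>iid (exp_law z) \<partial>iid (exp_law r)"]) measurable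
      also have "\<dots> = (\<integral>\<^sup>+v. \<integral>\<^sup>+u. \<integral>\<^sup>+x. f (departures v u x) \<partial>iid (exp_law r) \<partial>iid (exp_law z) \<partial>exp_law (r - z))"
        by (intro nn_integral_cong nn_integral_swap pz pr) measurable
      also have "\<dots> = (\<integral>\<^sup>+u. f u \<partial>iid (exp_law z))" by (rule burke_row[OF z(1) r(1) f])
      finally show ?case .
    qed
  qed
  also have "\<dots> = (\<integral>\<^sup>+u. f u \<partial>iid (exp_law z))" by (simp add: emeasure_space_1[simplified])
  finally show ?thesis .
qed

lemma level_measurable:
  "(\<lambda>(\<rho>, u). level z \<rho> u l) \<in> iid row_space \<Otimes>\<^sub>M iid borel \<rightarrow>\<^sub>M iid borel"
proof (induction l)
  case (Suc l)
  then have [measurable]: "(\<lambda>p. level z (fst p) (snd p) l)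
    \<in> iid row_space \<Otimes>\<^sub>M iid borel \<rightarrow>\<^sub>M iid borel"
    by (simp add: split_beta')
  have [measurable]: "(\<lambda>p. fst p l) \<in> iid row_space \<Otimes>\<^sub>M iid borel
      \<rightarrow>\<^sub>M row_space"
    by (rule measurable_compose[OF measurable_fst measurable_component_singleton]) simp
  show ?case unfolding level.simps split_beta' by measurable
qed (simp add: split_beta')

lemma level_measurable' [measurable (raw)]:
  assumes "\<rho> \<in> N \<rightarrow>\<^sub>M iid row_space" "u \<in> N \<rightarrow>\<^sub>M iid borel"
  shows "(\<lambda>\<omega>. level z (\<rho> \<omega>) (u \<omega>) l) \<in> N \<rightarrow>\<^sub>M iid borel"
  using measurable_compose[OF measurable_Pair[OF assms] level_measurable[of z l]] by simp

text \<open>The bottom row reproduces the stationary input, and its output is independent of the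
  rows above it, so the induction hypothesis covers the rest.\<close>

lemma nn_integral_level:
  assumes z: "0 < z" "z < c" and f: "f \<in> borel_measurable (iid borel)"
  shows "(\<integral>\<^sup>+\<rho>. \<integral>\<^sup>+u. f (level z \<rho> u l) \<partial>iid (exp_law z) \<partial>iid (row_law m)) = (\<integral>\<^sup>+u. f u \<partial>iid (exp_law z))"
proof (induction l)
  interpret R: prob_space "row_law m" by (rule prob_space_row_law)
  interpret RS: prob_space "iid (row_law m)" by (rule prob_space_iid) unfold_locales
  have pz: "prob_space (iid (exp_law z))" using z by (auto intro: prob_space_iid prob_space_exp_law)
  interpret Z: prob_space "iid (exp_law z)" by fact
  note f [measurable]
  {
    case 0
    then show ?case by (simp add: RS.emeasure_space_1)
  next
    case (Suc l)
    have [measurable]: "(\<lambda>\<omega>. \<omega>) \<in> iid (exp_law r) \<rightarrow>\<^sub>M iid borel" for r by (rule measurable_ident_sets) simp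
    have [measurable]: "(\<lambda>\<rho>. \<rho>) \<in> iid (row_law m) \<rightarrow>\<^sub>M iid row_space"
      by (rule measurable_ident_sets) simp
    have [simp]: "\<omega> \<in> space (iid borel)" for \<omega> :: "nat \<Rightarrow> real" by (simp add: space_PiM)
    have [simp]: "\<omega> \<in> space (iid row_space)" for \<omega> :: "nat \<Rightarrow> row"
      by (simp add: space_PiM space_pair_measure)
    have "(\<integral>\<^sup>+\<rho>. \<integral>\<^sup>+u. f (level z \<rho> u (Suc l)) \<partial>iid (exp_law z) \<partial>iid (row_law m))
      = (\<integral>\<^sup>+s. \<integral>\<^sup>+\<rho>. \<integral>\<^sup>+u. f (level z (case_nat s \<rho>) u (Suc l)) \<partial>iid (exp_law z) \<partial>iid (row_law m) \<partial>row_law m)"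
      by (rule nn_integral_iid_iter[OF prob_space_row_law]) measurable
    also have "\<dots> = (\<integral>\<^sup>+s. \<integral>\<^sup>+\<rho>. \<integral>\<^sup>+u. f (level z \<rho> (row_step z s u) l) \<partial>iid (exp_law z) \<partial>iid (row_law m) \<partial>row_law m)"
      by (simp only: level_case_nat)
    also have "\<dots> = (\<integral>\<^sup>+\<rho>. \<integral>\<^sup>+s. \<integral>\<^sup>+u. f (level z \<rho> (row_step z s u) l) \<partial>iid (exp_law z) \<partial>row_law m \<partial>iid (row_law m))"
      by (intro nn_integral_swap RS.prob_space_axioms R.prob_space_axioms) measurable
    also have "\<dots> = (\<integral>\<^sup>+\<rho>. \<integral>\<^sup>+u. f (level z \<rho> u l) \<partial>iid (exp_law z) \<partial>iid (row_law m))"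
      by (intro nn_integral_cong nn_integral_row_step[OF z]) measurable
    also have "\<dots> = (\<integral>\<^sup>+u. f u \<partial>iid (exp_law z))" by (rule Suc.IH)
    finally show ?case .
  }
qed

text \<open>Burke's theorem: the stationary input survives any number of rows.\<close>

lemma distr_level:
  assumes z: "0 < z" "z < c"
  shows "distr (iid (row_law m) \<Otimes>\<^sub>M iid (exp_law z)) (iid (exp_law z)) (\<lambda>(\<rho>, u). level z \<rho> u l) = iid (exp_law z)"
proof (rule measure_eqI)
  interpret R: prob_space "row_law m" by (rule prob_space_row_law)
  interpret RS: prob_space "iid (row_law m)" by (rule prob_space_iid) unfold_locales
  have pz: "prob_space (iid (exp_law z))" using z by (auto intro: prob_space_iid prob_space_exp_law)
  interpret Z: prob_space "iid (exp_law z)" by fact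
  let ?P = "iid (row_law m) \<Otimes>\<^sub>M iid (exp_law z)"
  fix A assume "A \<in> sets (distr ?P (iid (exp_law z)) (\<lambda>(\<rho>, u). level z \<rho> u l))"
  then have A [measurable]: "A \<in> sets (iid borel)" by simp
  have meas [measurable]: "(\<lambda>(\<rho>, u). level z \<rho> u l) \<in> ?P \<rightarrow>\<^sub>M iid (exp_law z)"
    using level_measurable[of z l] by (simp cong: measurable_cong_sets sets_pair_measure_cong)
  have "emeasure (distr ?P (iid (exp_law z)) (\<lambda>(\<rho>, u). level z \<rho> u l)) A
    = (\<integral>\<^sup>+p. indicator A p \<partial>distr ?P (iid (exp_law z)) (\<lambda>(\<rho>, u). level z \<rho> u l))" by simp
  also have "\<dots> = (\<integral>\<^sup>+p. indicator A ((\<lambda>(\<rho>, u). level z \<rho> u l) p) \<partial>?P)"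
    by (rule nn_integral_distr) measurable
  also have "\<dots> = (\<integral>\<^sup>+\<rho>. \<integral>\<^sup>+u. indicator A ((\<lambda>(\<rho>, u). level z \<rho> u l) (\<rho>, u)) \<partial>iid (exp_law z) \<partial>iid (row_law m))"
    by (rule Z.nn_integral_fst[symmetric]) measurable
  also have "\<dots> = (\<integral>\<^sup>+u. indicator A u \<partial>iid (exp_law z))"
    using nn_integral_level[OF z, of "indicator A" l] by simp
  finally show "emeasure (distr ?P (iid (exp_law z)) (\<lambda>(\<rho>, u). level z \<rho> u l)) A = emeasure (iid (exp_law z)) A"
    by simp
qed simp

end

section \<open>Shifts and moments of the row law\<close>

lemma distr_iid_shift:
  assumes "prob_space K"
  shows "distr (iid K) (iid K) (\<lambda>\<omega> i. \<omega> (i + b)) = iid K"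
  using distr_PiM_reindex[of UNIV "\<lambda>_. K" "\<lambda>i. i + b" UNIV] assms
  by (simp add: restrict_UNIV inj_on_def)

text \<open>Translation of the bulk by \<open>a\<close> columns and \<open>b\<close> rows. A row has
  a single boundary variable, which follows its row and is untouched by the horizontal
  shift.\<close>

definition shift_rows :: "nat \<Rightarrow> nat \<Rightarrow> (nat \<Rightarrow> row) \<Rightarrow> nat \<Rightarrow> row" where
  "shift_rows a b \<rho> j = (fst (\<rho> (j + b)), fst (snd (\<rho> (j + b))), \<lambda>i. snd (snd (\<rho> (j + b))) (i + a))"

lemma row_weight_shift_rows: "row_weight (shift_rows a b \<rho>) = (\<lambda>(i, j). row_weight \<rho> (i + a, j + b))"
  by (auto simp: row_weight_def shift_rows_def)

text \<open>For \<open>r > 0\<close> and Borel \<open>B\<close> this is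
  \<open>measure (exp_law r) B\<close>. It lies between 0 and 1 for every real \<open>r\<close>,
  whereas \<open>exp_law r\<close> is a probability measure only for positive rates; bounds and
  measurability in \<open>r\<close> thus hold without side conditions.\<close>

definition scaled_prob :: "real \<Rightarrow> real set \<Rightarrow> real" where
  "scaled_prob r B = measure (exp_law 1) ((\<lambda>x. x / r) -` B)"

context rate_law begin

sublocale E: prob_space "exp_law 1" by (rule prob_space_exp_law) simp
sublocale X: prob_space "iid (exp_law 1)" by (rule prob_space_iid) unfold_locales
sublocale R: prob_space "row_law m" by (rule prob_space_row_law)
sublocale RS: prob_space "iid (row_law m)" by (rule prob_space_iid) unfold_locales

lemma shift_measurable: "(\<lambda>x i. x (i + a)) \<in> iid (borel :: real measure) \<rightarrow>\<^sub>M iid borel"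
  by (rule measurable_PiM_single') auto

lemma distr_shift_row:
  "distr (row_law m) (row_law m) (\<lambda>s. (fst s, fst (snd s), \<lambda>i. snd (snd s) (i + a))) = row_law m"
    (is "distr _ _ ?f = _")
proof (rule measure_eqI)
  have f [measurable]: "?f \<in> row_space \<rightarrow>\<^sub>M row_space"
    using measurable_compose[OF _ shift_measurable[of a], of "\<lambda>s. snd (snd s)"] by measurable
  fix A assume "A \<in> sets (distr (row_law m) (row_law m) ?f)"
  then have [measurable]: "A \<in> sets row_space" by simp
  have f': "?f \<in> row_law m \<rightarrow>\<^sub>M row_law m" using f by (simp cong: measurable_cong_sets)
  have x: "(\<integral>\<^sup>+x. indicator A (r, v, \<lambda>i. x (i + a)) \<partial>iid (exp_law 1)) = (\<integral>\<^sup>+x. indicator A (r, v, x) \<partial>iid (exp_law 1))" for r v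
  proof -
    have "(\<integral>\<^sup>+x. indicator A (r, v, x) \<partial>distr (iid (exp_law 1)) (iid (exp_law 1)) (\<lambda>x i. x (i + a)))
      = (\<integral>\<^sup>+x. indicator A (r, v, \<lambda>i. x (i + a)) \<partial>iid (exp_law 1))"
    proof (rule nn_integral_distr)
      show "(\<lambda>x i. x (i + a)) \<in> iid (exp_law 1) \<rightarrow>\<^sub>M iid (exp_law 1)"
        using shift_measurable[of a] by (simp cong: measurable_cong_sets)
      have "(\<lambda>x. indicator A (r, v, x) :: ennreal) \<in> borel_measurable (iid borel)" by measurable
      then show "(\<lambda>x. indicator A (r, v, x) :: ennreal) \<in> borel_measurable (distr (iid (exp_law 1)) (iid (exp_law 1)) (\<lambda>x i. x (i + a)))"
        by (simp cong: measurable_cong_sets)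
    qed
    then show ?thesis by (simp add: distr_iid_shift[OF E.prob_space_axioms])
  qed
  have "emeasure (distr (row_law m) (row_law m) ?f) A = (\<integral>\<^sup>+s. indicator A s \<partial>distr (row_law m) (row_law m) ?f)"
    by simp
  also have "\<dots> = (\<integral>\<^sup>+s. indicator A (?f s) \<partial>row_law m)"
    by (rule nn_integral_distr[OF f']) simp
  also have "\<dots> = (\<integral>\<^sup>+r. \<integral>\<^sup>+v. \<integral>\<^sup>+x. indicator A (?f (r, v, x)) \<partial>iid (exp_law 1) \<partial>exp_law 1 \<partial>m)"
    by (rule nn_integral_row_law) measurable
  also have "\<dots> = (\<integral>\<^sup>+r. \<integral>\<^sup>+v. \<integral>\<^sup>+x. indicator A (r, v, x) \<partial>iid (exp_law 1) \<partial>exp_law 1 \<partial>m)"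
    by (simp add: x)
  also have "\<dots> = (\<integral>\<^sup>+s. indicator A s \<partial>row_law m)"
    by (rule nn_integral_row_law[symmetric]) measurable
  finally show "emeasure (distr (row_law m) (row_law m) ?f) A = emeasure (row_law m) A" by simp
qed simp

lemma shift_rows_measurable: "shift_rows a b \<in> iid (row_law m) \<rightarrow>\<^sub>M iid (row_law m)"
  and distr_shift_rows: "distr (iid (row_law m)) (iid (row_law m)) (shift_rows a b) = iid (row_law m)"
proof -
  let ?f = "\<lambda>s :: row. (fst s, fst (snd s), \<lambda>i. snd (snd s) (i + a))"
  have "?f \<in> row_space \<rightarrow>\<^sub>M row_space"
    using measurable_compose[OF _ shift_measurable[of a], of "\<lambda>s. snd (snd s)"] by measurable
  then have f: "?f \<in> row_law m \<rightarrow>\<^sub>M row_law m" by (simp cong: measurable_cong_sets)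
  have c: "(\<lambda>\<rho>. \<rho> k) \<in> iid (row_law m) \<rightarrow>\<^sub>M row_law m" for k
    by (rule measurable_component_singleton) simp
  have 1: "(\<lambda>\<rho> j. ?f (\<rho> j)) \<in> iid (row_law m) \<rightarrow>\<^sub>M iid (row_law m)"
    by (intro measurable_PiM_single' measurable_compose[OF c f]) (auto simp: space_PiM sets_eq_imp_space_eq[OF sets_row_law] space_pair_measure)
  have 2: "(\<lambda>\<rho> j. \<rho> (j + b)) \<in> iid (row_law m) \<rightarrow>\<^sub>M iid (row_law m)"
    by (intro measurable_PiM_single' c) (auto simp: space_PiM sets_eq_imp_space_eq[OF sets_row_law] space_pair_measure)
  have eq: "shift_rows a b = (\<lambda>\<rho> j. ?f (\<rho> j)) \<circ> (\<lambda>\<rho> j. \<rho> (j + b))"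
    by (auto simp: shift_rows_def fun_eq_iff)
  show "shift_rows a b \<in> iid (row_law m) \<rightarrow>\<^sub>M iid (row_law m)"
    unfolding eq by (rule measurable_comp[OF 2 1])
  show "distr (iid (row_law m)) (iid (row_law m)) (shift_rows a b) = iid (row_law m)"
    unfolding eq distr_distr[OF 1 2, symmetric]
    using distr_iid_shift[OF R.prob_space_axioms, of b] distr_iid[OF R.prob_space_axioms f] distr_shift_row[of a]
    by simp
qed

lemma row_weight_measurable:
  "(\<lambda>\<rho>. row_weight \<rho> z) \<in> borel_measurable (iid (row_law m))"
  "row_weight \<in> iid (row_law m) \<rightarrow>\<^sub>M Pi\<^sub>M UNIV (\<lambda>_. borel)"
proof -
  have *: "(\<lambda>\<rho>. row_weight \<rho> z) \<in> borel_measurable (iid (row_law m))" for z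
  proof -
    have c: "(\<lambda>\<rho>. \<rho> (snd z)) \<in> iid (row_law m) \<rightarrow>\<^sub>M row_law m"
      by (rule measurable_component_singleton) simp
    have "(\<lambda>s. snd (snd s) (fst z)) \<in> borel_measurable row_space"
      by (rule measurable_compose[OF _ measurable_component_singleton[of "fst z" UNIV]]) auto
    then have "(\<lambda>s. snd (snd s) (fst z) / fst s) \<in> borel_measurable row_space"
      by measurable
    then have "(\<lambda>s. snd (snd s) (fst z) / fst s) \<in> borel_measurable (row_law m)"
      by (simp cong: measurable_cong_sets)
    from measurable_compose[OF c this] show ?thesis by (simp add: row_weight_def split_beta')
  qed
  then show "(\<lambda>\<rho>. row_weight \<rho> z) \<in> borel_measurable (iid (row_law m))" .
  show "row_weight \<in> iid (row_law m) \<rightarrow>\<^sub>M Pi\<^sub>M UNIV (\<lambda>_. borel)"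
  proof (rule measurable_PiM_single')
    show "(\<lambda>\<rho>. row_weight \<rho> z) \<in> borel_measurable (iid (row_law m))" for z by (rule *)
  qed (simp add: Pi_iff)
qed

lemma scaled_prob_measurable:
  assumes [measurable]: "B \<in> sets borel"
  shows "(\<lambda>r. scaled_prob r B) \<in> borel_measurable borel"
proof -
  have "emeasure (exp_law 1) ((\<lambda>x. x / r) -` B) = (\<integral>\<^sup>+x. indicator B (x / r) \<partial>exp_law 1)" for r
  proof -
    have "(\<lambda>x. x / r) -` B \<in> sets borel" using measurable_sets[of "\<lambda>x. x / r" borel borel B] by simp
    then have "emeasure (exp_law 1) ((\<lambda>x. x / r) -` B) = (\<integral>\<^sup>+x. indicator ((\<lambda>x. x / r) -` B) x \<partial>exp_law 1)"
      by simp
    then show ?thesis by (simp add: indicator_def)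
  qed
  then show ?thesis unfolding scaled_prob_def measure_def by simp
qed

text \<open>The weights of a row are independent given its rate. They share that rate, so the
  product stays inside the integral over \<open>r\<close>.\<close>

lemma emeasure_row_event:
  assumes J: "finite J" and F: "\<And>i. i \<in> J \<Longrightarrow> F i \<in> sets borel"
  defines "A \<equiv> {s. \<forall>i\<in>J. snd (snd s) i / fst s \<in> F i}"
  shows "A \<in> sets (row_law m)"
    and "emeasure (row_law m) A = (\<integral>\<^sup>+r. ennreal (\<Prod>i\<in>J. scaled_prob r (F i)) \<partial>m)"
proof -
  have [measurable]: "(\<lambda>s. snd (snd s) i) \<in> borel_measurable row_space" for i
    by (rule measurable_compose[OF _ measurable_component_singleton[of i UNIV]]) auto
  have "{s \<in> space row_space. \<forall>i\<in>J. snd (snd s) i / fst s \<in> F i}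
    \<in> sets row_space"
  proof (rule sets.sets_Collect_finite_All[OF _ J])
    fix i assume "i \<in> J"
    then have [measurable]: "F i \<in> sets borel" by (rule F)
    show "{s \<in> space row_space. snd (snd s) i / fst s \<in> F i}
      \<in> sets row_space" by measurable
  qed
  moreover have "space row_space = (UNIV :: row set)"
    by (simp add: space_pair_measure space_PiM)
  ultimately have A: "A \<in> sets row_space" by (simp add: A_def)
  then show A': "A \<in> sets (row_law m)" by simp
  interpret P: product_prob_space "\<lambda>_::nat. exp_law 1" UNIV by unfold_locales
  have "emeasure (row_law m) A = (\<integral>\<^sup>+s. indicator A s \<partial>row_law m)" using A' by simp
  also have "\<dots> = (\<integral>\<^sup>+r. \<integral>\<^sup>+v. \<integral>\<^sup>+x. indicator A (r, v, x) \<partial>iid (exp_law 1) \<partial>exp_law 1 \<partial>m)"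
    using A by (intro nn_integral_row_law) simp
  also have "\<dots> = (\<integral>\<^sup>+r. \<integral>\<^sup>+v. ennreal (\<Prod>i\<in>J. scaled_prob r (F i)) \<partial>exp_law 1 \<partial>m)"
  proof (rule nn_integral_cong, rule nn_integral_cong)
    fix r v :: real
    have m: "(\<lambda>x. x / r) -` F i \<in> sets (exp_law 1)" if "i \<in> J" for i
      using measurable_sets[of "\<lambda>x. x / r" borel borel "F i"] F[OF that] by simp
    have "(\<integral>\<^sup>+x. indicator A (r, v, x) \<partial>iid (exp_law 1))
      = (\<integral>\<^sup>+x. indicator {x \<in> space (iid (exp_law 1)). \<forall>i\<in>J. x i \<in> (\<lambda>x. x / r) -` F i} x \<partial>iid (exp_law 1))"
      by (rule nn_integral_cong) (simp add: A_def indicator_def space_PiM)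
    also have "\<dots> = emeasure (iid (exp_law 1)) {x \<in> space (iid (exp_law 1)). \<forall>i\<in>J. x i \<in> (\<lambda>x. x / r) -` F i}"
      using J m by (intro nn_integral_indicator sets.sets_Collect_finite_All sets_Collect_single') (auto simp: vimage_def)
    also have "\<dots> = (\<Prod>i\<in>J. emeasure (exp_law 1) ((\<lambda>x. x / r) -` F i))"
      using J m by (intro P.emeasure_PiM_Collect) auto
    also have "\<dots> = ennreal (\<Prod>i\<in>J. scaled_prob r (F i))"
      by (simp add: scaled_prob_def E.emeasure_eq_measure prod_ennreal)
    finally show "(\<integral>\<^sup>+x. indicator A (r, v, x) \<partial>iid (exp_law 1)) = ennreal (\<Prod>i\<in>J. scaled_prob r (F i))" .
  qed
  also have "\<dots> = (\<integral>\<^sup>+r. ennreal (\<Prod>i\<in>J. scaled_prob r (F i)) \<partial>m)"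
    using E.emeasure_space_1 by simp
  finally show "emeasure (row_law m) A = (\<integral>\<^sup>+r. ennreal (\<Prod>i\<in>J. scaled_prob r (F i)) \<partial>m)" .
qed

text \<open>The function \<open>g\<close> of the overview, with integrand bounded by
  \<open>1 / (c - z)\<close> for \<open>z < c\<close>. At \<open>z = c\<close> it is the intended
  moment if there is no atom at \<open>c\<close> and the integrand is integrable, as the lemmas on
  the limit at the edge assume.\<close>

definition mean_inverse :: "real \<Rightarrow> real" where
  "mean_inverse z = (\<integral>r. 1 / (r - z) \<partial>m)"

lemma AE_inverse_bounds:
  assumes "z < c"
  shows "AE r in m. 0 \<le> 1 / (r - z) \<and> 1 / (r - z) \<le> 1 / (c - z)"
  using rate_ge
proof eventually_elim
  case (elim r)
  with assms have "1 / (r - z) \<le> 1 / (c - z)" by (intro divide_left_mono) auto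
  with elim assms show ?case by simp
qed

lemma mean_inverse_integrable:
  assumes "z < c"
  shows "integrable m (\<lambda>r. 1 / (r - z))"
proof (rule integrable_const_bound[where B = "1 / (c - z)"])
  show "AE r in m. norm (1 / (r - z)) \<le> 1 / (c - z)"
    using AE_inverse_bounds[OF assms] by eventually_elim simp
qed simp

lemma mean_inverse_bounds:
  assumes "z < c"
  shows "0 \<le> mean_inverse z" "mean_inverse z \<le> 1 / (c - z)"
proof -
  show "0 \<le> mean_inverse z" unfolding mean_inverse_def
    by (rule integral_nonneg_AE, use AE_inverse_bounds[OF assms] in eventually_elim) simp
  have "mean_inverse z \<le> (\<integral>r. 1 / (c - z) \<partial>m)" unfolding mean_inverse_def
    by (rule integral_mono_AE[OF mean_inverse_integrable[OF assms]], simp,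
        use AE_inverse_bounds[OF assms] in eventually_elim) simp
  then show "mean_inverse z \<le> 1 / (c - z)" using prob_space by simp
qed

lemma AE_row_law:
  "AE s in row_law m. c \<le> fst s \<and> 0 \<le> fst (snd s) \<and> (\<forall>i. 0 \<le> snd (snd s) i)"
proof -
  interpret EX: pair_prob_space "exp_law 1" "iid (exp_law 1)" ..
  interpret P: pair_prob_space m "exp_law 1 \<Otimes>\<^sub>M iid (exp_law 1)" ..
  have X: "AE x in iid (exp_law 1). \<forall>i. 0 \<le> x i"
  proof -
    have "AE x in iid (exp_law 1). 0 \<le> x i" for i
      by (rule AE_PiM_component) (auto intro: E.prob_space_axioms AE_exp_law_nonneg)
    then show ?thesis by (subst AE_all_countable) blast
  qed
  have [measurable]: "(\<lambda>s. snd (snd s) i) \<in> borel_measurable row_space"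
    "(\<lambda>s. snd s i) \<in> borel_measurable row_tail_space" for i
    by (rule measurable_compose[OF _ measurable_component_singleton[of i UNIV]], auto)+
  have VX: "AE q in exp_law 1 \<Otimes>\<^sub>M iid (exp_law 1). 0 \<le> fst q \<and> (\<forall>i. 0 \<le> snd q i)"
  proof (rule EX.AE_pair_measure)
    have "{q \<in> space row_tail_space. 0 \<le> fst q \<and> (\<forall>i. 0 \<le> snd q i)} \<in> sets (row_tail_space)"
      by measurable
    then show "{q \<in> space (exp_law 1 \<Otimes>\<^sub>M iid (exp_law 1)). 0 \<le> fst q \<and> (\<forall>i. 0 \<le> snd q i)} \<in> sets (exp_law 1 \<Otimes>\<^sub>M iid (exp_law 1))"
      by (simp cong: sets_pair_measure_cong add: space_pair_measure space_PiM)
    show "AE v in exp_law 1. AE x in iid (exp_law 1). 0 \<le> fst (v, x) \<and> (\<forall>i. 0 \<le> snd (v, x) i)"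
      using AE_exp_law_nonneg by eventually_elim (use X in simp)
  qed
  show ?thesis unfolding row_law_def
  proof (rule P.AE_pair_measure)
    have "{s \<in> space row_space. c \<le> fst s \<and> 0 \<le> fst (snd s) \<and> (\<forall>i. 0 \<le> snd (snd s) i)}
      \<in> sets row_space"
      by measurable
    then show "{s \<in> space (m \<Otimes>\<^sub>M (exp_law 1 \<Otimes>\<^sub>M iid (exp_law 1))). c \<le> fst s \<and> 0 \<le> fst (snd s) \<and> (\<forall>i. 0 \<le> snd (snd s) i)}
      \<in> sets (m \<Otimes>\<^sub>M (exp_law 1 \<Otimes>\<^sub>M iid (exp_law 1)))"
      by (simp cong: sets_pair_measure_cong add: space_pair_measure space_PiM)
    show "AE r in m. AE q in exp_law 1 \<Otimes>\<^sub>M iid (exp_law 1).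
        c \<le> fst (r, q) \<and> 0 \<le> fst (snd (r, q)) \<and> (\<forall>i. 0 \<le> snd (snd (r, q)) i)"
      using rate_ge by eventually_elim (use VX in simp)
  qed
qed

lemma AE_rows:
  "AE \<rho> in iid (row_law m). \<forall>j. c \<le> fst (\<rho> j) \<and> 0 \<le> fst (snd (\<rho> j)) \<and> (\<forall>i. 0 \<le> snd (snd (\<rho> j)) i)"
proof -
  have "AE \<rho> in iid (row_law m). c \<le> fst (\<rho> j) \<and> 0 \<le> fst (snd (\<rho> j)) \<and> (\<forall>i. 0 \<le> snd (snd (\<rho> j)) i)" for j
    by (rule AE_PiM_component[where I = UNIV and M = "\<lambda>_. row_law m" and i = j,
          OF R.prob_space_axioms UNIV_I AE_row_law])
  then show ?thesis by (subst AE_all_countable) blast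
qed

lemma left_weight_measurable':
  "(\<lambda>s. left_weight z s ^ i) \<in> borel_measurable row_space" "(\<lambda>s. ennreal (left_weight z s ^ i)) \<in> borel_measurable row_space"
  unfolding left_weight_def split_beta' by measurable

lemma left_weight_measurable: "left_weight z \<in> borel_measurable (row_law m)"
proof -
  have "left_weight z \<in> borel_measurable row_space"
    unfolding left_weight_def split_beta' by measurable
  then show ?thesis unfolding measurable_cong_sets[OF sets_row_law refl] .
qed

text \<open>Given its rate, the boundary weight is exponential of rate \<open>r - z\<close>, with
  \<open>i\<close>-th moment \<open>fact i / (r - z) ^ i\<close>. The case \<open>i = 1\<close>
  yields the mean, and \<open>i = 2\<close> the second moment required by the weak law, finite since
  \<open>r - z\<close> is at least \<open>c - z\<close>.\<close>

lemma left_weight_nn_moment: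
  assumes z: "z < c"
  shows "(\<integral>\<^sup>+s. ennreal (left_weight z s ^ i) \<partial>row_law m) = (\<integral>\<^sup>+r. ennreal (fact i * (1 / (r - z)) ^ i) \<partial>m)"
proof -
  have "(\<integral>\<^sup>+s. ennreal (left_weight z s ^ i) \<partial>row_law m)
    = (\<integral>\<^sup>+r. \<integral>\<^sup>+v. \<integral>\<^sup>+x. ennreal (left_weight z (r, v, x) ^ i) \<partial>iid (exp_law 1) \<partial>exp_law 1 \<partial>m)"
    by (rule nn_integral_row_law[OF left_weight_measurable'(2)])
  also have "\<dots> = (\<integral>\<^sup>+r. \<integral>\<^sup>+v. ennreal ((v / (r - z)) ^ i) \<partial>exp_law 1 \<partial>m)"
    by (simp add: left_weight_def X.emeasure_space_1)
  also have "\<dots> = (\<integral>\<^sup>+r. ennreal (fact i * (1 / (r - z)) ^ i) \<partial>m)"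
  proof (rule nn_integral_cong_AE)
    show "AE r in m. (\<integral>\<^sup>+v. ennreal ((v / (r - z)) ^ i) \<partial>exp_law 1) = ennreal (fact i * (1 / (r - z)) ^ i)"
      using rate_ge
    proof eventually_elim
      case (elim r)
      then have r: "0 < r - z" using z by simp
      have "(\<integral>\<^sup>+v. ennreal ((v / (r - z)) ^ i) \<partial>exp_law 1)
        = (\<integral>\<^sup>+v. ennreal ((1 / (r - z)) ^ i) * ennreal (v ^ i) \<partial>exp_law 1)"
      proof (rule nn_integral_cong_AE)
        show "AE v in exp_law 1. ennreal ((v / (r - z)) ^ i) = ennreal ((1 / (r - z)) ^ i) * ennreal (v ^ i)"
          using AE_exp_law_nonneg
        proof eventually_elim
          case (elim v)
          have "(v / (r - z)) ^ i = (1 / (r - z)) ^ i * v ^ i" by (simp add: power_divide)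
          with r elim show ?case by (simp add: ennreal_mult)
        qed
      qed
      also have "\<dots> = ennreal ((1 / (r - z)) ^ i) * (\<integral>\<^sup>+v. ennreal (v ^ i) \<partial>exp_law 1)"
        by (rule nn_integral_cmult) measurable
      also have "\<dots> = ennreal ((1 / (r - z)) ^ i * fact i)"
        using r by (simp add: exp_law_moment ennreal_mult)
      finally have "(\<integral>\<^sup>+v. ennreal ((v / (r - z)) ^ i) \<partial>exp_law 1) = ennreal (fact i * (1 / (r - z)) ^ i)"
        by (simp only: mult.commute)
      then show ?case .
    qed
  qed
  finally show ?thesis .
qed

lemma left_weight_AE_nonneg: "z < c \<Longrightarrow> AE s in row_law m. 0 \<le> left_weight z s"
  using AE_row_law by eventually_elim (auto simp: left_weight_def split: prod.split)

lemma left_weight_square_integrable: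
  assumes z: "z < c"
  shows "integrable (row_law m) (\<lambda>s. (left_weight z s)\<^sup>2)"
proof (rule integrableI_nonneg)
  show "(\<lambda>s. (left_weight z s)\<^sup>2) \<in> borel_measurable (row_law m)"
    unfolding measurable_cong_sets[OF sets_row_law refl] by (rule left_weight_measurable')
  have "(\<integral>\<^sup>+s. ennreal ((left_weight z s)\<^sup>2) \<partial>row_law m) \<le> (\<integral>\<^sup>+r. ennreal (2 * (1 / (c - z))\<^sup>2) \<partial>m)"
    unfolding left_weight_nn_moment[OF z]
  proof (rule nn_integral_mono_AE, use AE_inverse_bounds[OF z] in eventually_elim)
    case (elim r)
    then show ?case by (intro ennreal_leI mult_mono power_mono) (auto simp: fact_2)
  qed
  also have "\<dots> < \<infinity>" by (simp add: emeasure_space_1[simplified])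
  finally show "(\<integral>\<^sup>+s. ennreal ((left_weight z s)\<^sup>2) \<partial>row_law m) < \<infinity>" .
qed simp

lemma left_weight_mean:
  assumes z: "z < c"
  shows "integral\<^sup>L (row_law m) (left_weight z) = mean_inverse z"
proof -
  have "(\<integral>\<^sup>+s. ennreal (left_weight z s) \<partial>row_law m) = (\<integral>\<^sup>+r. ennreal (1 / (r - z)) \<partial>m)"
    using left_weight_nn_moment[OF z, of 1] by simp
  also have "\<dots> = ennreal (mean_inverse z)"
    unfolding mean_inverse_def
    by (rule nn_integral_eq_integral[OF mean_inverse_integrable[OF z]],
        use AE_inverse_bounds[OF z] in eventually_elim) simp
  finally have *: "(\<integral>\<^sup>+s. ennreal (left_weight z s) \<partial>row_law m) = ennreal (mean_inverse z)" .
  have "integral\<^sup>L (row_law m) (left_weight z) = enn2real (\<integral>\<^sup>+s. ennreal (left_weight z s) \<partial>row_law m)"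
    by (rule integral_eq_nn_integral[OF left_weight_measurable left_weight_AE_nonneg[OF z]])
  with * show ?thesis using mean_inverse_bounds[OF z] by simp
qed

end

section \<open>Transfer from the model to independent rows\<close>

context random_rate_exponential_model begin

lemma rate_measurable [measurable]: "\<xi> j \<in> borel_measurable M"
  using rates_indep by (auto simp: indep_vars_def)

sublocale L: rate_law m c
proof -
  have m: "m = distr M borel (\<xi> 0)" using rates_distr[of 0] by simp
  interpret m: prob_space m unfolding m by (rule prob_space_distr) simp
  have "AE r in m. c \<le> r" unfolding m by (subst AE_distr_iff) (auto intro: rates_ge)
  then show "rate_law m c" using c_pos by unfold_locales (auto simp: m)
qed

lemma rate_algebra_subalgebra: "subalgebra M (rate_algebra M \<xi>)"
proof -
  have 1: "(\<lambda>\<omega> j. \<xi> j \<omega>) \<in> M \<rightarrow>\<^sub>M Pi\<^sub>M UNIV (\<lambda>_. borel)"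
    by (rule measurable_PiM_single') auto
  then have "(\<lambda>\<omega> j. \<xi> j \<omega>) \<in> space M \<rightarrow> space (Pi\<^sub>M UNIV (\<lambda>_. borel))"
    by (auto simp: space_PiM)
  then show ?thesis unfolding subalgebra_def rate_algebra_def
    by (auto simp: sets_vimage_algebra2 intro: measurable_sets[OF 1])
qed

text \<open>Integrating the conditional probability leaves a function of the rates. Its factors are
  grouped by row because cells of one row share a rate, and independence of the rates lets the
  expectation factor over rows.\<close>

lemma prob_weights_rectangle:
  assumes J: "finite J" and F: "\<And>z. z \<in> J \<Longrightarrow> F z \<in> sets borel"
  shows "prob {\<omega> \<in> space M. \<forall>z\<in>J. X z \<omega> \<in> F z}
    = (\<Prod>j\<in>snd ` J. \<integral>r. (\<Prod>z\<in>{z \<in> J. snd z = j}. scaled_prob r (F z)) \<partial>m)"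
proof -
  let ?A = "{\<omega> \<in> space M. \<forall>z\<in>J. X z \<omega> \<in> F z}"
  let ?h = "\<lambda>j r. \<Prod>z\<in>{z \<in> J. snd z = j}. scaled_prob r (F z)"
  interpret S: finite_measure_subalgebra M "rate_algebra M \<xi>"
    by unfold_locales (rule rate_algebra_subalgebra)
  note [measurable] = weights_measurable
  have A: "?A \<in> events"
  proof (rule sets.sets_Collect_finite_All[OF _ J])
    fix z assume "z \<in> J"
    then have [measurable]: "F z \<in> sets borel" by (rule F)
    show "{\<omega> \<in> space M. X z \<omega> \<in> F z} \<in> events" by measurable
  qed
  have hm: "?h j \<in> borel_measurable borel" for j
    using F by (intro borel_measurable_prod L.scaled_prob_measurable) auto
  have "prob ?A = expectation (indicator ?A)" using A by simp
  also have "\<dots> = expectation (real_cond_exp M (rate_algebra M \<xi>) (indicator ?A))"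
    using A by (intro S.real_cond_exp_int(2)[symmetric]) (simp add: emeasure_eq_measure)
  also have "\<dots> = expectation (\<lambda>\<omega>. \<Prod>j\<in>snd ` J. ?h j (\<xi> j \<omega>))"
  proof (rule integral_cong_AE)
    show "(\<lambda>\<omega>. \<Prod>j\<in>snd ` J. ?h j (\<xi> j \<omega>)) \<in> borel_measurable M"
      using measurable_compose[OF rate_measurable hm] by measurable
    have "AE \<omega> in M. \<forall>j. c \<le> \<xi> j \<omega>" using rates_ge by (subst AE_all_countable) blast
    moreover have "AE \<omega> in M. real_cond_exp M (rate_algebra M \<xi>) (indicator ?A) \<omega>
        = (\<Prod>z\<in>J. measure (exp_law (\<xi> (snd z) \<omega>)) (F z))"
      using J F by (rule conditional_law)
    ultimately show "AE \<omega> in M. real_cond_exp M (rate_algebra M \<xi>) (indicator ?A) \<omega> = (\<Prod>j\<in>snd ` J. ?h j (\<xi> j \<omega>))"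
    proof eventually_elim
      case (elim \<omega>)
      have "measure (exp_law (\<xi> (snd z) \<omega>)) (F z) = scaled_prob (\<xi> (snd z) \<omega>) (F z)" if "z \<in> J" for z
      proof -
        have r: "0 < \<xi> (snd z) \<omega>" using elim(1) c_pos by (metis less_le_trans)
        show ?thesis unfolding exp_law_scale[OF r, symmetric] scaled_prob_def
          using F[OF that] by (subst measure_distr) auto
      qed
      then have "(\<Prod>z\<in>J. measure (exp_law (\<xi> (snd z) \<omega>)) (F z)) = (\<Prod>z\<in>J. scaled_prob (\<xi> (snd z) \<omega>) (F z))"
        by (intro prod.cong) auto
      also have "\<dots> = (\<Prod>j\<in>snd ` J. \<Prod>z\<in>{z \<in> J. snd z = j}. scaled_prob (\<xi> (snd z) \<omega>) (F z))"
        using J by (intro prod.group[symmetric]) auto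
      also have "\<dots> = (\<Prod>j\<in>snd ` J. ?h j (\<xi> j \<omega>))" by (intro prod.cong refl) auto
      finally show ?case using elim(2) by simp
    qed
  qed simp
  also have "\<dots> = (\<Prod>j\<in>snd ` J. expectation (\<lambda>\<omega>. ?h j (\<xi> j \<omega>)))"
  proof (rule indep_vars_lebesgue_integral)
    show "indep_vars (\<lambda>_. borel) (\<lambda>j \<omega>. ?h j (\<xi> j \<omega>)) (snd ` J)"
      using hm by (intro indep_vars_compose2[OF indep_vars_subset[OF rates_indep]]) auto
    have "0 \<le> ?h j r \<and> ?h j r \<le> 1" for j r
      by (auto intro!: prod_nonneg prod_le_1 simp: scaled_prob_def L.E.prob_le_1)
    then show "integrable M (\<lambda>\<omega>. ?h j (\<xi> j \<omega>))" for j
      using measurable_compose[OF rate_measurable hm]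
      by (intro integrable_const_bound[where B = 1]) auto
  qed (use J in simp)
  also have "\<dots> = (\<Prod>j\<in>snd ` J. \<integral>r. ?h j r \<partial>m)"
  proof (rule prod.cong[OF refl])
    fix j
    show "expectation (\<lambda>\<omega>. ?h j (\<xi> j \<omega>)) = (\<integral>r. ?h j r \<partial>m)"
      using integral_distr[OF rate_measurable hm, of j j] by (simp add: rates_distr)
  qed
  finally show ?thesis .
qed

text \<open>Both laws give a rectangle the same product over the rows it meets, and rectangles
  determine a measure on the product space. Only bulk weights are compared; the boundary variables
  exist on the right-hand space alone.\<close>

lemma distr_weights:
  "distr M (Pi\<^sub>M UNIV (\<lambda>_. borel)) (\<lambda>\<omega> z. X z \<omega>)
    = distr (iid (row_law m)) (Pi\<^sub>M UNIV (\<lambda>_. borel)) row_weight" (is "?P = ?Q")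
proof (rule measure_eqI_PiM_infinite[where I = UNIV and M = "\<lambda>_. borel"])
  have Xm: "(\<lambda>\<omega> z. X z \<omega>) \<in> M \<rightarrow>\<^sub>M Pi\<^sub>M UNIV (\<lambda>_. borel)"
    using weights_measurable by (intro measurable_PiM_single') auto
  interpret P: prob_space ?P by (rule prob_space_distr[OF Xm])
  show "finite_measure ?P" by (rule P.finite_measure)
  fix F and J :: "(nat \<times> nat) set" assume J: "finite J" and F: "\<And>z. z \<in> J \<Longrightarrow> F z \<in> sets (borel :: real measure)"
  let ?X = "prod_emb UNIV (\<lambda>_. borel) J (Pi\<^sub>E J F)"
  have X: "?X \<in> sets (Pi\<^sub>M UNIV (\<lambda>_. borel))" using J F by (intro sets_PiM_I) auto
  let ?h = "\<lambda>j r. \<Prod>z\<in>{z \<in> J. snd z = j}. scaled_prob r (F z)"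
  have h: "?h j \<in> borel_measurable borel" "0 \<le> ?h j r" "?h j r \<le> 1" for j r
    using F by (auto intro!: borel_measurable_prod L.scaled_prob_measurable prod_nonneg prod_le_1 simp: scaled_prob_def L.E.prob_le_1)
  have "emeasure ?P ?X = emeasure M {\<omega> \<in> space M. \<forall>z\<in>J. X z \<omega> \<in> F z}"
    unfolding emeasure_distr[OF Xm X] by (rule arg_cong[where f = "emeasure M"]) (auto simp: prod_emb_def PiE_iff)
  also have "\<dots> = ennreal (\<Prod>j\<in>snd ` J. \<integral>r. ?h j r \<partial>m)"
  proof -
    have "prob {\<omega> \<in> space M. \<forall>z\<in>J. X z \<omega> \<in> F z} = (\<Prod>j\<in>snd ` J. \<integral>r. ?h j r \<partial>m)"
      using J F by (rule prob_weights_rectangle)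
    then show ?thesis by (simp only: emeasure_eq_measure)
  qed
  also have "\<dots> = (\<Prod>j\<in>snd ` J. ennreal (\<integral>r. ?h j r \<partial>m))"
    by (rule prod_ennreal[symmetric]) (simp add: h(2))
  also have "\<dots> = (\<Prod>j\<in>snd ` J. emeasure (row_law m) {s. \<forall>i\<in>{i. (i, j) \<in> J}. snd (snd s) i / fst s \<in> F (i, j)})"
  proof (rule prod.cong[OF refl])
    fix j
    have bij: "bij_betw (\<lambda>i. (i, j)) {i. (i, j) \<in> J} {z \<in> J. snd z = j}"
      by (auto simp: bij_betw_def inj_on_def)
    then have fin: "finite {i. (i, j) \<in> J}" using J by (auto dest: bij_betw_finite)
    have "ennreal (\<integral>r. ?h j r \<partial>m) = (\<integral>\<^sup>+r. ennreal (?h j r) \<partial>m)"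
      using h by (intro nn_integral_eq_integral[symmetric] L.integrable_const_bound[where B = 1]) auto
    also have "\<dots> = (\<integral>\<^sup>+r. ennreal (\<Prod>i\<in>{i. (i, j) \<in> J}. scaled_prob r (F (i, j))) \<partial>m)"
      by (subst prod.reindex_bij_betw[OF bij, symmetric]) simp
    also have "\<dots> = emeasure (row_law m) {s. \<forall>i\<in>{i. (i, j) \<in> J}. snd (snd s) i / fst s \<in> F (i, j)}"
      using fin F by (intro L.emeasure_row_event(2)[symmetric]) auto
    finally show "ennreal (\<integral>r. ?h j r \<partial>m)
      = emeasure (row_law m) {s. \<forall>i\<in>{i. (i, j) \<in> J}. snd (snd s) i / fst s \<in> F (i, j)}" .
  qed
  also have "\<dots> = emeasure (iid (row_law m)) {\<rho> \<in> space (iid (row_law m)). \<forall>j\<in>snd ` J.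
      \<rho> j \<in> {s. \<forall>i\<in>{i. (i, j) \<in> J}. snd (snd s) i / fst s \<in> F (i, j)}}"
  proof -
    interpret P: product_prob_space "\<lambda>_::nat. row_law m" UNIV by unfold_locales
    show ?thesis
    proof (rule P.emeasure_PiM_Collect[symmetric])
      fix j
      have "finite ((\<lambda>i. (i, j)) -` J)" using J by (intro finite_vimageI) (auto simp: inj_on_def)
      then have fin: "finite {i. (i, j) \<in> J}" by (simp add: vimage_def)
      show "{s. \<forall>i\<in>{i. (i, j) \<in> J}. snd (snd s) i / fst s \<in> F (i, j)} \<in> sets (row_law m)"
        using fin F by (intro L.emeasure_row_event(1)) auto
    qed (use J in auto)
  qed
  also have "\<dots> = emeasure ?Q ?X"
    unfolding emeasure_distr[OF L.row_weight_measurable(2) X]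
    by (rule arg_cong[where f = "emeasure (iid (row_law m))"])
      (force simp: prod_emb_def PiE_iff row_weight_def)
  finally show "emeasure ?P ?X = emeasure ?Q ?X" .
qed auto

text \<open>Convergence to the constant \<open>\<Psi> x y\<close> is a measurable event of the
  weight field, so its probability depends only on the law of that field.\<close>

lemma AE_rows_limit_shape:
  assumes "is_limit_shape M X \<Psi>" "0 < x" "0 < y"
  shows "AE \<rho> in iid (row_law m).
    (\<lambda>n. last_passage (row_weight \<rho>) (nat \<lfloor>real n * x\<rfloor>) (nat \<lfloor>real n * y\<rfloor>) / real n) \<longlonglongrightarrow> \<Psi> x y"
proof -
  let ?conv = "\<lambda>w. (\<lambda>n. last_passage w (nat \<lfloor>real n * x\<rfloor>) (nat \<lfloor>real n * y\<rfloor>) / real n) \<longlonglongrightarrow> \<Psi> x y"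
  have Xm: "(\<lambda>\<omega> z. X z \<omega>) \<in> M \<rightarrow>\<^sub>M Pi\<^sub>M UNIV (\<lambda>_. borel)"
    using weights_measurable by (intro measurable_PiM_single') auto
  have c: "{w \<in> space (Pi\<^sub>M UNIV (\<lambda>_. borel)). ?conv w} \<in> sets (Pi\<^sub>M UNIV (\<lambda>_. borel))"
    by measurable
  have "AE \<omega> in M. ?conv (\<lambda>z. X z \<omega>)" using assms by (simp add: is_limit_shape_def)
  then have "AE w in distr M (Pi\<^sub>M UNIV (\<lambda>_. borel)) (\<lambda>\<omega> z. X z \<omega>). ?conv w"
    by (subst AE_distr_iff[OF Xm c])
  then show ?thesis
    unfolding distr_weights by (subst (asm) AE_distr_iff[OF L.row_weight_measurable(2) c])
qed

end

section \<open>Homogeneity and concavity of the limit\<close>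

lemma exp_law_square_integrable:
  assumes r: "0 < r" shows "integrable (exp_law r) (\<lambda>v. v\<^sup>2)"
proof (rule integrableI_nonneg)
  show "(\<integral>\<^sup>+v. ennreal (v\<^sup>2) \<partial>exp_law r) < \<infinity>" by (simp add: exp_law_moment[OF r])
qed auto

lemma exp_law_mean:
  assumes r: "0 < r" shows "(\<integral>v. v \<partial>exp_law r) = 1 / r"
proof -
  have "(\<integral>v. v \<partial>exp_law r) = enn2real (\<integral>\<^sup>+v. ennreal v \<partial>exp_law r)"
    by (rule integral_eq_nn_integral) (auto intro: AE_exp_law_nonneg)
  also have "(\<integral>\<^sup>+v. ennreal v \<partial>exp_law r) = ennreal (1 / r)"
    using exp_law_moment[OF r, of 1] by simp
  finally show ?thesis using r by simp
qed

lemma whp_exp_law_sum: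
  assumes "0 < r" "0 < e"
  shows "whp (iid (exp_law r)) (\<lambda>n u. \<bar>(\<Sum>i<n. u i) - real n / r\<bar> \<le> e * real n)"
  using weak_law_of_large_numbers[of "exp_law r" "\<lambda>x. x" e] assms
    exp_law_square_integrable exp_law_mean prob_space_exp_law
  by simp

lemma (in prob_space) distr_pair_snd:
  assumes "prob_space N" shows "distr (M \<Otimes>\<^sub>M N) N snd = N"
proof (rule measure_eqI)
  interpret N: prob_space N by fact
  fix A assume "A \<in> sets (distr (M \<Otimes>\<^sub>M N) N snd)"
  then have A: "A \<in> sets N" by simp
  have "emeasure (distr (M \<Otimes>\<^sub>M N) N snd) A = emeasure (M \<Otimes>\<^sub>M N) (space M \<times> A)"
    using A sets.sets_into_space[OF A]
    by (subst emeasure_distr) (auto simp: space_pair_measure intro!: arg_cong[where f = "emeasure (M \<Otimes>\<^sub>M N)"])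
  also have "\<dots> = emeasure N A"
    using A by (subst N.emeasure_pair_measure_Times) (auto simp: emeasure_space_1)
  finally show "emeasure (distr (M \<Otimes>\<^sub>M N) N snd) A = emeasure N A" .
qed simp

text \<open>Once \<open>P n\<close> has probability above \<open>1 - prob B\<close> it must meet
  \<open>B\<close>. This replaces conditioning on the fixed event that the lowest row has a nearly
  minimal rate.\<close>

lemma (in prob_space) whp_witness_in:
  assumes P: "whp M P" and B: "B \<in> events" "0 < prob B"
  shows "eventually (\<lambda>n. \<exists>\<omega>\<in>B. P n \<omega>) sequentially"
proof -
  obtain A where A: "\<And>n. A n \<in> sets M" "\<And>n \<omega>. \<omega> \<in> A n \<Longrightarrow> P n \<omega>" "(\<lambda>n. measure M (A n)) \<longlonglongrightarrow> 1"
    using P unfolding whp_def by blast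
  have "eventually (\<lambda>n. 1 - prob B < prob (A n)) sequentially"
    using order_tendstoD(1)[OF A(3), of "1 - prob B"] B(2) by simp
  then show ?thesis
  proof eventually_elim
    case (elim n)
    have "A n \<inter> B \<noteq> {}"
    proof
      assume "A n \<inter> B = {}"
      then have "prob (A n \<union> B) = prob (A n) + prob B"
        using A(1) B(1) by (intro finite_measure_Union) auto
      with elim prob_le_1[of "A n \<union> B"] show False by linarith
    qed
    then show ?case using A(2)[of _ n] by blast
  qed
qed

lemma nat_floor_le: "0 \<le> x \<Longrightarrow> real (nat \<lfloor>x\<rfloor>) \<le> x"
  by (simp add: of_nat_nat)

lemma nat_floor_gt: "x - 1 < real (nat \<lfloor>x\<rfloor>)"
  by linarith

lemma filterlim_nat_floor_mult:
  assumes "0 < (x :: real)"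
  shows "filterlim (\<lambda>n. nat \<lfloor>real n * x\<rfloor>) at_top sequentially"
proof -
  have "filterlim (\<lambda>n. x * real n) at_top sequentially"
    by (rule filterlim_tendsto_pos_mult_at_top[OF tendsto_const assms filterlim_real_sequentially])
  then have "filterlim (\<lambda>n. real n * x) at_top sequentially" by (simp add: mult.commute)
  then show ?thesis
    by (rule filterlim_compose[OF filterlim_compose[OF filterlim_nat_sequentially filterlim_floor_sequentially]])
qed

text \<open>From here on only the law of the rows and the limit are kept; the original probability
  space no longer occurs.\<close>

locale row_limit = rate_law m c for m c +
  fixes \<Psi> :: "real \<Rightarrow> real \<Rightarrow> real"
  assumes rate_near: "\<And>\<epsilon>. \<epsilon> > 0 \<Longrightarrow> measure m {c..<c + \<epsilon>} > 0"
    and limit: "\<And>x y. 0 < x \<Longrightarrow> 0 < y \<Longrightarrow> AE \<rho> in iid (row_law m).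
      (\<lambda>n. last_passage (row_weight \<rho>) (nat \<lfloor>real n * x\<rfloor>) (nat \<lfloor>real n * y\<rfloor>) / real n) \<longlonglongrightarrow> \<Psi> x y"
begin

definition scaled_passage :: "(nat \<Rightarrow> row) \<Rightarrow> real \<Rightarrow> real \<Rightarrow> nat \<Rightarrow> real" where
  "scaled_passage \<rho> x y n = last_passage (row_weight \<rho>) (nat \<lfloor>real n * x\<rfloor>) (nat \<lfloor>real n * y\<rfloor>)"

lemma limit': "0 < x \<Longrightarrow> 0 < y \<Longrightarrow>
    AE \<rho> in iid (row_law m). (\<lambda>n. scaled_passage \<rho> x y n / real n) \<longlonglongrightarrow> \<Psi> x y"
  using limit by (simp add: scaled_passage_def)

lemma AE_nonneg:
  "AE \<rho> in iid (row_law m). (\<forall>z. 0 \<le> row_weight \<rho> z) \<and> (\<forall>z<c. \<forall>j. 0 \<le> left_weight z (\<rho> j))"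
  using AE_rows
proof eventually_elim
  case (elim \<rho>)
  have "0 \<le> row_weight \<rho> (i, j)" for i j
    using elim[rule_format, of j] c_pos by (auto simp: row_weight_def)
  moreover have "0 \<le> left_weight z (\<rho> j)" if "z < c" for z j
    using elim[rule_format, of j] that by (auto simp: left_weight_def split: prod.split)
  ultimately show ?case by auto
qed

lemma scaled_passage_mono:
  assumes "\<And>z. 0 \<le> row_weight \<rho> z" "real n * x \<le> real n' * x'" "real n * y \<le> real n' * y'"
  shows "scaled_passage \<rho> x y n \<le> scaled_passage \<rho> x' y' n'"
  unfolding scaled_passage_def using assms
  by (intro last_passage_mono nat_mono floor_mono) auto

text \<open>For real \<open>t\<close> the rounded endpoints do not match exactly. By monotonicity
  the passage time at scale \<open>n\<close> in direction \<open>(t * x, t * y)\<close> lies between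
  those at the integer scales \<open>N n\<close> and \<open>N n + 1\<close> in direction
  \<open>(x, y)\<close>, and both scales divided by \<open>n\<close> tend to \<open>t\<close>. One
  good sample point suffices, as \<open>\<Psi>\<close> is deterministic.\<close>

lemma limit_homogeneous:
  assumes t: "0 < t" and xy: "0 < x" "0 < y"
  shows "\<Psi> (t * x) (t * y) = t * \<Psi> x y"
proof -
  have "AE \<rho> in iid (row_law m). (\<forall>z. 0 \<le> row_weight \<rho> z) \<and>
      (\<lambda>n. scaled_passage \<rho> x y n / real n) \<longlonglongrightarrow> \<Psi> x y \<and>
      (\<lambda>n. scaled_passage \<rho> (t * x) (t * y) n / real n) \<longlonglongrightarrow> \<Psi> (t * x) (t * y)"
    using AE_nonneg limit'[OF xy] limit'[OF mult_pos_pos[OF t xy(1)] mult_pos_pos[OF t xy(2)]]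
    by eventually_elim simp
  from RS.whp_witness[OF RS.whp_AE[OF this]] obtain \<rho> where
    nn: "\<And>z. 0 \<le> row_weight \<rho> z" and l1: "(\<lambda>n. scaled_passage \<rho> x y n / real n) \<longlonglongrightarrow> \<Psi> x y"
    and l2: "(\<lambda>n. scaled_passage \<rho> (t * x) (t * y) n / real n) \<longlonglongrightarrow> \<Psi> (t * x) (t * y)"
    by (auto simp: eventually_sequentially)
  define N where "N n = nat \<lfloor>real n * t\<rfloor>" for n
  have N: "filterlim N at_top sequentially" unfolding N_def[abs_def] by (rule filterlim_nat_floor_mult[OF t])
  have N': "filterlim (\<lambda>n. Suc (N n)) at_top sequentially"
    by (rule filterlim_compose[OF filterlim_Suc N])
  have Nle: "real (N n) \<le> real n * t" "real n * t \<le> real (Suc (N n))" for n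
  proof -
    show "real (N n) \<le> real n * t" unfolding N_def using t by (intro nat_floor_le) simp
    show "real n * t \<le> real (Suc (N n))"
      using nat_floor_gt[of "real n * t"] unfolding N_def of_nat_Suc by linarith
  qed
  have ratio: "(\<lambda>n. real (N n) / real n) \<longlonglongrightarrow> t"
  proof (rule tendsto_sandwich[of "\<lambda>n. t - 1 / real n" _ _ "\<lambda>_. t"])
    show "eventually (\<lambda>n. t - 1 / real n \<le> real (N n) / real n) sequentially"
      using eventually_gt_at_top[of 0]
    proof eventually_elim
      case (elim n)
      then have "t - 1 / real n = (real n * t - 1) / real n" by (simp add: diff_divide_distrib)
      also have "\<dots> \<le> real (N n) / real n" using Nle(2)[of n] by (intro divide_right_mono) auto
      finally show ?case .
    qed
    show "eventually (\<lambda>n. real (N n) / real n \<le> t) sequentially"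
      using eventually_gt_at_top[of 0]
    proof eventually_elim
      case (elim n)
      then show ?case using Nle(1)[of n] by (simp add: field_simps)
    qed
    show "(\<lambda>n. t - 1 / real n) \<longlonglongrightarrow> t"
      using tendsto_diff[OF tendsto_const lim_1_over_n, of t] by simp
  qed simp
  have ratio': "(\<lambda>n. real (Suc (N n)) / real n) \<longlonglongrightarrow> t"
    using tendsto_add[OF ratio lim_1_over_n] by (simp add: add_divide_distrib add.commute)
  have pull: "(\<lambda>n. scaled_passage \<rho> x y (g n) / real n) \<longlonglongrightarrow> t * \<Psi> x y"
    if g: "filterlim g at_top sequentially" "(\<lambda>n. real (g n) / real n) \<longlonglongrightarrow> t" for g
  proof -
    have "(\<lambda>n. real (g n) / real n * (scaled_passage \<rho> x y (g n) / real (g n))) \<longlonglongrightarrow> t * \<Psi> x y"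
      using filterlim_compose[OF l1 g(1)] by (intro tendsto_mult g(2)) (simp add: o_def)
    moreover have "eventually (\<lambda>n. real (g n) / real n * (scaled_passage \<rho> x y (g n) / real (g n))
        = scaled_passage \<rho> x y (g n) / real n) sequentially"
      using filterlim_at_top[THEN iffD1, OF g(1), rule_format, of 1]
      by eventually_elim simp
    ultimately show ?thesis using tendsto_cong by fast
  qed
  have le: "scaled_passage \<rho> x y (N n) \<le> scaled_passage \<rho> (t * x) (t * y) n"
    "scaled_passage \<rho> (t * x) (t * y) n \<le> scaled_passage \<rho> x y (Suc (N n))" for n
  proof -
    have "real (N n) * w \<le> real n * (t * w)" "real n * (t * w) \<le> real (Suc (N n)) * w" if "0 < w" for w
      using mult_right_mono[OF Nle(1)[of n], of w] mult_right_mono[OF Nle(2)[of n], of w] that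
      by (simp_all only: mult.assoc less_imp_le)
    then show "scaled_passage \<rho> x y (N n) \<le> scaled_passage \<rho> (t * x) (t * y) n"
      "scaled_passage \<rho> (t * x) (t * y) n \<le> scaled_passage \<rho> x y (Suc (N n))"
      using xy by (blast intro: scaled_passage_mono nn)+
  qed
  have "t * \<Psi> x y \<le> \<Psi> (t * x) (t * y)"
    by (rule LIMSEQ_le[OF pull[OF N ratio] l2]) (use le(1) in \<open>simp add: divide_right_mono\<close>)
  moreover have "\<Psi> (t * x) (t * y) \<le> t * \<Psi> x y"
    by (rule LIMSEQ_le[OF l2 pull[OF N' ratio']]) (use le(2) in \<open>simp add: divide_right_mono\<close>)
  ultimately show ?thesis by simp
qed

lemma scaled_passage_measurable: "(\<lambda>\<rho>. scaled_passage \<rho> x y n) \<in> borel_measurable (iid (row_law m))"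
  unfolding scaled_passage_def by (rule measurable_compose[OF row_weight_measurable(2) last_passage_measurable])

text \<open>The offsets may vary with \<open>n\<close>: the almost sure limit is first weakened to
  one in probability, which depends on the law alone and is therefore preserved by the
  shifts.\<close>

lemma whp_scaled_passage:
  assumes "0 < x" "0 < y" "0 < e"
  shows "whp (iid (row_law m)) (\<lambda>n \<rho>. \<bar>scaled_passage (shift_rows (a n) (b n) \<rho>) x y n / real n - \<Psi> x y\<bar> < e)"
proof -
  have "whp (iid (row_law m)) (\<lambda>n \<rho>. \<bar>scaled_passage \<rho> x y n / real n - \<Psi> x y\<bar> < e)"
    using assms by (intro RS.whp_tendsto limit' borel_measurable_divide scaled_passage_measurable) auto
  from RS.whp_distr[OF this shift_rows_measurable distr_shift_rows] show ?thesis .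
qed

lemma shift_rows_0 [simp]: "shift_rows 0 0 \<rho> = \<rho>"
  by (auto simp: shift_rows_def)

text \<open>Paths are concatenated at the rounded point of direction \<open>(x, y)\<close>. The
  second piece lives in an environment translated by an amount depending on \<open>n\<close>, hence
  the use of convergence in probability; rounding is harmless because the sum of two floors is at
  most the floor of the sum.\<close>

lemma limit_superadditive:
  assumes "0 < x" "0 < y" "0 < x'" "0 < y'"
  shows "\<Psi> x y + \<Psi> x' y' \<le> \<Psi> (x + x') (y + y')"
proof (rule field_le_epsilon)
  fix e :: real assume e: "0 < e"
  define k where "k n = nat \<lfloor>real n * x\<rfloor>" for n
  define l where "l n = nat \<lfloor>real n * y\<rfloor>" for n
  let ?d = "e / 3"
  have "whp (iid (row_law m)) (\<lambda>n \<rho>. (\<bar>scaled_passage (shift_rows 0 0 \<rho>) x y n / real n - \<Psi> x y\<bar> < ?d \<and>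
      \<bar>scaled_passage (shift_rows (k n) (l n) \<rho>) x' y' n / real n - \<Psi> x' y'\<bar> < ?d) \<and>
      (\<bar>scaled_passage (shift_rows 0 0 \<rho>) (x + x') (y + y') n / real n - \<Psi> (x + x') (y + y')\<bar> < ?d \<and>
      (\<forall>z. 0 \<le> row_weight \<rho> z) \<and> (\<forall>z<c. \<forall>j. 0 \<le> left_weight z (\<rho> j))))"
    using assms e by (intro RS.whp_conj whp_scaled_passage RS.whp_AE AE_nonneg) auto
  from RS.whp_witness[OF this] obtain n0 where n0: "\<And>n. n \<ge> n0 \<Longrightarrow> \<exists>\<rho>\<in>space (iid (row_law m)). (\<bar>scaled_passage (shift_rows 0 0 \<rho>) x y n / real n - \<Psi> x y\<bar> < ?d \<and>
      \<bar>scaled_passage (shift_rows (k n) (l n) \<rho>) x' y' n / real n - \<Psi> x' y'\<bar> < ?d) \<and>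
      (\<bar>scaled_passage (shift_rows 0 0 \<rho>) (x + x') (y + y') n / real n - \<Psi> (x + x') (y + y')\<bar> < ?d \<and>
      (\<forall>z. 0 \<le> row_weight \<rho> z) \<and> (\<forall>z<c. \<forall>j. 0 \<le> left_weight z (\<rho> j)))"
    unfolding eventually_sequentially by blast
  define n where "n = Suc n0"
  from n0[of n] obtain \<rho> where *: "\<bar>scaled_passage \<rho> x y n / real n - \<Psi> x y\<bar> < ?d"
      "\<bar>scaled_passage (shift_rows (k n) (l n) \<rho>) x' y' n / real n - \<Psi> x' y'\<bar> < ?d"
      "\<bar>scaled_passage \<rho> (x + x') (y + y') n / real n - \<Psi> (x + x') (y + y')\<bar> < ?d"
      and nn: "\<And>z. 0 \<le> row_weight \<rho> z" by (auto simp: n_def)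
  have sh: "row_weight (shift_rows (k n) (l n) \<rho>) = (\<lambda>(i, j). row_weight \<rho> (k n + i, l n + j))"
    by (simp add: row_weight_shift_rows add.commute)
  have "scaled_passage \<rho> x y n + scaled_passage (shift_rows (k n) (l n) \<rho>) x' y' n
      \<le> last_passage (row_weight \<rho>) (k n + nat \<lfloor>real n * x'\<rfloor>) (l n + nat \<lfloor>real n * y'\<rfloor>)"
    unfolding scaled_passage_def sh k_def[symmetric] l_def[symmetric] by (rule last_passage_superadditive)
  also have "\<dots> \<le> scaled_passage \<rho> (x + x') (y + y') n"
    unfolding scaled_passage_def k_def l_def using assms
    by (intro last_passage_mono nn) (auto simp: distrib_left nat_add_distrib[symmetric] intro!: nat_mono le_floor_add)
  finally have "scaled_passage \<rho> x y n / real n + scaled_passage (shift_rows (k n) (l n) \<rho>) x' y' n / real n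
      \<le> scaled_passage \<rho> (x + x') (y + y') n / real n"
    by (simp add: add_divide_distrib[symmetric] divide_right_mono)
  with * show "\<Psi> x y + \<Psi> x' y' \<le> \<Psi> (x + x') (y + y') + e" by linarith
qed

text \<open>Homogeneity moves the weights \<open>u\<close> and \<open>v\<close> into both
  coordinates; superadditivity then adds the second coordinates up to one.\<close>

lemma limit_concave: "concave_on {0<..} (\<lambda>x. \<Psi> x 1)"
  unfolding concave_on_iff
proof safe
  fix x x' u v :: real
  assume x: "0 < x" "0 < x'" and uv: "0 \<le> u" "0 \<le> v" "u + v = 1"
  show "u * \<Psi> x 1 + v * \<Psi> x' 1 \<le> \<Psi> (u *\<^sub>R x + v *\<^sub>R x') 1"
  proof (cases "u = 0 \<or> v = 0")
    case True
    with uv show ?thesis by auto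
  next
    case False
    with uv have pos: "0 < u" "0 < v" by auto
    have "u * \<Psi> x 1 + v * \<Psi> x' 1 = \<Psi> (u * x) (u * 1) + \<Psi> (v * x') (v * 1)"
      using pos x by (simp only: limit_homogeneous zero_less_one)
    also have "\<dots> \<le> \<Psi> (u * x + v * x') (u * 1 + v * 1)"
      using pos x by (intro limit_superadditive) auto
    finally show ?thesis using uv by simp
  qed
qed

end

section \<open>The variational formula\<close>

context row_limit begin

lemma row_component_measurable: "(\<lambda>\<rho>. \<rho> j) \<in> iid (row_law m) \<rightarrow>\<^sub>M row_law m"
  by (rule measurable_component_singleton) simp

lemma distr_row_component: "distr (iid (row_law m)) (row_law m) (\<lambda>\<rho>. \<rho> j) = row_law m"
  by (rule distr_PiM_component) (auto intro: R.prob_space_axioms)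

lemma distr_bulk:
  shows "(\<lambda>s. snd (snd s)) \<in> row_law m \<rightarrow>\<^sub>M iid (exp_law 1)"
    and "distr (row_law m) (iid (exp_law 1)) (\<lambda>s. snd (snd s)) = iid (exp_law 1)"
proof -
  interpret EX: pair_prob_space "exp_law 1" "iid (exp_law 1)" ..
  show 1: "(\<lambda>s. snd (snd s)) \<in> row_law m \<rightarrow>\<^sub>M iid (exp_law 1)"
    unfolding row_law_def by measurable
  have "distr (row_law m) (iid (exp_law 1)) (\<lambda>s. snd (snd s))
    = distr (distr (row_law m) (exp_law 1 \<Otimes>\<^sub>M iid (exp_law 1)) snd) (iid (exp_law 1)) snd"
    unfolding row_law_def by (subst distr_distr) (simp_all add: o_def)
  also have "\<dots> = distr (exp_law 1 \<Otimes>\<^sub>M iid (exp_law 1)) (iid (exp_law 1)) snd"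
    unfolding row_law_def by (subst distr_pair_snd) (rule EX.prob_space_axioms, rule refl)
  also have "\<dots> = iid (exp_law 1)"
    by (rule E.distr_pair_snd) (rule X.prob_space_axioms)
  finally show "distr (row_law m) (iid (exp_law 1)) (\<lambda>s. snd (snd s)) = iid (exp_law 1)" .
qed

lemma distr_rate: "fst \<in> row_law m \<rightarrow>\<^sub>M m" "distr (row_law m) m fst = m"
proof -
  interpret EX: pair_prob_space "exp_law 1" "iid (exp_law 1)" ..
  show "fst \<in> row_law m \<rightarrow>\<^sub>M m" unfolding row_law_def by measurable
  show "distr (row_law m) m fst = m" unfolding row_law_def by (rule EX.distr_pair_fst)
qed

text \<open>Follow the lowest row on the event, of positive probability, that its rate is close to \<open>c\<close>.\<close>

lemma limit_ge_row:
  assumes x: "0 < x"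
  shows "x / c \<le> \<Psi> x 1"
proof -
  \<comment> \<open>The three corrections account for rounding down (\<open>x - d\<close>), the weak
    law for the row sum (\<open>1 - d\<close>) and a rate that is only close to minimal
    (\<open>c + d\<close>).\<close>
  have bound: "(x - d) * (1 - d) / (c + d) \<le> \<Psi> x 1 + d" if d: "0 < d" "d < 1" "d < x" for d
  proof -
    define k where "k n = nat \<lfloor>real n * x\<rfloor>" for n
    have k: "filterlim k at_top sequentially" unfolding k_def[abs_def] by (rule filterlim_nat_floor_mult[OF x])
    let ?B = "{\<rho> \<in> space (iid (row_law m)). fst (\<rho> 0) < c + d}"
    have Bm: "?B = (\<lambda>\<rho>. fst (\<rho> 0)) -` {..<c + d} \<inter> space (iid (row_law m))" by auto
    have r0: "(\<lambda>\<rho>. fst (\<rho> 0)) \<in> iid (row_law m) \<rightarrow>\<^sub>M m"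
      by (rule measurable_compose[OF row_component_measurable distr_rate(1)])
    have B: "?B \<in> RS.events" unfolding Bm by (rule measurable_sets[OF r0]) simp
    have "RS.prob ?B = measure (distr (iid (row_law m)) m (\<lambda>\<rho>. fst (\<rho> 0))) {..<c + d}"
      unfolding Bm by (rule measure_distr[OF r0, symmetric]) simp
    also have "distr (iid (row_law m)) m (\<lambda>\<rho>. fst (\<rho> 0)) = m"
      using distr_distr[OF distr_rate(1) row_component_measurable, of 0] by (simp add: distr_row_component distr_rate o_def)
    also have "measure m {..<c + d} \<ge> measure m {c..<c + d}"
      by (rule finite_measure_mono) auto
    finally have Bpos: "0 < RS.prob ?B" using rate_near[OF d(1)] by linarith
    have "whp (iid (exp_law 1)) (\<lambda>n u. \<bar>(\<Sum>i<n. u i) - real n / 1\<bar> \<le> d * real n)"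
      using d by (intro whp_exp_law_sum) auto
    from whp_subseq[OF this k]
    have "whp (iid (exp_law 1)) (\<lambda>n u. \<bar>(\<Sum>i<k n. u i) - real (k n)\<bar> \<le> d * real (k n))" by simp
    from R.whp_distr[OF this distr_bulk]
    have "whp (row_law m) (\<lambda>n s. \<bar>(\<Sum>i<k n. snd (snd s) i) - real (k n)\<bar> \<le> d * real (k n))" .
    from RS.whp_distr[OF this row_component_measurable distr_row_component[of 0]]
    have "whp (iid (row_law m)) (\<lambda>n \<rho>. \<bar>(\<Sum>i<k n. snd (snd (\<rho> 0)) i) - real (k n)\<bar> \<le> d * real (k n))" .
    from RS.whp_conj[OF this RS.whp_conj[OF whp_scaled_passage[OF x zero_less_one d(1), of "\<lambda>_. 0" "\<lambda>_. 0"]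
          RS.whp_conj[OF RS.whp_AE[OF AE_nonneg] RS.whp_AE[OF AE_rows]]]]
    have "eventually (\<lambda>n. \<exists>\<rho>\<in>?B. \<bar>(\<Sum>i<k n. snd (snd (\<rho> 0)) i) - real (k n)\<bar> \<le> d * real (k n) \<and>
       \<bar>scaled_passage (shift_rows 0 0 \<rho>) x 1 n / real n - \<Psi> x 1\<bar> < d \<and>
       ((\<forall>z. 0 \<le> row_weight \<rho> z) \<and> (\<forall>z<c. \<forall>j. 0 \<le> left_weight z (\<rho> j))) \<and>
       (\<forall>j. c \<le> fst (\<rho> j) \<and> 0 \<le> fst (snd (\<rho> j)) \<and> (\<forall>i. 0 \<le> snd (snd (\<rho> j)) i))) sequentially"
      by (rule RS.whp_witness_in[OF _ B Bpos])
    moreover have "eventually (\<lambda>n. n > nat \<lceil>1 / d\<rceil>) sequentially" by (rule eventually_gt_at_top)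
    ultimately have "eventually (\<lambda>n. (x - d) * (1 - d) / (c + d) \<le> \<Psi> x 1 + d) sequentially"
    proof eventually_elim
      case (elim n)
      then obtain \<rho> where r: "fst (\<rho> 0) < c + d" "c \<le> fst (\<rho> 0)"
        and s: "\<bar>(\<Sum>i<k n. snd (snd (\<rho> 0)) i) - real (k n)\<bar> \<le> d * real (k n)"
        and p: "\<bar>scaled_passage \<rho> x 1 n / real n - \<Psi> x 1\<bar> < d"
        and nn: "\<And>z. 0 \<le> row_weight \<rho> z" by auto
      have n: "0 < real n" "1 \<le> d * real n"
      proof -
        have "1 / d \<le> real n" using elim(2) by linarith
        then show "1 \<le> d * real n" using d by (simp add: field_simps)
        show "0 < real n" using elim(2) by simp
      qed
      have kn: "real n * (x - d) \<le> real (k n)"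
        using nat_floor_gt[of "real n * x"] n(2) unfolding k_def by (simp add: algebra_simps)
      have "real n * ((x - d) * (1 - d) / (c + d)) = real n * (x - d) * (1 - d) / (c + d)" by simp
      also have "\<dots> \<le> real (k n) * (1 - d) / (c + d)"
        using kn d c_pos by (intro divide_right_mono mult_right_mono) auto
      also have "\<dots> \<le> (\<Sum>i<k n. snd (snd (\<rho> 0)) i) / (c + d)"
        using s d c_pos by (intro divide_right_mono) (auto simp: algebra_simps abs_le_iff)
      also have "\<dots> \<le> (\<Sum>i<k n. snd (snd (\<rho> 0)) i) / fst (\<rho> 0)"
      proof (rule divide_left_mono)
        have "0 \<le> real (k n) * (1 - d)" using d by simp
        also have "\<dots> \<le> (\<Sum>i<k n. snd (snd (\<rho> 0)) i)" using s by (auto simp: algebra_simps abs_le_iff)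
        finally show "0 \<le> (\<Sum>i<k n. snd (snd (\<rho> 0)) i)" .
      qed (use r c_pos in auto)
      also have "\<dots> = (\<Sum>i<k n. row_weight \<rho> (i, 0))"
        by (simp add: row_weight_def sum_divide_distrib)
      also have "\<dots> \<le> scaled_passage \<rho> x 1 n"
        unfolding scaled_passage_def k_def by (rule row_sum_le_last_passage[OF nn]) simp
      finally have "(x - d) * (1 - d) / (c + d) \<le> scaled_passage \<rho> x 1 n / real n"
        using n by (simp add: pos_le_divide_eq mult.commute)
      with p show ?case by linarith
    qed
    then show ?thesis by simp
  qed
  have "((\<lambda>d. (x - d) * (1 - d) / (c + d)) \<longlongrightarrow> (x - 0) * (1 - 0) / (c + 0)) (at_right 0)"
    using c_pos by (intro tendsto_intros) auto
  moreover have "((\<lambda>d. \<Psi> x 1 + d) \<longlongrightarrow> \<Psi> x 1 + 0) (at_right 0)"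
    by (intro tendsto_intros)
  moreover have "eventually (\<lambda>d. (x - d) * (1 - d) / (c + d) \<le> \<Psi> x 1 + d) (at_right 0)"
    using eventually_at_right_less[of 0] eventually_at_right_real[of 0 "min 1 x"] x
    by (auto elim!: eventually_mono intro!: bound)
  ultimately have "(x - 0) * (1 - 0) / (c + 0) \<le> \<Psi> x 1 + 0"
    by (intro tendsto_le[OF trivial_limit_at_right_real])
  then show ?thesis by simp
qed

end

section \<open>The upper half of the variational formula\<close>

locale row_limit_boundary = row_limit m c \<Psi> for m c \<Psi> +
  fixes z :: real
  assumes z: "0 < z" "z < c"
begin

abbreviation Q :: "((nat \<Rightarrow> row) \<times> (nat \<Rightarrow> real)) measure" where
  "Q \<equiv> iid (row_law m) \<Otimes>\<^sub>M iid (exp_law z)"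

sublocale Z1: prob_space "exp_law z" using z by (intro prob_space_exp_law)
sublocale Z: prob_space "iid (exp_law z)" by (rule prob_space_iid) unfold_locales
sublocale QS: pair_prob_space "iid (row_law m)" "iid (exp_law z)" ..

lemma whp_fst: "whp (iid (row_law m)) P \<Longrightarrow> whp Q (\<lambda>n p. P n (fst p))"
  by (rule QS.whp_distr[OF _ measurable_fst Z.distr_pair_fst])

lemma whp_snd: "whp (iid (exp_law z)) P \<Longrightarrow> whp Q (\<lambda>n p. P n (snd p))"
  by (rule QS.whp_distr[OF _ measurable_snd RS.distr_pair_snd[OF Z.prob_space_axioms]])

text \<open>By Burke's theorem the increments at height \<open>l n\<close> have the law of the
  input, whatever \<open>l\<close> is, so the weak law for the input applies although the height
  moves.\<close>

lemma whp_level_sum: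
  assumes k: "filterlim k at_top sequentially" and e: "0 < e"
  shows "whp Q (\<lambda>n p. \<bar>(\<Sum>i<k n. level z (fst p) (snd p) (l n) i) - real (k n) / z\<bar> \<le> e * real (k n))"
proof -
  have meas: "(\<lambda>(\<rho>, u). level z \<rho> u l) \<in> Q \<rightarrow>\<^sub>M iid (exp_law z)" for l
    using level_measurable[of z l] by (simp cong: measurable_cong_sets sets_pair_measure_cong)
  from QS.whp_distr[OF whp_subseq[OF whp_exp_law_sum[OF z(1) e] k] meas distr_level[OF z]]
  show ?thesis by (simp add: split_beta')
qed

lemma whp_input_sum:
  assumes "filterlim k at_top sequentially" "0 < e"
  shows "whp Q (\<lambda>n p. \<bar>(\<Sum>i<k n. snd p i) - real (k n) / z\<bar> \<le> e * real (k n))"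
  by (rule whp_snd[OF whp_subseq[OF whp_exp_law_sum[OF z(1) assms(2)] assms(1)]])

lemma whp_left_sum:
  assumes "filterlim k at_top sequentially" "0 < e"
  shows "whp Q (\<lambda>n p. \<bar>(\<Sum>j<k n. left_weight z (fst p j)) - real (k n) * mean_inverse z\<bar> \<le> e * real (k n))"
proof -
  have "whp (iid (row_law m)) (\<lambda>n \<rho>. \<bar>(\<Sum>i<n. left_weight z (\<rho> i)) - real n * mean_inverse z\<bar> \<le> e * real n)"
    using weak_law_of_large_numbers[OF R.prob_space_axioms left_weight_measurable left_weight_square_integrable[OF z(2)] assms(2)]
    by (simp add: left_weight_mean[OF z(2)])
  from whp_fst[OF whp_subseq[OF this assms(1)]] show ?thesis .
qed

lemma whp_nonneg:
  "whp Q (\<lambda>n p. ((\<forall>y. 0 \<le> row_weight (fst p) y) \<and> (\<forall>j. 0 \<le> left_weight z (fst p j))) \<and> (\<forall>i. 0 \<le> snd p i))"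
proof (rule QS.whp_conj)
  show "whp Q (\<lambda>n p. (\<forall>y. 0 \<le> row_weight (fst p) y) \<and> (\<forall>j. 0 \<le> left_weight z (fst p j)))"
    by (rule whp_mono[OF whp_fst[OF RS.whp_AE[OF AE_nonneg]]]) (use z in auto)
  have "AE u in iid (exp_law z). 0 \<le> u i" for i
    by (rule AE_PiM_component) (auto intro: Z1.prob_space_axioms AE_exp_law_nonneg)
  then have "AE u in iid (exp_law z). \<forall>i. 0 \<le> u i" by (subst AE_all_countable) blast
  from whp_snd[OF Z.whp_AE[OF this]] show "whp Q (\<lambda>n p. \<forall>i. 0 \<le> snd p i)" .
qed

lemma limit_le:
  assumes x: "0 < x" and y: "0 < y"
  shows "\<Psi> x y \<le> x / z + y * mean_inverse z"
proof -
  let ?g = "mean_inverse z"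
  have g: "0 \<le> ?g" using mean_inverse_bounds z by simp
  \<comment> \<open>The slack in \<open>x + e\<close> and \<open>y + e\<close> absorbs the extra row
    and column of the boundary lattice, since \<open>1 \<le> e * n\<close> for large
    \<open>n\<close>; the slack in the other factors is that of the weak laws.\<close>
  have bound: "\<Psi> x y - e \<le> (y + e) * (?g + e) + (x + e) * (1 / z + e)" if e: "0 < e" for e
  proof -
    define k where "k n = nat \<lfloor>real n * x\<rfloor>" for n
    define l where "l n = nat \<lfloor>real n * y\<rfloor>" for n
    have k: "filterlim (\<lambda>n. Suc (k n)) at_top sequentially" and l: "filterlim (\<lambda>n. Suc (l n)) at_top sequentially"
      unfolding k_def l_def by (rule filterlim_compose[OF filterlim_Suc filterlim_nat_floor_mult], fact)+
    have "eventually (\<lambda>n. \<exists>p\<in>space Q.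
        \<bar>(\<Sum>i<Suc (k n). level z (fst p) (snd p) (Suc (l n)) i) - real (Suc (k n)) / z\<bar> \<le> e * real (Suc (k n)) \<and>
        \<bar>(\<Sum>j<Suc (l n). left_weight z (fst p j)) - real (Suc (l n)) * mean_inverse z\<bar> \<le> e * real (Suc (l n)) \<and>
        \<bar>scaled_passage (shift_rows 0 0 (fst p)) x y n / real n - \<Psi> x y\<bar> < e \<and>
        ((\<forall>y. 0 \<le> row_weight (fst p) y) \<and> (\<forall>j. 0 \<le> left_weight z (fst p j))) \<and> (\<forall>i. 0 \<le> snd p i)) sequentially"
      by (intro QS.whp_witness QS.whp_conj whp_level_sum[OF k e] whp_left_sum[OF l e] whp_nonneg
          whp_fst[OF whp_scaled_passage[OF x y e]])
    moreover have "eventually (\<lambda>n. n > nat \<lceil>1 / e\<rceil>) sequentially" by (rule eventually_gt_at_top)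
    ultimately have "eventually (\<lambda>n. \<Psi> x y - e \<le> (y + e) * (?g + e) + (x + e) * (1 / z + e)) sequentially"
    proof eventually_elim
      case (elim n)
      then obtain \<rho> u where
        L: "\<bar>(\<Sum>i<Suc (k n). level z \<rho> u (Suc (l n)) i) - real (Suc (k n)) / z\<bar> \<le> e * real (Suc (k n))"
        and V: "\<bar>(\<Sum>j<Suc (l n). left_weight z (\<rho> j)) - real (Suc (l n)) * ?g\<bar> \<le> e * real (Suc (l n))"
        and p: "\<bar>scaled_passage \<rho> x y n / real n - \<Psi> x y\<bar> < e"
        and nn: "\<And>y. 0 \<le> row_weight \<rho> y" "\<And>j. 0 \<le> left_weight z (\<rho> j)" "\<And>i. 0 \<le> u i"
        by (auto simp del: sum.lessThan_Suc of_nat_Suc level.simps)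
      have n: "0 < real n" "1 \<le> e * real n"
      proof -
        have "1 / e \<le> real n" using elim(2) by linarith
        then show "1 \<le> e * real n" using e by (simp add: field_simps)
        show "0 < real n" using elim(2) by simp
      qed
      have sizes: "real (Suc (l n)) \<le> real n * (y + e)" "real (Suc (k n)) \<le> real n * (x + e)"
      proof -
        have "real (l n) \<le> real n * y" "real (k n) \<le> real n * x"
          unfolding k_def l_def using x y by (intro nat_floor_le; simp)+
        with n(2) show "real (Suc (l n)) \<le> real n * (y + e)" "real (Suc (k n)) \<le> real n * (x + e)"
          by (simp_all add: distrib_left mult.commute)
      qed
      have "scaled_passage \<rho> x y n \<le> last_passage (row_weight \<rho>) (k n) (l n) + row_weight \<rho> (k n, l n)"
        using nn(1) by (simp add: scaled_passage_def k_def l_def)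
      also have "\<dots> \<le> boundary_passage u (\<lambda>j. left_weight z (\<rho> j)) (row_weight \<rho>) (Suc (k n)) (Suc (l n))"
        by (intro last_passage_le_boundary_passage nn)
      also have "\<dots> = (\<Sum>j<Suc (l n). left_weight z (\<rho> j)) + (\<Sum>i<Suc (k n). level z \<rho> u (Suc (l n)) i)"
        by (rule boundary_passage_eq_sum_level)
      also have "\<dots> \<le> (real (Suc (l n)) * ?g + e * real (Suc (l n))) + (real (Suc (k n)) / z + e * real (Suc (k n)))"
        using L V unfolding abs_le_iff by linarith
      also have "\<dots> = real (Suc (l n)) * (?g + e) + real (Suc (k n)) * (1 / z + e)"
        by (simp add: distrib_left mult.commute del: of_nat_Suc)
      also have "\<dots> \<le> real n * (y + e) * (?g + e) + real n * (x + e) * (1 / z + e)"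
        using sizes g e z by (intro add_mono mult_right_mono) auto
      also have "\<dots> = real n * ((y + e) * (?g + e) + (x + e) * (1 / z + e))"
        by (simp only: distrib_left[of "real n" "_ * _" "_ * _"] mult.assoc)
      finally have "scaled_passage \<rho> x y n / real n \<le> (y + e) * (?g + e) + (x + e) * (1 / z + e)"
        using n by (simp add: pos_divide_le_eq mult.commute)
      with p show ?case by linarith
    qed
    then show ?thesis by simp
  qed
  have "((\<lambda>e. \<Psi> x y - e) \<longlongrightarrow> \<Psi> x y - 0) (at_right 0)" by (intro tendsto_intros)
  moreover have "((\<lambda>e. (y + e) * (?g + e) + (x + e) * (1 / z + e)) \<longlongrightarrow> (y + 0) * (?g + 0) + (x + 0) * (1 / z + 0)) (at_right 0)"
    by (intro tendsto_intros)
  moreover have "eventually (\<lambda>e. \<Psi> x y - e \<le> (y + e) * (?g + e) + (x + e) * (1 / z + e)) (at_right 0)"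
    using eventually_at_right_less[of 0] by eventually_elim (rule bound)
  ultimately have "\<Psi> x y - 0 \<le> (y + 0) * (?g + 0) + (x + 0) * (1 / z + 0)"
    by (intro tendsto_le[OF trivial_limit_at_right_real])
  then show ?thesis by simp
qed

end

section \<open>Duality: the lower half of the variational formula\<close>

lemma (in row_limit) scaled_passage_of_nat:
  "scaled_passage \<rho> (real a) (real b) t = last_passage (row_weight \<rho>) (t * a) (t * b)"
proof -
  have "nat \<lfloor>real t * real a\<rfloor> = t * a" for a
    by (simp only: of_nat_mult[symmetric] floor_of_nat nat_int)
  then show ?thesis by (simp add: scaled_passage_def)
qed

text \<open>Compare the stationary passage time with the bulk one. In a box that is much wider than high an optimal
  path leaves along the horizontal axis; the point where it does so is located up to one of \<open>M\<close> blocks.\<close>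

context row_limit_boundary begin

lemma mean_inverse_le_limit:
  assumes \<epsilon>: "0 < \<epsilon>"
  shows "\<exists>x>0. mean_inverse z \<le> \<Psi> x 1 - x / z + \<epsilon>"
proof -
  let ?g = "mean_inverse z"
  \<comment> \<open>Any point strictly between \<open>z\<close> and \<open>c\<close> would do: the
    upper bound at \<open>z'\<close> grows with the width at slope \<open>1 / z'\<close>, strictly
    below the slope \<open>1 / z\<close> of the stationary passage time.\<close>
  define z' where "z' = (z + c) / 2"
  have z': "z < z'" "z' < c" using z by (simp_all add: z'_def)
  interpret B': row_limit_boundary m c \<Psi> z'
    using z z' by unfold_locales auto
  let ?g' = "mean_inverse z'"
  have gap: "0 < 1 / z - 1 / z'" using z z' by (simp add: frac_less2)
  \<comment> \<open>\<open>K\<close> is the ratio of width to height of the box. The difference of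
    slopes over this width must beat \<open>?g'\<close> plus all errors per unit of height; these
    errors amount to at most 2.\<close>
  obtain K :: nat where K0: "?g' + 3 < real K * (1 / z - 1 / z')"
    using reals_Archimedean3[OF gap] by blast
  have "0 \<le> ?g'" using mean_inverse_bounds z' by simp
  with K0 gap have K: "0 < K" by (intro gr0I) auto
  \<comment> \<open>The box has \<open>M\<close> blocks of width \<open>K * t\<close> and height
    \<open>M * t\<close>. Locating the exit only up to a block costs \<open>K / z\<close> in all,
    hence \<open>K / (M * z)\<close> per unit of height.\<close>
  obtain M0 :: nat where M0: "real K / z < real M0 * (\<epsilon> / 2)"
    using reals_Archimedean3[OF half_gt_zero[OF \<epsilon>]] by blast
  define M where "M = Suc M0"
  have M: "0 < M" "real K / (real M * z) \<le> \<epsilon> / 2"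
  proof -
    have "real K / z < real M * (\<epsilon> / 2)" using M0 \<epsilon> by (simp add: M_def algebra_simps)
    then have "real K / z / real M \<le> \<epsilon> / 2"
      by (subst pos_divide_le_eq) (simp_all add: M_def mult.commute del: of_nat_Suc)
    then show "real K / (real M * z) \<le> \<epsilon> / 2" by (simp add: mult.commute)
  qed (simp add: M_def)
  \<comment> \<open>The final inequality contains four errors \<open>\<eta>\<close>, from the left
    sum, the top sum, the input sum and the bulk passage; together they take half of
    \<open>\<epsilon>\<close>. The bound by 1 serves the exclusion of vertical exits.\<close>
  define \<eta> where "\<eta> = min 1 (\<epsilon> / 8)"
  have \<eta>: "0 < \<eta>" "\<eta> \<le> 1" "\<eta> \<le> \<epsilon> / 8" using \<epsilon> by (auto simp: \<eta>_def)
  have lin: "filterlim (\<lambda>t. a * t) at_top sequentially" if "0 < a" for a :: nat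
    using that by (rule mult_nat_left_at_top)
  have KM: "0 < K * M" using K M by simp
  define P1 where "P1 t p \<longleftrightarrow> \<bar>(\<Sum>i<K * M * t. level z (fst p) (snd p) (M * t) i) - real (K * M * t) / z\<bar> \<le> \<eta> / real (K * M) * real (K * M * t)" for t and p :: "(nat \<Rightarrow> row) \<times> (nat \<Rightarrow> real)"
  define P2 where "P2 t p \<longleftrightarrow> \<bar>(\<Sum>j<M * t. left_weight z (fst p j)) - real (M * t) * ?g\<bar> \<le> \<eta> / real M * real (M * t)" for t and p :: "(nat \<Rightarrow> row) \<times> (nat \<Rightarrow> real)"
  \<comment> \<open>Only block ends \<open>a\<close> occur here, and only block starts
    \<open>i\<close> in \<open>P4\<close>. Rounding to blocks keeps the number of events independent
    of \<open>t\<close>, as \<open>whp_ball\<close> requires. The tolerances are scaled so that each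
    error is \<open>\<eta> * t\<close>.\<close>
  define P3 where "P3 t p \<longleftrightarrow> (\<forall>a\<in>{1..M}. \<bar>(\<Sum>i<a * K * t. snd p i) - real (a * K * t) / z\<bar> \<le> \<eta> / real (a * K) * real (a * K * t))" for t and p :: "(nat \<Rightarrow> row) \<times> (nat \<Rightarrow> real)"
  define P4 where "P4 t p \<longleftrightarrow> (\<forall>i\<in>{..<M}. \<bar>scaled_passage (shift_rows (i * K * t) 0 (fst p)) (real ((M - i) * K)) (real M) t / real t - \<Psi> (real ((M - i) * K)) (real M)\<bar> < \<eta>)" for t and p :: "(nat \<Rightarrow> row) \<times> (nat \<Rightarrow> real)"
  define P5 where "P5 p \<longleftrightarrow> ((\<forall>y. 0 \<le> row_weight (fst p) y) \<and> (\<forall>j. 0 \<le> left_weight z (fst p j))) \<and> (\<forall>i. 0 \<le> snd p i)" for p :: "(nat \<Rightarrow> row) \<times> (nat \<Rightarrow> real)"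
  have "whp Q P1" unfolding P1_def using \<eta> KM by (intro whp_level_sum lin) auto
  moreover have "whp Q P2" unfolding P2_def using \<eta> M by (intro whp_left_sum lin) auto
  moreover have "whp Q P3" unfolding P3_def using \<eta> K by (intro QS.whp_ball whp_input_sum lin) auto
  moreover have "whp Q P4" unfolding P4_def using \<eta> K M
    by (intro QS.whp_ball whp_fst[OF whp_scaled_passage]) auto
  moreover have "whp Q (\<lambda>t. P5)" unfolding P5_def by (rule whp_nonneg)
  ultimately have "whp Q (\<lambda>t p. P1 t p \<and> P2 t p \<and> P3 t p \<and> P4 t p \<and> P5 p)"
    by (intro QS.whp_conj)
  from QS.whp_witness[OF this] obtain t0 where "\<And>t. t \<ge> t0 \<Longrightarrow> \<exists>p\<in>space Q. P1 t p \<and> P2 t p \<and> P3 t p \<and> P4 t p \<and> P5 p"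
    unfolding eventually_sequentially by blast
  then obtain t \<rho> u where t: "0 < t" and P: "P1 t (\<rho>, u)" "P2 t (\<rho>, u)" "P3 t (\<rho>, u)" "P4 t (\<rho>, u)" "P5 (\<rho>, u)"
    by (metis le_SucI order_refl surj_pair zero_less_Suc)
  let ?w = "row_weight \<rho>" and ?v = "\<lambda>j. left_weight z (\<rho> j)"
  let ?n = "K * M * t" and ?l = "M * t"
  have nn: "\<And>y. 0 \<le> ?w y" "\<And>j. 0 \<le> ?v j" "\<And>i. 0 \<le> u i" using P(5) by (auto simp: P5_def)
  have L: "\<bar>(\<Sum>i<?n. level z \<rho> u ?l i) - real t * (real K * real M / z)\<bar> \<le> \<eta> * real t"
    using P(1) KM by (simp add: P1_def mult_ac)
  have V: "\<bar>(\<Sum>j<?l. ?v j) - real t * (real M * ?g)\<bar> \<le> \<eta> * real t"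
    using P(2) M by (simp add: P2_def mult_ac)
  have U: "(\<Sum>i<a * K * t. u i) \<le> real t * (real a * real K / z) + \<eta> * real t" if "a \<in> {1..M}" for a
  proof -
    have "\<bar>(\<Sum>i<a * K * t. u i) - real (a * K * t) / z\<bar> \<le> \<eta> / real (a * K) * real (a * K * t)"
      using P(3) that by (simp add: P3_def)
    also have "\<eta> / real (a * K) * real (a * K * t) = \<eta> * real t" using that K by simp
    finally show ?thesis by (simp add: abs_le_iff mult_ac)
  qed
  have S: "last_passage (\<lambda>(i', j). ?w (i' + i * K * t, j)) ((M - i) * K * t) ?l \<le> real t * (\<Psi> (real ((M - i) * K)) (real M) + \<eta>)"
    if "i < M" for i
  proof -
    have "\<bar>scaled_passage (shift_rows (i * K * t) 0 \<rho>) (real ((M - i) * K)) (real M) t / real t - \<Psi> (real ((M - i) * K)) (real M)\<bar> < \<eta>"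
      using P(4) that by (simp add: P4_def)
    then have "scaled_passage (shift_rows (i * K * t) 0 \<rho>) (real ((M - i) * K)) (real M) t / real t \<le> \<Psi> (real ((M - i) * K)) (real M) + \<eta>"
      by linarith
    then have "scaled_passage (shift_rows (i * K * t) 0 \<rho>) (real ((M - i) * K)) (real M) t \<le> real t * (\<Psi> (real ((M - i) * K)) (real M) + \<eta>)"
      using t by (simp add: pos_divide_le_eq mult.commute)
    moreover have "scaled_passage (shift_rows (i * K * t) 0 \<rho>) (real ((M - i) * K)) (real M) t
      = last_passage (\<lambda>(i', j). ?w (i' + i * K * t, j)) ((M - i) * K * t) ?l"
      unfolding scaled_passage_of_nat row_weight_shift_rows by (simp add: mult_ac)
    ultimately show ?thesis by simp
  qed
  let ?B = "boundary_passage u ?v ?w ?n ?l"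
  have B: "?B = (\<Sum>j<?l. ?v j) + (\<Sum>i<?n. level z \<rho> u ?l i)"
    by (rule boundary_passage_eq_sum_level)
  from boundary_passage_exit[where v = ?v and u = u and w = ?w and k = ?n and l = ?l, OF nn(2)] show ?thesis
  proof (elim disjE exE conjE)
    \<comment> \<open>The vertical sums cancel, leaving the top sum, of slope \<open>1 / z\<close>,
      below a bulk passage time of slope at most \<open>1 / z'\<close>. The choice of
      \<open>K\<close> contradicts this.\<close>
    assume "?B \<le> (\<Sum>j<?l. ?v j) + corner_passage ?w ?n ?l"
    then have "(\<Sum>i<?n. level z \<rho> u ?l i) \<le> corner_passage ?w ?n ?l" using B by simp
    also have "\<dots> \<le> last_passage ?w ?n ?l" by (rule corner_passage_le_last_passage[OF nn(1)])
    also have "\<dots> \<le> real t * (\<Psi> (real (M * K)) (real M) + \<eta>)" using S[of 0] M by (simp add: mult_ac)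
    finally have "real t * (real K * real M / z) \<le> real t * (\<Psi> (real (M * K)) (real M) + \<eta>) + \<eta> * real t"
      using L by (simp add: abs_le_iff)
    then have "real t * (real K * real M / z) \<le> real t * (\<Psi> (real (M * K)) (real M) + 2 * \<eta>)"
      by (simp add: algebra_simps)
    then have "real K * real M / z \<le> \<Psi> (real (M * K)) (real M) + 2 * \<eta>"
      by (rule mult_left_le_imp_le) (use t in simp)
    moreover have "\<Psi> (real (M * K)) (real M) \<le> real (M * K) / z' + real M * ?g'"
      using K M by (intro B'.limit_le) auto
    moreover have "2 * \<eta> \<le> real M * 2" using \<eta> M by (simp add: M_def)
    ultimately have "real K * real M / z \<le> real (M * K) / z' + real M * ?g' + real M * 2" by linarith
    then have "real M * (real K / z) \<le> real M * (real K / z' + ?g' + 2)"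
      by (simp add: distrib_left mult.commute)
    then have "real K / z \<le> real K / z' + ?g' + 2"
      by (rule mult_left_le_imp_le) (use M in simp)
    with K0 have False by (simp add: algebra_simps)
    then show ?thesis ..
  next
    fix a assume a: "a < ?n" and le: "?B \<le> (\<Sum>i<Suc a. u i) + corner_passage (\<lambda>(i, j). ?w (i + a, j)) (?n - a) ?l"
    \<comment> \<open>The exit lies in block \<open>i\<close>. The input sum is enlarged to the end
      of that block and the bulk passage is started at its beginning; both changes go
      upwards.\<close>
    define i where "i = a div (K * t)"
    define b where "b = a mod (K * t)"
    have ab: "a = i * K * t + b" "b < K * t"
      using div_mult_mod_eq[of a "K * t"] K t by (simp_all add: i_def b_def mult.assoc del: div_mult_mod_eq)
    have i: "i < M"
    proof (rule ccontr)
      assume "\<not> i < M"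
      then have "M * (K * t) \<le> i * (K * t)" by (intro mult_right_mono) auto
      moreover have "K * M * t = M * (K * t)" "i * K * t = i * (K * t)" by (simp_all only: mult_ac)
      ultimately show False using a ab(1) by linarith
    qed
    have "(\<Sum>i<Suc a. u i) \<le> (\<Sum>i<Suc i * K * t. u i)"
    proof (rule sum_mono2)
      have "Suc i * K * t = K * t + i * K * t" by (simp add: add_mult_distrib)
      with ab have "Suc a \<le> Suc i * K * t" by linarith
      then show "{..<Suc a} \<subseteq> {..<Suc i * K * t}" by auto
    qed (use nn(3) in auto)
    also have "\<dots> \<le> real t * (real (Suc i) * real K / z) + \<eta> * real t" using i by (intro U) auto
    finally have S1: "(\<Sum>i<Suc a. u i) \<le> real t * (real (Suc i) * real K / z) + \<eta> * real t" .
    let ?wi = "\<lambda>(i', j). ?w (i' + i * K * t, j)"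
    have nb: "?n - a + b = (M - i) * K * t"
    proof -
      have "K * M * t = i * K * t + (M - i) * K * t" 
      proof -
        obtain d where "M = i + d" using i less_imp_add_positive by blast
        then show ?thesis by (simp add: algebra_simps)
      qed
      with a ab(1) show ?thesis by simp
    qed
    have "corner_passage (\<lambda>(i, j). ?w (i + a, j)) (?n - a) ?l = corner_passage (\<lambda>(i', j). ?wi (i' + b, j)) (?n - a) ?l"
      by (simp add: ab(1) add_ac)
    also have "\<dots> \<le> corner_passage ?wi (?n - a + b) ?l"
      by (rule corner_passage_mono_shift) (auto simp: nn(1))
    also have "\<dots> \<le> last_passage ?wi ((M - i) * K * t) ?l"
      unfolding nb by (rule corner_passage_le_last_passage) (auto simp: nn(1))
    also have "\<dots> \<le> real t * (\<Psi> (real ((M - i) * K)) (real M) + \<eta>)" by (rule S[OF i])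
    finally have S2: "corner_passage (\<lambda>(i, j). ?w (i + a, j)) (?n - a) ?l \<le> real t * (\<Psi> (real ((M - i) * K)) (real M) + \<eta>)" .
    have "real t * (real M * ?g) + real t * (real K * real M / z) - 2 * \<eta> * real t \<le> ?B"
      using L V unfolding B abs_le_iff by linarith
    also have "\<dots> \<le> real t * (real (Suc i) * real K / z) + \<eta> * real t + real t * (\<Psi> (real ((M - i) * K)) (real M) + \<eta>)"
      using le S1 S2 by linarith
    finally have "real t * (real M * ?g + real K * real M / z) \<le> real t * (real (Suc i) * real K / z + \<Psi> (real ((M - i) * K)) (real M) + 4 * \<eta>)"
      by (simp add: algebra_simps)
    then have main: "real M * ?g + real K * real M / z \<le> real (Suc i) * real K / z + \<Psi> (real ((M - i) * K)) (real M) + 4 * \<eta>"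
      by (rule mult_left_le_imp_le) (use t in simp)
    \<comment> \<open>The width remaining to the right of the block start, per unit of height. By
      homogeneity it is the required witness.\<close>
    define x where "x = real ((M - i) * K) / real M"
    have x: "0 < x" using i K M by (simp add: x_def)
    have Mx: "real M * x = real ((M - i) * K)" using M by (simp add: x_def)
    have "\<Psi> (real M * x) (real M * 1) = real M * \<Psi> x 1"
      using M x by (intro limit_homogeneous) auto
    then have hom: "\<Psi> (real ((M - i) * K)) (real M) = real M * \<Psi> x 1" by (simp only: Mx mult_1_right)
    have "real M * x = (real M - real i) * real K" using i by (simp add: Mx of_nat_diff)
    then have xz: "real M * (x / z) = real M * real K / z - real i * real K / z"
      by (simp add: left_diff_distrib diff_divide_distrib)
    have "real (Suc i) * real K / z = real i * real K / z + real K / z"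
      by (simp add: distrib_right add_divide_distrib)
    with main hom xz have "real M * ?g \<le> real M * \<Psi> x 1 - real M * (x / z) + real K / z + 4 * \<eta>"
      by (simp add: mult.commute)
    moreover have "real K / z \<le> real M * (\<epsilon> / 2)"
      using mult_left_mono[OF M(2), of "real M"] M(1) by simp
    moreover have "4 * \<eta> \<le> real M * (\<epsilon> / 2)"
    proof -
      have "\<epsilon> / 2 \<le> real M * (\<epsilon> / 2)" using \<epsilon> M by (simp add: M_def)
      with \<eta> show ?thesis by linarith
    qed
    ultimately have "real M * ?g \<le> real M * \<Psi> x 1 - real M * (x / z) + (real M * (\<epsilon> / 2) + real M * (\<epsilon> / 2))"
      by linarith
    then have "real M * ?g \<le> real M * (\<Psi> x 1 - x / z + \<epsilon>)"
      by (simp only: right_diff_distrib distrib_left[symmetric] distrib_left field_sum_of_halves)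
    then have "?g \<le> \<Psi> x 1 - x / z + \<epsilon>" by (rule mult_left_le_imp_le) (use M in simp)
    with x show ?thesis by blast
  qed
qed

end

context row_limit begin

lemma variational_upper:
  assumes "0 < \<alpha>" "0 < z" "z < c"
  shows "\<Psi> 1 \<alpha> \<le> 1 / z + \<alpha> * mean_inverse z"
proof -
  interpret row_limit_boundary m c \<Psi> z using assms by unfold_locales
  show ?thesis using limit_le[of 1 \<alpha>] assms by simp
qed

text \<open>The point \<open>z\<close> is the inverse of the slope of a supporting line of \<open>x \<mapsto> \<Psi> x 1\<close> at \<open>1 / \<alpha>\<close>, or close to
  \<open>c\<close> when that slope is \<open>1 / c\<close>.\<close>

lemma variational_lower:
  assumes \<alpha>: "0 < \<alpha>" and \<delta>: "0 < \<delta>"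
  shows "\<exists>z\<in>{0<..<c}. 1 / z + \<alpha> * mean_inverse z - \<delta> \<le> \<Psi> 1 \<alpha>"
proof -
  define x0 where "x0 = 1 / \<alpha>"
  have x0: "0 < x0" using \<alpha> by (simp add: x0_def)
  have "convex_on {0<..} (\<lambda>x. - \<Psi> x 1)" using limit_concave by (simp add: concave_on_def)
  from convex_le_Inf_differential[OF this, of x0] x0
  obtain s' where "\<And>x. 0 < x \<Longrightarrow> - \<Psi> x 1 \<ge> - \<Psi> x0 1 + s' * (x - x0)"
    by (auto simp: interior_open)
  then obtain s where s: "\<And>x. 0 < x \<Longrightarrow> \<Psi> x 1 \<le> \<Psi> x0 1 + s * (x - x0)"
    by (metis (no_types, opaque_lifting) add_uminus_conv_diff le_diff_eq minus_add_distrib minus_le_iff minus_minus mult_minus_left neg_le_iff_le)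
  \<comment> \<open>Otherwise the supporting line would fall below \<open>x / c\<close> for large
    \<open>x\<close>, against \<open>limit_ge_row\<close>.\<close>
  have sc: "1 / c \<le> s"
  proof (rule ccontr)
    assume "\<not> 1 / c \<le> s"
    then have gap: "0 < 1 / c - s" by simp
    then obtain N :: nat where N: "\<Psi> x0 1 - s * x0 < real N * (1 / c - s)"
      using reals_Archimedean3 by blast
    define x where "x = real (Suc N)"
    have x: "0 < x" by (simp add: x_def)
    have "real N * (1 / c - s) \<le> x * (1 / c - s)" using gap by (intro mult_right_mono) (auto simp: x_def)
    then have "\<Psi> x0 1 - s * x0 < x * (1 / c - s)" using N by linarith
    moreover have "x / c \<le> \<Psi> x0 1 + s * (x - x0)" using limit_ge_row[OF x] s[OF x] by linarith
    ultimately show False by (simp add: algebra_simps)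
  qed
  have s0: "0 < s" using sc c_pos by (meson divide_pos_pos less_le_trans zero_less_one)
  \<comment> \<open>The supporting line bounds \<open>\<Psi> x 1 - s * x\<close> by its value at
    \<open>x0\<close>. For \<open>s \<le> 1 / z\<close> the same bound holds for
    \<open>\<Psi> x 1 - x / z\<close>, and by the duality these differences come arbitrarily close
    to \<open>mean_inverse z\<close> or exceed it.\<close>
  have key: "s * x0 + mean_inverse z \<le> \<Psi> x0 1" if zs: "0 < z" "z < c" "s \<le> 1 / z" for z
  proof (rule field_le_epsilon)
    fix e :: real assume e: "0 < e"
    interpret row_limit_boundary m c \<Psi> z using zs by unfold_locales
    obtain x where x: "0 < x" "mean_inverse z \<le> \<Psi> x 1 - x / z + e"
      using mean_inverse_le_limit[OF e] by blast
    have "x * s \<le> x * (1 / z)" using x(1) zs by (intro mult_left_mono) auto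
    with x s[OF x(1)] show "s * x0 + mean_inverse z \<le> \<Psi> x0 1 + e" by (simp add: algebra_simps)
  qed
  have hom: "\<Psi> 1 \<alpha> = \<alpha> * \<Psi> x0 1"
    using limit_homogeneous[of \<alpha> x0 1] \<alpha> x0 by (simp add: x0_def)
  have scale: "s + \<alpha> * mean_inverse z \<le> \<Psi> 1 \<alpha>" if z: "0 < z" "z < c" "s \<le> 1 / z" for z
  proof -
    have "\<alpha> * (s * x0 + mean_inverse z) \<le> \<alpha> * \<Psi> x0 1" using key[OF z] \<alpha> by (intro mult_left_mono) auto
    then show ?thesis using \<alpha> by (simp add: hom x0_def distrib_left)
  qed
  show ?thesis
  proof (cases "s = 1 / c")
    case False
    with sc have "1 / c < s" by simp
    then have "1 / s < c" using c_pos s0 by (simp add: field_simps)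
    with scale[of "1 / s"] s0 \<delta> show ?thesis by (intro bexI[of _ "1 / s"]) auto
  next
    case True
    have "((\<lambda>z. 1 / z) \<longlongrightarrow> 1 / c) (at_left c)" using c_pos by (intro tendsto_intros) auto
    then have "eventually (\<lambda>z. 1 / z < 1 / c + \<delta>) (at_left c)" using \<delta> by (intro order_tendstoD) auto
    moreover have "eventually (\<lambda>z. z \<in> {0<..<c}) (at_left c)" using c_pos by (rule eventually_at_left_real)
    ultimately have "eventually (\<lambda>z. 1 / z < 1 / c + \<delta> \<and> z \<in> {0<..<c}) (at_left c)" by eventually_elim simp
    then obtain z where z: "1 / z < 1 / c + \<delta>" "0 < z" "z < c"
      using eventually_happens[of _ "at_left c"] trivial_limit_at_left_real by fastforce
    have "s \<le> 1 / z" using z True by (simp add: frac_le)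
    from scale[OF z(2,3) this] z True show ?thesis by (intro bexI[of _ z]) auto
  qed
qed

end

section \<open>Beta integrals and binomial series\<close>

lemma nn_integral_indicator_has_integral:
  fixes f :: "real \<Rightarrow> real"
  assumes "\<And>x. x \<in> S \<Longrightarrow> 0 \<le> f x" "(f has_integral I) S"
  shows "(\<integral>\<^sup>+x. indicator S x * ennreal (f x) \<partial>lborel) = ennreal I"
proof -
  have "ennreal (indicator S x * f x) = indicator S x * ennreal (f x)" for x
    by (simp add: indicator_def)
  with nn_integral_has_integral_lebesgue[OF assms] show ?thesis by simp
qed

lemma alternating_gbinomial_Suc:
  fixes a :: real
  shows "(-1) ^ Suc k * (a gchoose Suc k) = (-1) ^ k * (a gchoose k) * ((real k - a) / real (Suc k))"
proof -
  have "(a gchoose Suc k) = (a gchoose k) * ((a - real k) / real (Suc k))"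
    by (simp add: gbinomial_prod_rev)
  also have "(a - real k) / real (Suc k) = - ((real k - a) / real (Suc k))"
    by (simp only: minus_divide_left minus_diff_eq)
  finally show ?thesis by simp
qed

text \<open>The first of these coefficients is \<open>- a\<close>, and the ratio of consecutive ones
  is \<open>(k - a) / (k + 1)\<close>, nonnegative from \<open>k = 1\<close> on because
  \<open>a < 1\<close>. The constant sign justifies integrating the series term by term.\<close>

lemma alternating_gbinomial_nonpos:
  fixes a :: real
  assumes "0 \<le> a" "a < 1"
  shows "(-1) ^ Suc k * (a gchoose Suc k) \<le> 0"
proof (induction k)
  case 0
  then show ?case using assms by simp
next
  case (Suc k)
  have "0 \<le> (real (Suc k) - a) / real (Suc (Suc k))" using assms by simp
  with Suc show ?case unfolding alternating_gbinomial_Suc[of "Suc k"] by (rule mult_nonpos_nonneg)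
qed

text \<open>Integrate the binomial series of \<open>1 - (1 - t) powr a\<close>, all of whose coefficients are nonnegative,
  against \<open>t powr (b - 1)\<close>.\<close>

lemma gbinomial_Beta_sums:
  fixes a b :: real
  assumes a: "0 \<le> a" "a < 1" and b: "0 < b"
  shows "(\<lambda>k. (a gchoose k) * ((-1) ^ k / (real k + b))) sums Beta b (a + 1)"
proof -
  \<comment> \<open>The constant term 1 has the opposite sign and is split off; it contributes
    \<open>1 / b\<close> to the integral. Hence index \<open>k\<close> belongs to the power
    \<open>Suc k\<close>.\<close>
  define d where "d k = - ((-1) ^ Suc k * (a gchoose Suc k))" for k
  have d: "0 \<le> d k" for k using alternating_gbinomial_nonpos[OF a, of k] by (simp add: d_def)
  define f where "f = (\<lambda>k t. d k * t powr (real k + b))"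
  have f: "(f k has_integral d k / (real (Suc k) + b)) {0..1}" for k
    using has_integral_mult_right[OF has_integral_powr_from_0[of "real k + b" 1], of "d k"] b
    by (simp add: f_def add_ac)
  have powb: "((\<lambda>t. t powr (b - 1)) has_integral 1 / b) {0..1}"
    using has_integral_powr_from_0[of "b - 1" 1] b by simp
  have rest: "((\<lambda>t. t powr (b - 1) - t powr (b - 1) * (1 - t) powr a) has_integral 1 / b - Beta b (a + 1)) {0..1}"
    using has_integral_diff[OF powb has_integral_Beta_real[of b "a + 1"]] a b by simp
  have le: "t powr (b - 1) * (1 - t) powr a \<le> t powr (b - 1)" if "t \<in> {0..1}" for t
    using that a by (intro mult_left_le) (auto intro: powr_le1)
  have Ig: "(\<integral>\<^sup>+t. indicator {0..1} t * ennreal (t powr (b - 1) - t powr (b - 1) * (1 - t) powr a) \<partial>lborel)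
    = ennreal (1 / b - Beta b (a + 1))"
    by (rule nn_integral_indicator_has_integral[OF _ rest]) (use le in auto)
  have If: "(\<integral>\<^sup>+t. indicator {0..1} t * ennreal (f k t) \<partial>lborel) = ennreal (d k / (real (Suc k) + b))" for k
    by (rule nn_integral_indicator_has_integral[OF _ f]) (simp add: f_def d)
  have series: "(\<lambda>k. f k t) sums (t powr (b - 1) - t powr (b - 1) * (1 - t) powr a)" if t: "0 < t" "t < 1" for t
  proof -
    have "(\<lambda>k. (a gchoose k) * (- t) ^ k) sums (1 - t) powr a"
      using gen_binomial_real[of "- t" a] t by simp
    then have "(\<lambda>k. (a gchoose Suc k) * (- t) ^ Suc k) sums ((1 - t) powr a - 1)"
      by (subst sums_Suc_iff) simp
    then have "(\<lambda>k. - (t powr (b - 1)) * ((a gchoose Suc k) * (- t) ^ Suc k)) sums (- (t powr (b - 1)) * ((1 - t) powr a - 1))"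
      by (rule sums_mult)
    moreover have "- (t powr (b - 1)) * ((a gchoose Suc k) * (- t) ^ Suc k) = f k t" for k
    proof -
      have "t powr (real k + b) = t powr (b - 1) * t ^ Suc k"
        using t by (simp add: powr_realpow[symmetric] powr_add[symmetric] add.commute del: power_Suc)
      moreover have "(- t) ^ Suc k = (-1) ^ Suc k * t ^ Suc k" by (rule power_minus)
      ultimately show ?thesis by (simp only: f_def d_def) (simp add: mult_ac)
    qed
    ultimately show ?thesis by (simp add: algebra_simps)
  qed
  have "(\<Sum>k. ennreal (d k / (real (Suc k) + b))) = (\<integral>\<^sup>+t. (\<Sum>k. indicator {0..1} t * ennreal (f k t)) \<partial>lborel)"
    unfolding If[symmetric] by (rule nn_integral_suminf[symmetric]) (simp add: f_def)
  also have "\<dots> = (\<integral>\<^sup>+t. indicator {0..1} t * ennreal (t powr (b - 1) - t powr (b - 1) * (1 - t) powr a) \<partial>lborel)"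
  proof (rule nn_integral_cong_AE)
    show "AE t in lborel. (\<Sum>k. indicator {0..1} t * ennreal (f k t))
       = indicator {0..1} t * ennreal (t powr (b - 1) - t powr (b - 1) * (1 - t) powr a)"
      using AE_lborel_singleton[of 0] AE_lborel_singleton[of 1]
    proof eventually_elim
      case (elim t)
      show ?case
      proof (cases "0 < t \<and> t < 1")
        case True
        then have "(\<Sum>k. ennreal (f k t)) = ennreal (t powr (b - 1) - t powr (b - 1) * (1 - t) powr a)"
          using series[of t] by (intro suminf_ennreal_eq) (auto simp: f_def d)
        with True show ?thesis by (simp add: indicator_def)
      next
        case False
        with elim have "t \<notin> {0..1}" by auto
        then have "indicator {0..1} t = (0 :: ennreal)" by (rule indicator_simps(2))
        then show ?thesis by simp
      qed
    qed
  qed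
  also have "\<dots> = ennreal (1 / b - Beta b (a + 1))" by (rule Ig)
  finally have sum_eq: "(\<Sum>k. ennreal (d k / (real (Suc k) + b))) = ennreal (1 / b - Beta b (a + 1))" .
  have "0 \<le> 1 / b - Beta b (a + 1)"
    by (rule has_integral_nonneg[OF rest]) (use le in auto)
  moreover have "(\<lambda>k. ennreal (d k / (real (Suc k) + b))) sums ennreal (1 / b - Beta b (a + 1))"
    unfolding sum_eq[symmetric] by (rule summable_sums[OF summableI])
  moreover have "0 \<le> d k / (real (Suc k) + b)" for k using d[of k] b by simp
  ultimately have "(\<lambda>k. d k / (real (Suc k) + b)) sums (1 / b - Beta b (a + 1))"
    using sums_ennreal[of "\<lambda>k. d k / (real (Suc k) + b)"] by blast
  from sums_minus[OF this] have "(\<lambda>k. - (d k / (real (Suc k) + b))) sums (Beta b (a + 1) - 1 / b)" by simp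
  then have "(\<lambda>k. (a gchoose Suc k) * ((-1) ^ Suc k / (real (Suc k) + b))) sums (Beta b (a + 1) - 1 / b)"
    by (simp add: d_def mult_ac)
  then show ?thesis by (subst (asm) sums_Suc_iff) simp
qed

text \<open>The relation between the two constants is
  \<open>(x + y) * Beta (x + 1) y = x * Beta x y\<close> at \<open>x = - \<nu>\<close> and
  \<open>y = \<nu> + 2\<close>. Their sum 2 is the origin of the factor 2 in
  \<open>B0_const\<close>.\<close>

lemma A_const_Beta:
  assumes \<nu>: "-1 \<le> \<nu>" "\<nu> < 0"
  shows "A1_const \<nu> = Beta (1 - \<nu>) (\<nu> + 2)" "A2_const \<nu> = Beta (- \<nu>) (\<nu> + 2)"
    and "2 * A1_const \<nu> = - \<nu> * A2_const \<nu>" and "0 < A2_const \<nu>"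
proof -
  show A1: "A1_const \<nu> = Beta (1 - \<nu>) (\<nu> + 2)"
    using gbinomial_Beta_sums[of "\<nu> + 1" "1 - \<nu>"] \<nu> unfolding A1_const_def
    by (simp add: sums_iff algebra_simps)
  show A2: "A2_const \<nu> = Beta (- \<nu>) (\<nu> + 2)"
    using gbinomial_Beta_sums[of "\<nu> + 1" "- \<nu>"] \<nu> unfolding A2_const_def
    by (simp add: sums_iff algebra_simps)
  have "- \<nu> \<notin> \<int>\<^sub>\<le>\<^sub>0" using \<nu> by (auto elim!: nonpos_Ints_cases)
  from Beta_plus1_left[OF this, of "\<nu> + 2"] show "2 * A1_const \<nu> = - \<nu> * A2_const \<nu>"
    unfolding A1 A2 by (simp add: add.commute)
  show "0 < A2_const \<nu>" unfolding A2 using \<nu> by (simp add: Beta_def Gamma_real_pos)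
qed

text \<open>The tangent at \<open>y = 1\<close> of a convex power; for negative exponents it follows
  from \<open>ln y \<le> y - 1\<close> and \<open>1 + x \<le> exp x\<close>.\<close>

lemma powr_tangent_le:
  fixes y \<nu> :: real
  assumes "\<nu> < 0" "0 < y"
  shows "1 + \<nu> * (y - 1) \<le> y powr \<nu>"
proof -
  have "\<nu> * (y - 1) \<le> \<nu> * ln y" using assms ln_le_minus_one[of y] by (intro mult_left_mono_neg) auto
  also have "1 + \<nu> * ln y \<le> exp (\<nu> * ln y)" by (rule exp_ge_add_one_self)
  finally show ?thesis using assms by (simp add: powr_def)
qed

text \<open>The point \<open>t0\<close> is the critical point of the convex function \<open>t / c\<^sup>2 + D * t powr \<nu>\<close>.\<close>

lemma linear_plus_powr_min:
  fixes c D \<nu> t t0 :: real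
  assumes "0 < c" "0 < D" "\<nu> < 0" "0 < t" and t0: "t0 = (- \<nu> * c\<^sup>2 * D) powr (1 / (1 - \<nu>))"
  shows "t0 / c\<^sup>2 + D * t0 powr \<nu> \<le> t / c\<^sup>2 + D * t powr \<nu>"
proof -
  have pos: "0 < - \<nu> * c\<^sup>2 * D" using assms(1-3) by (intro mult_pos_pos) auto
  then have "- \<nu> * c\<^sup>2 * D \<noteq> 0" by linarith
  then have t0_pos: "0 < t0" unfolding t0 by (simp only: powr_gt_zero not_False_eq_True)
  have "1 / (1 - \<nu>) * (1 - \<nu>) = 1" using assms(3) by simp
  then have "t0 powr (1 - \<nu>) = - \<nu> * c\<^sup>2 * D" unfolding t0 powr_powr
    using powr_one[OF less_imp_le[OF pos]] by (simp only:)
  then have "t0 / t0 powr \<nu> = - \<nu> * c\<^sup>2 * D" using t0_pos by (simp add: powr_diff)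
  then have crit: "t0 = - \<nu> * c\<^sup>2 * D * t0 powr \<nu>" using t0_pos by (simp add: field_simps)
  then have t0c: "t0 / c\<^sup>2 = - \<nu> * D * t0 powr \<nu>" using assms(1) by (simp add: field_simps)
  have "t / c\<^sup>2 = t0 / c\<^sup>2 * (t / t0)" using t0_pos by simp
  then have lin: "t / c\<^sup>2 = - \<nu> * D * t0 powr \<nu> * (t / t0)" unfolding t0c .
  have "D * t0 powr \<nu> * (1 + \<nu> * (t / t0 - 1)) \<le> D * t0 powr \<nu> * (t / t0) powr \<nu>"
    using assms t0_pos by (intro mult_left_mono powr_tangent_le) auto
  also have "D * t0 powr \<nu> * (t / t0) powr \<nu> = D * t powr \<nu>"
    using assms t0_pos by (simp add: powr_divide)
  finally show ?thesis unfolding lin t0c by (simp add: algebra_simps)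
qed

section \<open>Behaviour of the mean of the inverse rate gap\<close>

context rate_law begin

lemma mean_inverse_mono:
  assumes "z \<le> z'" "z' < c"
  shows "mean_inverse z \<le> mean_inverse z'"
  unfolding mean_inverse_def
proof (rule integral_mono_AE)
  show "AE r in m. 1 / (r - z) \<le> 1 / (r - z')"
    using rate_ge by eventually_elim (use assms in \<open>auto intro!: divide_left_mono\<close>)
qed (use assms in \<open>auto intro: mean_inverse_integrable\<close>)

lemma inverse_moment_eq: "inverse_moment c m = mean_inverse c"
  unfolding inverse_moment_def mean_inverse_def set_lebesgue_integral_def
proof (rule integral_cong_AE)
  show "AE r in m. indicator {c..} r *\<^sub>R (1 / (r - c)) = 1 / (r - c)"
    using rate_ge by eventually_elim simp
qed auto

lemma mean_inverse_le_edge: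
  assumes "integrable m (\<lambda>r. 1 / (r - c))" "AE r in m. r \<noteq> c" "z < c"
  shows "mean_inverse z \<le> mean_inverse c"
  unfolding mean_inverse_def
proof (rule integral_mono_AE)
  show "AE r in m. 1 / (r - z) \<le> 1 / (r - c)"
    using rate_ge assms(2)
  proof eventually_elim
    case (elim r)
    then show ?case using assms(3) by (intro divide_left_mono) auto
  qed
qed (use assms in \<open>auto intro: mean_inverse_integrable\<close>)

text \<open>Dominated convergence along \<open>z = c - 1 / (n + 1)\<close> with majorant
  \<open>1 / (r - c)\<close>; monotonicity in \<open>z\<close> extends the estimate from one member
  of the sequence to everything between it and \<open>c\<close>.\<close>

lemma mean_inverse_near_edge:
  assumes int: "integrable m (\<lambda>r. 1 / (r - c))" and ne: "AE r in m. r \<noteq> c" and e: "0 < e"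
  obtains d where "0 < d" "\<And>z. c - d < z \<Longrightarrow> z < c \<Longrightarrow> mean_inverse c - e \<le> mean_inverse z"
proof -
  have "(\<lambda>n. \<integral>r. 1 / (r - (c - 1 / real (Suc n))) \<partial>m) \<longlonglongrightarrow> (\<integral>r. 1 / (r - c) \<partial>m)"
  proof (rule integral_dominated_convergence[where w = "\<lambda>r. 1 / (r - c)"])
    show "AE r in m. (\<lambda>n. 1 / (r - (c - 1 / real (Suc n)))) \<longlonglongrightarrow> 1 / (r - c)"
      using ne
    proof eventually_elim
      case (elim r)
      have "(\<lambda>n. 1 / (r - (c - 1 / real (Suc n)))) \<longlonglongrightarrow> 1 / (r - (c - 0))"
        using elim LIMSEQ_Suc[OF lim_1_over_n] by (intro tendsto_intros) auto
      then show ?case by simp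
    qed
    show "AE r in m. norm (1 / (r - (c - 1 / real (Suc n)))) \<le> 1 / (r - c)" for n
      using rate_ge ne
    proof eventually_elim
      case (elim r)
      have "0 < r - c" using elim by simp
      moreover have "0 < 1 / real (Suc n)" by simp
      ultimately have "1 / (r - c + 1 / real (Suc n)) \<le> 1 / (r - c)"
        by (intro divide_left_mono mult_pos_pos add_pos_pos) auto
      moreover have "r - (c - 1 / real (Suc n)) = r - c + 1 / real (Suc n)" by simp
      moreover have "0 < r - c + 1 / real (Suc n)"
        using \<open>0 < r - c\<close> \<open>0 < 1 / real (Suc n)\<close> by (rule add_pos_pos)
      ultimately show ?case by (simp only: real_norm_def abs_of_pos zero_less_divide_1_iff)
    qed
  qed (use int in auto)
  then have "(\<lambda>n. mean_inverse (c - 1 / real (Suc n))) \<longlonglongrightarrow> mean_inverse c"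
    unfolding mean_inverse_def .
  from order_tendstoD(1)[OF this, of "mean_inverse c - e"] e
  obtain n where n: "mean_inverse c - e < mean_inverse (c - 1 / real (Suc n))"
    by (auto simp: eventually_sequentially)
  show ?thesis
  proof (rule that)
    fix z assume "c - 1 / real (Suc n) < z" "z < c"
    then have "mean_inverse (c - 1 / real (Suc n)) \<le> mean_inverse z" by (intro mean_inverse_mono) auto
    with n show "mean_inverse c - e \<le> mean_inverse z" by simp
  qed simp
qed

text \<open>An atom at \<open>c\<close> would make the extended integral infinite, so the extended
  and the real integrand agree almost everywhere. The first moment is then controlled by
  \<open>2 * \<bar>t\<bar> \<le> 1 + t^2\<close> with \<open>t = 1 / (r - c)\<close>.\<close>

lemma inverse_square_moment_finite:
  assumes "inverse_square_moment c m < \<infinity>"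
  shows "AE r in m. r \<noteq> c" "integrable m (\<lambda>r. 1 / (r - c)\<^sup>2)" "integrable m (\<lambda>r. 1 / (r - c))"
proof -
  have eq: "inverse_square_moment c m = (\<integral>\<^sup>+r. 1 / ennreal ((r - c)\<^sup>2) \<partial>m)"
    unfolding inverse_square_moment_def
    by (rule nn_integral_cong_AE, use rate_ge in eventually_elim) simp
  with assms have fin: "(\<integral>\<^sup>+r. 1 / ennreal ((r - c)\<^sup>2) \<partial>m) \<noteq> \<infinity>" by simp
  have "AE r in m. 1 / ennreal ((r - c)\<^sup>2) \<noteq> \<infinity>"
    by (rule nn_integral_PInf_AE[OF _ fin]) measurable
  then show ne: "AE r in m. r \<noteq> c" by eventually_elim auto
  have "(\<integral>\<^sup>+r. ennreal (1 / (r - c)\<^sup>2) \<partial>m) = (\<integral>\<^sup>+r. 1 / ennreal ((r - c)\<^sup>2) \<partial>m)"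
  proof (rule nn_integral_cong_AE, use ne in eventually_elim)
    case (elim r)
    then show ?case by (simp add: divide_ennreal[of 1, simplified])
  qed
  then show sq: "integrable m (\<lambda>r. 1 / (r - c)\<^sup>2)"
    using fin by (intro integrableI_nonneg) (auto simp: top.not_eq_extremum)
  have "integrable m (\<lambda>r. 1 + 1 / (r - c)\<^sup>2)" using sq by simp
  then show "integrable m (\<lambda>r. 1 / (r - c))"
  proof (rule Bochner_Integration.integrable_bound)
    show "AE r in m. norm (1 / (r - c)) \<le> norm (1 + 1 / (r - c)\<^sup>2)"
    proof (rule AE_I2)
      fix r
      have "0 \<le> (\<bar>1 / (r - c)\<bar> - 1)\<^sup>2" by simp
      then have "2 * \<bar>1 / (r - c)\<bar> \<le> 1 + 1 / (r - c)\<^sup>2"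
        by (simp add: power2_diff power_divide)
      then have "\<bar>1 / (r - c)\<bar> \<le> 1 + 1 / (r - c)\<^sup>2" by linarith
      then show "norm (1 / (r - c)) \<le> norm (1 + 1 / (r - c)\<^sup>2)" by simp
    qed
  qed simp
qed

section \<open>The rate distribution near its lower bound\<close>

definition lower_tail :: "real \<Rightarrow> real" where
  "lower_tail s = measure m {c..<c + s}"

lemma lower_tail_bounds: "0 \<le> lower_tail s" "lower_tail s \<le> 1"
  by (simp_all add: lower_tail_def)

lemma lower_tail_mono: "s \<le> s' \<Longrightarrow> lower_tail s \<le> lower_tail s'"
  unfolding lower_tail_def by (rule finite_measure_mono) auto

lemma lower_tail_measurable [measurable]: "lower_tail \<in> borel_measurable borel"
  by (rule borel_measurable_mono) (simp add: mono_def lower_tail_mono)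

lemma nn_integral_inverse:
  assumes "z < c"
  shows "(\<integral>\<^sup>+r. ennreal (1 / (r - z)) \<partial>m) = ennreal (mean_inverse z)"
  unfolding mean_inverse_def
  by (rule nn_integral_eq_integral[OF mean_inverse_integrable[OF assms]],
      use AE_inverse_bounds[OF assms] in eventually_elim) simp

text \<open>Layer cake: \<open>1 / (t + u)\<close> is \<open>1 / u\<close> times the length of the set of all \<open>\<tau>\<close> in the unit interval
  with \<open>t < u * (1 - \<tau>) / \<tau>\<close>.\<close>

lemma mean_inverse_layer_cake:
  assumes u: "0 < u"
  shows "(\<integral>\<^sup>+\<tau>. ennreal (indicator {0<..<1} \<tau> * lower_tail (u * (1 - \<tau>) / \<tau>)) \<partial>lborel) = ennreal (u * mean_inverse (c - u))"
    (is "?T = _")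
proof -
  let ?P = "\<lambda>\<tau> r. 0 < \<tau> \<and> \<tau> < 1 \<and> c \<le> r \<and> r < c + u * (1 - \<tau>) / \<tau>"
  let ?I = "\<lambda>r \<tau>. if ?P \<tau> r then 1 else 0 :: ennreal"
  interpret PS: pair_sigma_finite m lborel
    by (simp add: pair_sigma_finite_def sigma_finite_lborel sigma_finite_measure_axioms)
  have "ennreal (u * mean_inverse (c - u)) = ennreal u * (\<integral>\<^sup>+r. ennreal (1 / (r - (c - u))) \<partial>m)"
    using u mean_inverse_bounds[of "c - u"] by (simp add: nn_integral_inverse ennreal_mult)
  also have "\<dots> = (\<integral>\<^sup>+r. ennreal u * ennreal (1 / (r - (c - u))) \<partial>m)"
    by (rule nn_integral_cmult[symmetric]) measurable
  also have "\<dots> = (\<integral>\<^sup>+r. \<integral>\<^sup>+\<tau>. ?I r \<tau> \<partial>lborel \<partial>m)"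
  proof (rule nn_integral_cong_AE, use rate_ge in eventually_elim)
    case (elim r)
    let ?b = "u / (r - c + u)"
    have b: "0 < ?b" "?b \<le> 1" using u elim by auto
    have "?P \<tau> r \<longleftrightarrow> \<tau> \<in> {0<..<?b}" for \<tau>
    proof (cases "0 < \<tau>")
      case True
      have "r < c + u * (1 - \<tau>) / \<tau> \<longleftrightarrow> \<tau> < ?b"
        using True u elim by (simp add: field_simps)
      then show ?thesis using True b elim by auto
    qed auto
    then have "(\<integral>\<^sup>+\<tau>. ?I r \<tau> \<partial>lborel) = (\<integral>\<^sup>+\<tau>. indicator {0<..<?b} \<tau> \<partial>lborel)"
      by (intro nn_integral_cong) (simp add: indicator_def)
    also have "\<dots> = ennreal ?b" using b by (simp add: emeasure_lborel_Ioo)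
    also have "\<dots> = ennreal u * ennreal (1 / (r - (c - u)))"
      using u elim by (subst ennreal_mult[symmetric]) (auto simp: algebra_simps)
    finally show ?case by simp
  qed
  also have "\<dots> = (\<integral>\<^sup>+\<tau>. \<integral>\<^sup>+r. ?I r \<tau> \<partial>m \<partial>lborel)"
    by (rule PS.Fubini'[symmetric]) measurable
  also have "\<dots> = ?T"
  proof (rule nn_integral_cong)
    fix \<tau> :: real
    show "(\<integral>\<^sup>+r. ?I r \<tau> \<partial>m) = ennreal (indicator {0<..<1} \<tau> * lower_tail (u * (1 - \<tau>) / \<tau>))"
    proof (cases "0 < \<tau> \<and> \<tau> < 1")
      case True
      then have "(\<integral>\<^sup>+r. ?I r \<tau> \<partial>m) = (\<integral>\<^sup>+r. indicator {c..<c + u * (1 - \<tau>) / \<tau>} r \<partial>m)"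
        by (intro nn_integral_cong) (simp add: indicator_def)
      also have "\<dots> = ennreal (lower_tail (u * (1 - \<tau>) / \<tau>))"
        by (simp add: lower_tail_def emeasure_eq_measure)
      finally show ?thesis using True by simp
    next
      case False
      then have "(\<integral>\<^sup>+r. ?I r \<tau> \<partial>m) = (\<integral>\<^sup>+r. 0 \<partial>m)"
        by (intro nn_integral_cong) auto
      with False show ?thesis by (auto simp: indicator_def)
    qed
  qed
  finally show ?thesis by simp
qed

lemma mean_inverse_layer_cake_integral:
  assumes u: "0 < u"
  shows "integrable lborel (\<lambda>\<tau>. indicator {0<..<1} \<tau> * lower_tail (u * (1 - \<tau>) / \<tau>))"
    and "(\<integral>\<tau>. indicator {0<..<1} \<tau> * lower_tail (u * (1 - \<tau>) / \<tau>) \<partial>lborel) = u * mean_inverse (c - u)"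
proof -
  have nn: "0 \<le> indicator {0<..<1} \<tau> * lower_tail (u * (1 - \<tau>) / \<tau>)" for \<tau>
    by (simp add: lower_tail_bounds)
  show "integrable lborel (\<lambda>\<tau>. indicator {0<..<1} \<tau> * lower_tail (u * (1 - \<tau>) / \<tau>))"
    by (rule integrableI_nonneg) (use nn mean_inverse_layer_cake[OF u] in \<open>auto\<close>)
  have "0 \<le> u * mean_inverse (c - u)" using u mean_inverse_bounds[of "c - u"] by simp
  then show "(\<integral>\<tau>. indicator {0<..<1} \<tau> * lower_tail (u * (1 - \<tau>) / \<tau>) \<partial>lborel) = u * mean_inverse (c - u)"
    by (subst integral_eq_nn_integral) (use nn in \<open>auto simp: mean_inverse_layer_cake[OF u]\<close>)
qed

end

section \<open>Consequences of a power tail at the edge\<close>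

locale rate_tail = rate_law m c for m c +
  fixes \<nu> \<kappa> :: real
  assumes \<kappa>: "0 < \<kappa>" and \<nu>: "-1 \<le> \<nu>"
    and tail: "((\<lambda>t. measure m {c..<t} / (t - c) powr (\<nu> + 1)) \<longlongrightarrow> \<kappa>) (at_right c)"
begin

lemma lower_tail_limit: "((\<lambda>s. lower_tail s / s powr (\<nu> + 1)) \<longlongrightarrow> \<kappa>) (at_right 0)"
  using tail unfolding filterlim_at_right_to_0[of _ _ c] lower_tail_def by (simp add: add.commute)

lemma lower_tail_near:
  assumes "0 < e"
  obtains d where "0 < d" "\<And>s. 0 < s \<Longrightarrow> s \<le> d \<Longrightarrow>
    (\<kappa> - e) * s powr (\<nu> + 1) \<le> lower_tail s \<and> lower_tail s \<le> (\<kappa> + e) * s powr (\<nu> + 1)"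
proof -
  have "eventually (\<lambda>s. dist (lower_tail s / s powr (\<nu> + 1)) \<kappa> < e) (at_right 0)"
    using tendstoD[OF lower_tail_limit assms] .
  then obtain b where b: "0 < b" "\<And>s. 0 < s \<Longrightarrow> s < b \<Longrightarrow> dist (lower_tail s / s powr (\<nu> + 1)) \<kappa> < e"
    unfolding eventually_at_right_field by auto
  show ?thesis
  proof (rule that[of "b / 2"])
    fix s assume s: "0 < s" "s \<le> b / 2"
    then have "dist (lower_tail s / s powr (\<nu> + 1)) \<kappa> < e" using b by simp
    then have "\<kappa> - e \<le> lower_tail s / s powr (\<nu> + 1)" "lower_tail s / s powr (\<nu> + 1) \<le> \<kappa> + e"
      by (auto simp: dist_real_def abs_less_iff)
    with s show "(\<kappa> - e) * s powr (\<nu> + 1) \<le> lower_tail s \<and> lower_tail s \<le> (\<kappa> + e) * s powr (\<nu> + 1)"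
      by (simp add: pos_le_divide_eq pos_divide_le_eq)
  qed (use b in simp)
qed

text \<open>Near zero the limit gives the bound; beyond \<open>d\<close> a probability is at most
  \<open>1 \<le> (s / d) powr (\<nu> + 1)\<close>. A bound valid for all \<open>s\<close> is needed
  as a majorant in the layer cake integral.\<close>

lemma lower_tail_le_powr:
  obtains C where "0 < C" "\<And>s. 0 < s \<Longrightarrow> lower_tail s \<le> C * s powr (\<nu> + 1)"
proof -
  obtain d where d: "0 < d" "\<And>s. 0 < s \<Longrightarrow> s \<le> d \<Longrightarrow> lower_tail s \<le> (\<kappa> + 1) * s powr (\<nu> + 1)"
    by (rule lower_tail_near[of 1]) auto
  define C where "C = max (\<kappa> + 1) (1 / d powr (\<nu> + 1))"
  show ?thesis
  proof (rule that[of C])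
    show "0 < C" using \<kappa> by (simp add: C_def)
    fix s :: real assume s: "0 < s"
    show "lower_tail s \<le> C * s powr (\<nu> + 1)"
    proof (cases "s \<le> d")
      case True
      have "lower_tail s \<le> (\<kappa> + 1) * s powr (\<nu> + 1)" using d(2)[OF s True] .
      also have "\<dots> \<le> C * s powr (\<nu> + 1)" by (intro mult_right_mono) (auto simp: C_def)
      finally show ?thesis .
    next
      case False
      have "lower_tail s \<le> 1" by (rule lower_tail_bounds)
      also have "1 = 1 / d powr (\<nu> + 1) * d powr (\<nu> + 1)" using d by simp
      also have "\<dots> \<le> C * s powr (\<nu> + 1)"
        using False d(1) \<nu> by (intro mult_mono powr_mono2) (auto simp: C_def le_max_iff_disj)
      finally show ?thesis .
    qed
  qed
qed

text \<open>Inserting the tail \<open>\<kappa> * s powr (\<nu> + 1)\<close> into the layer cake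
  formula leaves \<open>\<kappa>\<close> times the integral of
  \<open>((1 - \<tau>) / \<tau>) powr (\<nu> + 1)\<close> over the unit interval. This is
  \<open>Beta (- \<nu>) (\<nu> + 2)\<close>, convergent at \<open>\<tau> = 0\<close> because
  \<open>\<nu> < 0\<close>.\<close>

lemma mean_inverse_powr_limit:
  assumes \<nu>0: "\<nu> < 0"
  shows "((\<lambda>u. u powr (- \<nu>) * mean_inverse (c - u)) \<longlongrightarrow> \<kappa> * A2_const \<nu>) (at_right 0)"
proof -
  obtain C where C: "0 < C" "\<And>s. 0 < s \<Longrightarrow> lower_tail s \<le> C * s powr (\<nu> + 1)"
    using lower_tail_le_powr by blast
  define h where "h \<tau> = indicator {0<..<1} \<tau> * ((1 - \<tau>) / \<tau>) powr (\<nu> + 1)" for \<tau> :: real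
  have hm [measurable]: "h \<in> borel_measurable borel" unfolding h_def[abs_def] by measurable
  have h_nn: "0 \<le> h \<tau>" for \<tau> by (simp add: h_def)
  have h_int: "(\<integral>\<^sup>+\<tau>. ennreal (h \<tau>) \<partial>lborel) = ennreal (A2_const \<nu>)"
  proof -
    have B: "((\<lambda>\<tau>. \<tau> powr (- \<nu> - 1) * (1 - \<tau>) powr (\<nu> + 2 - 1)) has_integral Beta (- \<nu>) (\<nu> + 2)) {0..1}"
      using \<nu> \<nu>0 by (intro has_integral_Beta_real) auto
    have "(\<integral>\<^sup>+\<tau>. ennreal (h \<tau>) \<partial>lborel) = (\<integral>\<^sup>+\<tau>. indicator {0..1} \<tau> * ennreal (\<tau> powr (- \<nu> - 1) * (1 - \<tau>) powr (\<nu> + 2 - 1)) \<partial>lborel)"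
    proof (rule nn_integral_cong_AE)
      show "AE \<tau> in lborel. ennreal (h \<tau>) = indicator {0..1} \<tau> * ennreal (\<tau> powr (- \<nu> - 1) * (1 - \<tau>) powr (\<nu> + 2 - 1))"
        using AE_lborel_singleton[of 0] AE_lborel_singleton[of 1]
      proof eventually_elim
        case (elim \<tau>)
        show ?case
        proof (cases "0 < \<tau> \<and> \<tau> < 1")
          case True
          have "- \<nu> - 1 = - (\<nu> + 1)" by simp
          then have p: "\<tau> powr (- \<nu> - 1) = 1 / \<tau> powr (\<nu> + 1)" by (simp only: powr_minus_divide)
          have "\<nu> + 2 - 1 = \<nu> + 1" by simp
          then show ?thesis using True by (simp add: h_def p powr_divide add.commute)
        next
          case False
          with elim have "\<tau> \<notin> {0..1}" "\<tau> \<notin> {0<..<1}" by auto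
          then show ?thesis by (simp add: h_def indicator_simps(2) del: atLeastAtMost_iff greaterThanLessThan_iff)
        qed
      qed
    qed
    also have "\<dots> = ennreal (Beta (- \<nu>) (\<nu> + 2))"
      by (rule nn_integral_indicator_has_integral[OF _ B]) auto
    finally show ?thesis using A_const_Beta(2)[OF \<nu> \<nu>0] by simp
  qed
  have h_integrable: "integrable lborel h"
    by (rule integrableI_nonneg) (use h_nn h_int in auto)
  have h_integral: "integral\<^sup>L lborel h = A2_const \<nu>"
    using A_const_Beta(4)[OF \<nu> \<nu>0] by (subst integral_eq_nn_integral) (use h_nn h_int in auto)
  \<comment> \<open>The substitution \<open>y = 1 / u\<close> turns the limit at zero into one at
    infinity, the form of the dominated convergence theorem used here.\<close>
  define S where "S y \<tau> = indicator {0<..<1} \<tau> * (y powr (\<nu> + 1) * lower_tail (inverse y * (1 - \<tau>) / \<tau>))" for y \<tau> :: real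
  have "((\<lambda>y. integral\<^sup>L lborel (S y)) \<longlongrightarrow> integral\<^sup>L lborel (\<lambda>\<tau>. \<kappa> * h \<tau>)) at_top"
  proof (rule integral_dominated_convergence_at_top[where w = "\<lambda>\<tau>. C * h \<tau>"])
    show "S y \<in> borel_measurable lborel" for y unfolding S_def[abs_def] by measurable
    show "integrable lborel (\<lambda>\<tau>. C * h \<tau>)" using h_integrable by simp
    have S_le: "norm (S y \<tau>) \<le> C * h \<tau>" if y: "0 < y" for y \<tau>
    proof (cases "0 < \<tau> \<and> \<tau> < 1")
      case True
      define s where "s = inverse y * (1 - \<tau>) / \<tau>"
      have s: "0 < s" using True y by (simp add: s_def)
      have "y powr (\<nu> + 1) * lower_tail s \<le> y powr (\<nu> + 1) * (C * s powr (\<nu> + 1))"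
        using C(2)[OF s] by (intro mult_left_mono) auto
      also have "\<dots> = C * (y * s) powr (\<nu> + 1)" using y s by (simp add: powr_mult)
      also have "y * s = (1 - \<tau>) / \<tau>" using y by (simp add: s_def)
      finally show ?thesis using True by (simp add: S_def h_def s_def[symmetric] lower_tail_bounds)
    qed (auto simp: S_def h_def)
    show "eventually (\<lambda>y. AE \<tau> in lborel. norm (S y \<tau>) \<le> C * h \<tau>) at_top"
      using eventually_gt_at_top[of 0] by eventually_elim (rule AE_I2, rule S_le)
    show "AE \<tau> in lborel. ((\<lambda>y. S y \<tau>) \<longlongrightarrow> \<kappa> * h \<tau>) at_top"
    proof (rule AE_I2)
      fix \<tau> :: real
      show "((\<lambda>y. S y \<tau>) \<longlongrightarrow> \<kappa> * h \<tau>) at_top"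
      proof (cases "0 < \<tau> \<and> \<tau> < 1")
        case True
        define q where "q = (1 - \<tau>) / \<tau>"
        have q: "0 < q" using True by (simp add: q_def)
        have "((\<lambda>y. inverse y * q) \<longlongrightarrow> 0 * q) at_top"
          by (intro tendsto_mult tendsto_const tendsto_inverse_0_at_top filterlim_ident)
        then have "filterlim (\<lambda>y. inverse y * q) (at_right 0) at_top"
          using q by (intro tendsto_imp_filterlim_at_right) (auto intro: eventually_mono[OF eventually_gt_at_top[of 0]])
        from filterlim_compose[OF lower_tail_limit this]
        have "((\<lambda>y. lower_tail (inverse y * q) / (inverse y * q) powr (\<nu> + 1)) \<longlongrightarrow> \<kappa>) at_top" .
        then have "((\<lambda>y. lower_tail (inverse y * q) / (inverse y * q) powr (\<nu> + 1) * q powr (\<nu> + 1)) \<longlongrightarrow> \<kappa> * q powr (\<nu> + 1)) at_top"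
          by (intro tendsto_mult tendsto_const)
        moreover have "eventually (\<lambda>y. lower_tail (inverse y * q) / (inverse y * q) powr (\<nu> + 1) * q powr (\<nu> + 1) = S y \<tau>) at_top"
          using eventually_gt_at_top[of 0]
        proof eventually_elim
          case (elim y)
          have "(inverse y * q) powr (\<nu> + 1) = q powr (\<nu> + 1) / y powr (\<nu> + 1)"
            using elim q by (simp add: powr_mult powr_divide inverse_eq_divide)
          moreover have "q powr (\<nu> + 1) \<noteq> 0" "y powr (\<nu> + 1) \<noteq> 0" using q elim by auto
          ultimately show ?case using True by (simp add: S_def q_def)
        qed
        ultimately have "((\<lambda>y. S y \<tau>) \<longlongrightarrow> \<kappa> * q powr (\<nu> + 1)) at_top"
          by (rule Lim_transform_eventually)
        then show ?thesis using True by (simp add: h_def q_def)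
      qed (auto simp: S_def h_def)
    qed
  qed measurable
  then have lim: "((\<lambda>y. integral\<^sup>L lborel (S y)) \<longlongrightarrow> \<kappa> * A2_const \<nu>) at_top"
    using h_integral by simp
  have "eventually (\<lambda>y. integral\<^sup>L lborel (S y) = inverse y powr (- \<nu>) * mean_inverse (c - inverse y)) at_top"
    using eventually_gt_at_top[of 0]
  proof eventually_elim
    case (elim y)
    then have y: "0 < inverse y" by simp
    have "S y = (\<lambda>\<tau>. y powr (\<nu> + 1) * (indicator {0<..<1} \<tau> * lower_tail (inverse y * (1 - \<tau>) / \<tau>)))"
      by (simp add: S_def fun_eq_iff mult_ac)
    then have "integral\<^sup>L lborel (S y) = y powr (\<nu> + 1) * (inverse y * mean_inverse (c - inverse y))"
      using mean_inverse_layer_cake_integral(2)[OF y] by simp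
    moreover have "y powr (\<nu> + 1) * inverse y = inverse y powr (- \<nu>)"
      using elim by (simp add: powr_add inverse_powr powr_minus)
    ultimately show ?case by simp
  qed
  from Lim_transform_eventually[OF lim this]
  show ?thesis unfolding filterlim_at_right_to_top .
qed

text \<open>Now the rescaled integrand \<open>(1 - \<tau>) / \<tau>\<close> is not integrable at
  zero, and the divergence produces the logarithm. The power tail is used only for
  \<open>s \<le> d\<close>; elsewhere the tail is bounded by 1 from above and by 0 from
  below.\<close>

lemma mean_inverse_log_bounds:
  assumes \<nu>0: "\<nu> = 0" and e: "0 < e" "e < \<kappa>"
  obtains d where "0 < d"
    "\<And>u. 0 < u \<Longrightarrow> (\<kappa> - e) * (ln ((u + d) / u) - 1) \<le> mean_inverse (c - u)"
    "\<And>u. 0 < u \<Longrightarrow> mean_inverse (c - u) \<le> 1 / d + (\<kappa> + e) * ln ((u + d) / u)"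
proof -
  obtain d where d: "0 < d" "\<And>s. 0 < s \<Longrightarrow> s \<le> d \<Longrightarrow> (\<kappa> - e) * s \<le> lower_tail s \<and> lower_tail s \<le> (\<kappa> + e) * s"
    using lower_tail_near[OF e(1)] \<nu>0 by (auto simp: powr_one)
  have *: "(\<kappa> - e) * (ln ((u + d) / u) - 1) \<le> mean_inverse (c - u) \<and>
     mean_inverse (c - u) \<le> 1 / d + (\<kappa> + e) * ln ((u + d) / u)" if u: "0 < u" for u
  proof -
    \<comment> \<open>The point at which \<open>u * (1 - \<tau>) / \<tau>\<close> equals
      \<open>d\<close>: to its right the power tail is available, to its left the integral is at
      most \<open>a\<close>.\<close>
    define a where "a = u / (u + d)"
    have a: "0 < a" "a < 1" using u d by (auto simp: a_def)
    have lna: "- ln a = ln ((u + d) / u)" using u d by (simp add: a_def ln_div)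
    let ?F = "\<lambda>\<tau>. indicator {0<..<1} \<tau> * lower_tail (u * (1 - \<tau>) / \<tau>)"
    note F = mean_inverse_layer_cake_integral[OF u]
    have inv: "has_bochner_integral lborel (\<lambda>\<tau>. (1 / \<tau>) * indicator {a..1} \<tau>) (ln 1 - ln a)"
      using a by (intro has_bochner_integral_FTC_Icc_nonneg) (auto intro!: derivative_eq_intros)
    have one: "has_bochner_integral lborel (\<lambda>\<tau>. indicator {a..1} \<tau> :: real) (1 - a)"
      using a has_bochner_integral_real_indicator[of "{a..1}" lborel] by simp
    have low: "has_bochner_integral lborel (\<lambda>\<tau>. indicator {0..a} \<tau> :: real) a"
      using a has_bochner_integral_real_indicator[of "{0..a}" lborel] by simp
    have small: "u * (1 - \<tau>) / \<tau> \<le> d" if "a \<le> \<tau>" for \<tau>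
    proof -
      have "0 < \<tau>" using a that by linarith
      moreover have "u \<le> \<tau> * (u + d)" using that u d by (simp add: a_def pos_divide_le_eq)
      ultimately show ?thesis by (simp add: pos_divide_le_eq algebra_simps)
    qed
    have up: "?F \<tau> \<le> indicator {0..a} \<tau> + (\<kappa> + e) * u * ((1 / \<tau>) * indicator {a..1} \<tau>)" for \<tau>
    proof (cases "0 < \<tau> \<and> \<tau> < 1")
      case True
      show ?thesis
      proof (cases "\<tau> \<le> a")
        case le: True
        have "0 \<le> (\<kappa> + e) * u * ((1 / \<tau>) * indicator {a..1} \<tau>)"
          using True \<kappa> e u by simp
        then show ?thesis using True le lower_tail_bounds(2)[of "u * (1 - \<tau>) / \<tau>"] by simp
      next
        case False
        have s: "0 < u * (1 - \<tau>) / \<tau>" using True u by simp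
        have "lower_tail (u * (1 - \<tau>) / \<tau>) \<le> (\<kappa> + e) * (u * (1 - \<tau>) / \<tau>)"
          by (rule d(2)[OF s small, THEN conjunct2]) (use False in simp)
        also have "\<dots> \<le> (\<kappa> + e) * (u * 1 / \<tau>)"
          using True u \<kappa> e by (intro mult_left_mono divide_right_mono) auto
        finally show ?thesis using True False by simp
      qed
    next
      case False
      then have "?F \<tau> = 0" by (auto simp: indicator_def)
      moreover have "0 \<le> (1 / \<tau>) * indicator {a..1} \<tau>" using a by (simp add: indicator_def)
      moreover have "0 \<le> (\<kappa> + e) * u" using \<kappa> e u by simp
      ultimately have "?F \<tau> = 0" "0 \<le> (\<kappa> + e) * u * ((1 / \<tau>) * indicator {a..1} \<tau>)"
        by (simp, simp only: mult_nonneg_nonneg)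
      moreover have "0 \<le> (indicator {0..a} \<tau> :: real)" by simp
      ultimately show ?thesis by linarith
    qed
    have lo: "(\<kappa> - e) * u * ((1 / \<tau>) * indicator {a..1} \<tau> - indicator {a..1} \<tau>) \<le> ?F \<tau>" for \<tau>
    proof (cases "a \<le> \<tau> \<and> \<tau> < 1")
      case True
      then have \<tau>: "0 < \<tau>" using a by linarith
      have s: "0 < u * (1 - \<tau>) / \<tau>" using True \<tau> u by simp
      have "(\<kappa> - e) * (u * (1 - \<tau>) / \<tau>) \<le> lower_tail (u * (1 - \<tau>) / \<tau>)"
        by (rule d(2)[OF s small, THEN conjunct1]) (use True in simp)
      moreover have "(\<kappa> - e) * u * (1 / \<tau> - 1) = (\<kappa> - e) * (u * (1 - \<tau>) / \<tau>)"
        using \<tau> by (simp add: field_simps)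
      ultimately show ?thesis using True \<tau> by simp
    next
      case False
      then have "(1 / \<tau>) * indicator {a..1} \<tau> - indicator {a..1} \<tau> = 0" by (auto simp: indicator_def)
      then show ?thesis by (simp add: lower_tail_bounds)
    qed
    have upi: "has_bochner_integral lborel (\<lambda>\<tau>. indicator {0..a} \<tau> + (\<kappa> + e) * u * ((1 / \<tau>) * indicator {a..1} \<tau>)) (a + (\<kappa> + e) * u * (ln 1 - ln a))"
      by (intro has_bochner_integral_add has_bochner_integral_mult_right low inv)
    have loi: "has_bochner_integral lborel (\<lambda>\<tau>. (\<kappa> - e) * u * ((1 / \<tau>) * indicator {a..1} \<tau> - indicator {a..1} \<tau>)) ((\<kappa> - e) * u * (ln 1 - ln a - (1 - a)))"
      by (intro has_bochner_integral_diff has_bochner_integral_mult_right one inv)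
    have "u * mean_inverse (c - u) \<le> a + (\<kappa> + e) * u * (ln 1 - ln a)"
      unfolding F(2)[symmetric] has_bochner_integral_integral_eq[OF upi, symmetric]
      by (rule integral_mono[OF F(1) integrable.intros[OF upi] up])
    also have "\<dots> = u * (1 / (u + d) + (\<kappa> + e) * (- ln a))" by (simp add: a_def algebra_simps)
    finally have U: "mean_inverse (c - u) \<le> 1 / (u + d) + (\<kappa> + e) * (- ln a)"
      by (rule mult_left_le_imp_le) (rule u)
    have "u * ((\<kappa> - e) * (- ln a - (1 - a))) = (\<kappa> - e) * u * (ln 1 - ln a - (1 - a))" by simp
    also have "\<dots> \<le> u * mean_inverse (c - u)"
      unfolding F(2)[symmetric] has_bochner_integral_integral_eq[OF loi, symmetric]
      by (rule integral_mono[OF integrable.intros[OF loi] F(1) lo])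
    finally have L: "(\<kappa> - e) * (- ln a - (1 - a)) \<le> mean_inverse (c - u)"
      by (rule mult_left_le_imp_le) (rule u)
    have "(\<kappa> - e) * (- ln a - 1) \<le> (\<kappa> - e) * (- ln a - (1 - a))"
      using a e by (intro mult_left_mono) auto
    moreover have "1 / (u + d) \<le> 1 / d" using u d by (intro divide_left_mono) auto
    ultimately show ?thesis using U L unfolding lna by linarith
  qed
  from that[OF d(1)] * show ?thesis by blast
qed

lemma mean_inverse_log_limit:
  assumes \<nu>0: "\<nu> = 0"
  shows "((\<lambda>u. mean_inverse (c - u) / ln (1 / u)) \<longlongrightarrow> \<kappa>) (at_right 0)"
proof (rule order_tendstoI)
  have ln_pos: "eventually (\<lambda>u. 0 < u \<and> 0 < ln (1 / u)) (at_right (0 :: real))"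
    using eventually_at_right_real[OF zero_less_one] by eventually_elim auto
  fix b assume "b < \<kappa>"
  define e where "e = min ((\<kappa> - b) / 2) (\<kappa> / 2)"
  have e: "0 < e" "e < \<kappa>" "b < \<kappa> - e" using \<open>b < \<kappa>\<close> \<kappa> by (auto simp: e_def min_def field_simps)
  obtain d where d: "0 < d" "\<And>u. 0 < u \<Longrightarrow> (\<kappa> - e) * (ln ((u + d) / u) - 1) \<le> mean_inverse (c - u)"
    using mean_inverse_log_bounds[OF \<nu>0 e(1,2)] by metis
  have "((\<lambda>u. (\<kappa> - e) * ((ln ((u + d) / u) - 1) / ln (1 / u))) \<longlongrightarrow> (\<kappa> - e) * 1) (at_right 0)"
    using d(1) by (intro tendsto_mult tendsto_const) real_asymp
  then have "eventually (\<lambda>u. b < (\<kappa> - e) * ((ln ((u + d) / u) - 1) / ln (1 / u))) (at_right 0)"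
    using e by (intro order_tendstoD) auto
  with ln_pos show "eventually (\<lambda>u. b < mean_inverse (c - u) / ln (1 / u)) (at_right 0)"
  proof eventually_elim
    case (elim u)
    have "b < (\<kappa> - e) * (ln ((u + d) / u) - 1) / ln (1 / u)" using elim by simp
    also have "\<dots> \<le> mean_inverse (c - u) / ln (1 / u)"
      using elim d(2)[of u] by (intro divide_right_mono) auto
    finally show ?case .
  qed
next
  have ln_pos: "eventually (\<lambda>u. 0 < u \<and> 0 < ln (1 / u)) (at_right (0 :: real))"
    using eventually_at_right_real[OF zero_less_one] by eventually_elim auto
  fix b assume "\<kappa> < b"
  define e where "e = min ((b - \<kappa>) / 2) (\<kappa> / 2)"
  have e: "0 < e" "e < \<kappa>" "\<kappa> + e < b" using \<open>\<kappa> < b\<close> \<kappa> by (auto simp: e_def min_def field_simps)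
  obtain d where d: "0 < d" "\<And>u. 0 < u \<Longrightarrow> mean_inverse (c - u) \<le> 1 / d + (\<kappa> + e) * ln ((u + d) / u)"
    using mean_inverse_log_bounds[OF \<nu>0 e(1,2)] by metis
  have "((\<lambda>u. 1 / d * (1 / ln (1 / u)) + (\<kappa> + e) * (ln ((u + d) / u) / ln (1 / u))) \<longlongrightarrow> 1 / d * 0 + (\<kappa> + e) * 1) (at_right 0)"
    using d(1) by (intro tendsto_mult tendsto_add tendsto_const) real_asymp+
  then have "eventually (\<lambda>u. 1 / d * (1 / ln (1 / u)) + (\<kappa> + e) * (ln ((u + d) / u) / ln (1 / u)) < b) (at_right 0)"
    using e by (intro order_tendstoD) auto
  with ln_pos show "eventually (\<lambda>u. mean_inverse (c - u) / ln (1 / u) < b) (at_right 0)"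
  proof eventually_elim
    case (elim u)
    have "mean_inverse (c - u) / ln (1 / u) \<le> (1 / d + (\<kappa> + e) * ln ((u + d) / u)) / ln (1 / u)"
      using elim d(2)[of u] by (intro divide_right_mono) auto
    also have "\<dots> = 1 / d * (1 / ln (1 / u)) + (\<kappa> + e) * (ln ((u + d) / u) / ln (1 / u))"
      by (simp only: add_divide_distrib times_divide_eq_right mult_1_right)
    finally show ?case using elim by linarith
  qed
qed

text \<open>If the moment were finite, its part over \<open>[c, c + t)\<close> would vanish as
  \<open>t\<close> tends to zero. But that part is at least \<open>lower_tail t / t^2\<close>, hence
  at least \<open>\<kappa> / 2 * t powr (\<nu> - 1) \<ge> \<kappa> / 2\<close> for small
  \<open>t \<le> 1\<close>.\<close>

lemma inverse_square_moment_infinite: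
  assumes "\<nu> \<le> 1"
  shows "inverse_square_moment c m = \<infinity>"
proof (rule ccontr)
  assume "inverse_square_moment c m \<noteq> \<infinity>"
  then have fin: "inverse_square_moment c m < \<infinity>" by (simp add: top.not_eq_extremum)
  note ne = inverse_square_moment_finite(1)[OF fin] and int = inverse_square_moment_finite(2)[OF fin]
  let ?s = "\<lambda>n. 1 / real (Suc n)"
  let ?G = "\<lambda>n r. indicator {..<c + ?s n} r * (1 / (r - c)\<^sup>2)"
  have "(\<lambda>n. \<integral>r. ?G n r \<partial>m) \<longlonglongrightarrow> (\<integral>r. 0 \<partial>m)"
  proof (rule integral_dominated_convergence[where w = "\<lambda>r. 1 / (r - c)\<^sup>2"])
    show "AE r in m. (\<lambda>n. ?G n r) \<longlonglongrightarrow> 0"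
      using ne rate_ge
    proof eventually_elim
      case (elim r)
      have "eventually (\<lambda>n. ?s n < r - c) sequentially"
        using order_tendstoD(2)[OF LIMSEQ_Suc[OF lim_1_over_n], of "r - c"] elim by simp
      then have "eventually (\<lambda>n. ?G n r = 0) sequentially"
        by eventually_elim (simp add: indicator_def)
      then show ?case by (rule tendsto_eventually)
    qed
    show "AE r in m. norm (?G n r) \<le> 1 / (r - c)\<^sup>2" for n
      by (rule AE_I2) (simp add: indicator_def)
  qed (use int in auto)
  then have G0: "(\<lambda>n. \<integral>r. ?G n r \<partial>m) \<longlonglongrightarrow> 0" by simp
  obtain d where d: "0 < d" "\<And>s. 0 < s \<Longrightarrow> s \<le> d \<Longrightarrow> \<kappa> / 2 * s powr (\<nu> + 1) \<le> lower_tail s"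
    by (rule lower_tail_near[of "\<kappa> / 2"]) (use \<kappa> in auto)
  have "eventually (\<lambda>n. ?s n < d) sequentially"
    using order_tendstoD(2)[OF LIMSEQ_Suc[OF lim_1_over_n] d(1)] .
  moreover have "eventually (\<lambda>n. (\<integral>r. ?G n r \<partial>m) < \<kappa> / 2) sequentially"
    using order_tendstoD(2)[OF G0, of "\<kappa> / 2"] \<kappa> by simp
  ultimately have "eventually (\<lambda>n. False) sequentially"
  proof eventually_elim
    case (elim n)
    let ?t = "?s n"
    have t: "0 < ?t" "?t \<le> 1" by auto
    have Gint: "integrable m (?G n)"
      by (rule Bochner_Integration.integrable_bound[OF int]) (auto simp: indicator_def)
    have "\<kappa> / 2 * ?t\<^sup>2 = \<kappa> / 2 * ?t powr 2" using t by simp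
    also have "\<dots> \<le> \<kappa> / 2 * ?t powr (\<nu> + 1)"
      using t assms \<kappa> by (intro mult_left_mono powr_mono') auto
    also have "\<dots> \<le> lower_tail ?t" using elim t by (intro d(2)) auto
    also have "\<dots> = (\<integral>r. indicator {c..<c + ?t} r \<partial>m)" by (simp add: lower_tail_def)
    also have "\<dots> \<le> (\<integral>r. ?t\<^sup>2 * ?G n r \<partial>m)"
    proof (rule integral_mono_AE)
      show "AE r in m. indicator {c..<c + ?t} r \<le> ?t\<^sup>2 * ?G n r"
        using ne
      proof eventually_elim
        case (elim r)
        show ?case
        proof (cases "c \<le> r \<and> r < c + ?t")
          case True
          then have "(r - c)\<^sup>2 \<le> ?t\<^sup>2" using t by (intro power_mono) auto
          moreover have "0 < (r - c)\<^sup>2" using elim by simp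
          ultimately show ?thesis using True by (simp add: indicator_def pos_le_divide_eq)
        qed (auto simp: indicator_def)
      qed
      show "integrable m (indicator {c..<c + ?t} :: real \<Rightarrow> real)"
        by (rule integrable_real_indicator) (auto simp: emeasure_eq_measure)
      show "integrable m (\<lambda>r. ?t\<^sup>2 * ?G n r)" by (rule integrable_mult_right) (rule Gint)
    qed
    also have "\<dots> = ?t\<^sup>2 * (\<integral>r. ?G n r \<partial>m)" by (rule integral_mult_right_zero)
    finally have "?t\<^sup>2 * (\<kappa> / 2) \<le> ?t\<^sup>2 * (\<integral>r. ?G n r \<partial>m)" by (simp only: mult.commute)
    then have "\<kappa> / 2 \<le> (\<integral>r. ?G n r \<partial>m)" by (rule mult_left_le_imp_le) (use t in simp)
    with elim show ?case by simp
  qed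
  then show False by simp
qed

text \<open>An atom at \<open>c\<close> would lie in all intervals \<open>[c, c + s)\<close>, whose
  probabilities tend to zero.\<close>

lemma AE_rate_neq_edge:
  assumes \<nu>0: "0 < \<nu>" shows "AE r in m. r \<noteq> c"
proof -
  obtain C where C: "0 < C" "\<And>s. 0 < s \<Longrightarrow> lower_tail s \<le> C * s powr (\<nu> + 1)"
    using lower_tail_le_powr by blast
  have le: "measure m {c} \<le> C * s powr (\<nu> + 1)" if "0 < s" for s
  proof -
    have "measure m {c} \<le> lower_tail s" unfolding lower_tail_def using that by (intro finite_measure_mono) auto
    with C(2)[OF that] show ?thesis by simp
  qed
  have "((\<lambda>s. C * s powr (\<nu> + 1)) \<longlongrightarrow> 0) (at_right 0)"
    using \<nu>0 by real_asymp
  moreover have "eventually (\<lambda>s. measure m {c} \<le> C * s powr (\<nu> + 1)) (at_right 0)"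
    using eventually_at_right_less[of 0] by eventually_elim (rule le)
  ultimately have "measure m {c} \<le> 0"
    by (intro tendsto_lowerbound[OF _ _ trivial_limit_at_right_real])
  then have "emeasure m {c} = 0" by (simp add: emeasure_eq_measure measure_le_0_iff)
  then have "AE r in m. r \<notin> {c}" by (intro AE_not_in) (auto simp: null_sets_def)
  then show ?thesis by eventually_elim simp
qed

text \<open>Dyadic decomposition: where \<open>(1 / 2) ^ Suc k \<le> r - c < (1 / 2) ^ k\<close> the
  integrand is at most \<open>2 ^ Suc k\<close>, and the probability of
  \<open>r < c + (1 / 2) ^ k\<close> is at most a multiple of
  \<open>(1 / 2) powr (k * (\<nu> + 1))\<close>. The result is a geometric series of ratio
  \<open>(1 / 2) powr \<nu> < 1\<close>.\<close>

lemma inverse_integrable: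
  assumes \<nu>0: "0 < \<nu>" shows "integrable m (\<lambda>r. 1 / (r - c))"
proof -
  obtain C where C: "0 < C" "\<And>s. 0 < s \<Longrightarrow> lower_tail s \<le> C * s powr (\<nu> + 1)"
    using lower_tail_le_powr by blast
  let ?b = "\<lambda>k r. ennreal (2 ^ Suc k) * indicator {c..<c + (1 / 2) ^ k} r"
  let ?q = "(1 / 2 :: real) powr \<nu>"
  have q: "0 < ?q" "?q < 1" using \<nu>0 powr_less_mono'[of "1/2" 0 \<nu>] by auto
  have pt: "AE r in m. ennreal (1 / (r - c)) \<le> 1 + (\<Sum>k. ?b k r)"
    using AE_rate_neq_edge[OF \<nu>0] rate_ge
  proof eventually_elim
    case (elim r)
    then have t: "0 < r - c" by simp
    show ?case
    proof (cases "1 \<le> r - c")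
      case True
      then have "ennreal (1 / (r - c)) \<le> ennreal 1" by (intro ennreal_leI) simp
      then show ?thesis by (auto intro: order_trans add_increasing2)
    next
      case False
      let ?P = "\<lambda>k. (1 / 2) ^ Suc k \<le> r - c"
      obtain n where "(1 / 2) ^ n < r - c" using real_arch_pow_inv[OF t, of "1 / 2"] by auto
      then have "?P n" using t by simp
      define k where "k = (LEAST k. ?P k)"
      have k: "?P k" unfolding k_def by (rule LeastI[of ?P, OF \<open>?P n\<close>])
      have k': "r - c < (1 / 2) ^ k"
      proof (cases k)
        case 0
        then show ?thesis using False by simp
      next
        case (Suc j)
        then have "\<not> ?P j" using not_less_Least[of j ?P] by (simp add: k_def)
        then show ?thesis unfolding Suc by simp
      qed
      have "1 / (r - c) \<le> 1 / (1 / 2) ^ Suc k" using k t by (intro divide_left_mono mult_pos_pos) auto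
      then have "1 / (r - c) \<le> 2 ^ Suc k" by (simp add: power_one_over)
      then have "ennreal (1 / (r - c)) \<le> ennreal (2 ^ Suc k)" by (rule ennreal_leI)
      also have "\<dots> = ?b k r" using k' t by (simp add: indicator_def)
      also have "\<dots> = sum (\<lambda>k. ?b k r) {k}"
        by (simp only: sum.insert finite.emptyI empty_iff not_False_eq_True sum.empty add_0_right)
      also have "\<dots> \<le> (\<Sum>k. ?b k r)" by (rule sum_le_suminf[OF summableI]) auto
      finally show ?thesis by (simp add: add_increasing)
    qed
  qed
  have "(\<integral>\<^sup>+r. ennreal (1 / (r - c)) \<partial>m) \<le> (\<integral>\<^sup>+r. 1 + (\<Sum>k. ?b k r) \<partial>m)"
    by (rule nn_integral_mono_AE[OF pt])
  also have "\<dots> = (\<integral>\<^sup>+r. 1 \<partial>m) + (\<Sum>k. \<integral>\<^sup>+r. ?b k r \<partial>m)"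
    by (subst nn_integral_add) (auto intro!: nn_integral_suminf)
  also have "(\<lambda>k. \<integral>\<^sup>+r. ?b k r \<partial>m) = (\<lambda>k. ennreal (2 ^ Suc k * lower_tail ((1 / 2) ^ k)))"
    by (simp add: nn_integral_cmult_indicator lower_tail_def emeasure_eq_measure ennreal_mult fun_eq_iff)
  also have "(\<Sum>k. ennreal (2 ^ Suc k * lower_tail ((1 / 2) ^ k))) \<le> (\<Sum>k. ennreal (2 * C * ?q ^ k))"
  proof (rule suminf_le[OF _ summableI summableI], rule ennreal_leI)
    fix k
    have "((1 / 2) ^ k) powr \<nu> = ?q ^ k"
      by (simp add: powr_realpow[symmetric] powr_powr mult.commute)
    then have e: "((1 / 2 :: real) ^ k) powr (\<nu> + 1) = ?q ^ k * (1 / 2) ^ k" by (simp add: powr_add)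
    have "2 ^ Suc k * lower_tail ((1 / 2) ^ k) \<le> 2 ^ Suc k * (C * ((1 / 2) ^ k) powr (\<nu> + 1))"
      by (intro mult_left_mono C(2)) auto
    also have "\<dots> = 2 * C * ?q ^ k * (2 ^ k * (1 / 2) ^ k)" unfolding e by simp
    also have "2 ^ k * (1 / 2 :: real) ^ k = 1" by (simp add: power_mult_distrib[symmetric])
    finally show "2 ^ Suc k * lower_tail ((1 / 2) ^ k) \<le> 2 * C * ?q ^ k" by simp
  qed
  also have "(\<Sum>k. ennreal (2 * C * ?q ^ k)) = ennreal (\<Sum>k. 2 * C * ?q ^ k)"
    using C(1) q by (intro suminf_ennreal2) (auto intro!: summable_mult summable_geometric)
  finally have "(\<integral>\<^sup>+r. ennreal (1 / (r - c)) \<partial>m) \<le> (\<integral>\<^sup>+r. 1 \<partial>m) + ennreal (\<Sum>k. 2 * C * ?q ^ k)"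
    by (simp add: add_left_mono)
  also have "\<dots> < \<infinity>" by (simp add: emeasure_eq_measure)
  finally have fin: "(\<integral>\<^sup>+r. ennreal (1 / (r - c)) \<partial>m) < \<infinity>" .
  show ?thesis
    by (rule integrableI_nonneg[OF _ _ fin]) (simp, use rate_ge in eventually_elim, simp)
qed

end

section \<open>Asymptotics close to the axis\<close>

text \<open>The tangent of the convex function \<open>1 / z\<close> at \<open>c\<close>: moving
  \<open>z\<close> a distance \<open>u\<close> away from the edge costs at least
  \<open>u / c^2\<close>.\<close>

lemma inverse_gap:
  fixes c z :: real
  assumes "0 < z" "z < c"
  shows "(c - z) / c\<^sup>2 \<le> 1 / z - 1 / c"
proof -
  have "(c - z) / c\<^sup>2 \<le> (c - z) / (z * c)"
    using assms by (intro divide_left_mono) (auto simp: power2_eq_square)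
  also have "\<dots> = 1 / z - 1 / c" using assms by (simp add: field_simps)
  finally show ?thesis .
qed

context row_limit begin

lemma limit_le_edge:
  assumes int: "integrable m (\<lambda>r. 1 / (r - c))" and ne: "AE r in m. r \<noteq> c" and \<alpha>: "0 < \<alpha>"
  shows "\<Psi> 1 \<alpha> \<le> 1 / c + \<alpha> * mean_inverse c"
proof (rule tendsto_lowerbound[OF _ _ trivial_limit_at_left_real])
  show "((\<lambda>z. 1 / z + \<alpha> * mean_inverse c) \<longlongrightarrow> 1 / c + \<alpha> * mean_inverse c) (at_left c)"
    using c_pos by (intro tendsto_intros) auto
  have "eventually (\<lambda>z. z \<in> {0<..<c}) (at_left c)" using c_pos by (rule eventually_at_left_real)
  then show "eventually (\<lambda>z. \<Psi> 1 \<alpha> \<le> 1 / z + \<alpha> * mean_inverse c) (at_left c)"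
  proof eventually_elim
    case (elim z)
    then have "\<alpha> * mean_inverse z \<le> \<alpha> * mean_inverse c"
      using \<alpha> by (intro mult_left_mono mean_inverse_le_edge[OF int ne]) auto
    moreover have "\<Psi> 1 \<alpha> \<le> 1 / z + \<alpha> * mean_inverse z"
      using \<alpha> elim by (intro variational_upper) auto
    ultimately show ?case by linarith
  qed
qed

text \<open>The lower half of the variational formula as used from here on: a bound on all
  candidates is a bound on the limit.\<close>

lemma limit_geI:
  assumes "0 < \<alpha>" "\<And>z. 0 < z \<Longrightarrow> z < c \<Longrightarrow> A \<le> 1 / z + \<alpha> * mean_inverse z"
  shows "A \<le> \<Psi> 1 \<alpha>"
proof (rule field_le_epsilon)
  fix e :: real assume "0 < e"
  from variational_lower[OF assms(1) this] obtain z where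
    "0 < z" "z < c" "1 / z + \<alpha> * mean_inverse z - e \<le> \<Psi> 1 \<alpha>" by auto
  with assms(2)[of z] show "A \<le> \<Psi> 1 \<alpha> + e" by simp
qed

text \<open>Moving \<open>z\<close> away from \<open>c\<close> lowers
  \<open>\<alpha> * mean_inverse z\<close> by at most \<open>\<alpha> * (c - z) * J\<close>, while
  the first term rises by at least \<open>(c - z) / c^2\<close>. For small \<open>\<alpha>\<close>
  the rise wins for every \<open>z\<close>, the infimum sits at the edge and the formula is
  exact.\<close>

lemma limit_linear:
  assumes fin: "inverse_square_moment c m < \<infinity>"
  shows "\<exists>\<alpha>\<^sub>0>0. \<forall>\<alpha>\<in>{0<..\<alpha>\<^sub>0}. \<Psi> 1 \<alpha> = 1 / c + \<alpha> * inverse_moment c m"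
proof -
  note ne = inverse_square_moment_finite(1)[OF fin] and sq = inverse_square_moment_finite(2)[OF fin]
    and int = inverse_square_moment_finite(3)[OF fin]
  define J where "J = (\<integral>r. 1 / (r - c)\<^sup>2 \<partial>m)"
  have J: "0 \<le> J" by (simp add: J_def)
  have gap: "mean_inverse c - mean_inverse z \<le> (c - z) * J" if z: "z < c" for z
  proof -
    have "mean_inverse c - mean_inverse z = (\<integral>r. 1 / (r - c) - 1 / (r - z) \<partial>m)"
      unfolding mean_inverse_def
      by (rule Bochner_Integration.integral_diff[OF int mean_inverse_integrable[OF z], symmetric])
    also have "\<dots> \<le> (\<integral>r. (c - z) * (1 / (r - c)\<^sup>2) \<partial>m)"
    proof (rule integral_mono_AE)
      show "AE r in m. 1 / (r - c) - 1 / (r - z) \<le> (c - z) * (1 / (r - c)\<^sup>2)"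
        using ne rate_ge
      proof eventually_elim
        case (elim r)
        then have r: "0 < r - c" "0 < r - z" using z by auto
        have "1 / (r - c) - 1 / (r - z) = (c - z) / ((r - c) * (r - z))"
          using r by (simp add: field_simps)
        also have "\<dots> \<le> (c - z) / ((r - c) * (r - c))"
          using r z by (intro divide_left_mono mult_left_mono) auto
        finally show ?case by (simp add: power2_eq_square)
      qed
      show "integrable m (\<lambda>r. 1 / (r - c) - 1 / (r - z))"
        by (rule Bochner_Integration.integrable_diff[OF int mean_inverse_integrable[OF z]])
      show "integrable m (\<lambda>r. (c - z) * (1 / (r - c)\<^sup>2))"
        by (rule integrable_mult_right) (rule sq)
    qed
    also have "\<dots> = (c - z) * J" unfolding J_def by (rule integral_mult_right_zero)
    finally show ?thesis .
  qed
  show ?thesis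
  \<comment> \<open>The threshold amounts to \<open>\<alpha> * J \<le> 1 / c^2\<close>; adding 1 to
    \<open>J\<close> keeps the denominator positive without further argument.\<close>
  proof (intro exI[of _ "1 / (c\<^sup>2 * (J + 1))"] conjI ballI)
    show "0 < 1 / (c\<^sup>2 * (J + 1))" using c_pos J by simp
    fix \<alpha> assume "\<alpha> \<in> {0<..1 / (c\<^sup>2 * (J + 1))}"
    then have \<alpha>: "0 < \<alpha>" "\<alpha> \<le> 1 / (c\<^sup>2 * (J + 1))" by auto
    have "\<alpha> * (c\<^sup>2 * (J + 1)) \<le> 1" using \<alpha>(2) c_pos J by (simp add: pos_le_divide_eq)
    moreover have "\<alpha> * J * c\<^sup>2 \<le> \<alpha> * (c\<^sup>2 * (J + 1))" using \<alpha> by (simp add: algebra_simps)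
    ultimately have aJ: "\<alpha> * J \<le> 1 / c\<^sup>2" using c_pos by (simp add: pos_le_divide_eq)
    have "1 / c + \<alpha> * mean_inverse c \<le> \<Psi> 1 \<alpha>"
    proof (rule limit_geI[OF \<alpha>(1)])
      fix z assume z: "0 < z" "z < c"
      have "\<alpha> * (mean_inverse c - mean_inverse z) \<le> \<alpha> * ((c - z) * J)"
        using gap[OF z(2)] \<alpha> by (intro mult_left_mono) auto
      also have "\<dots> = (c - z) * (\<alpha> * J)" by simp
      also have "\<dots> \<le> (c - z) * (1 / c\<^sup>2)" using aJ z by (intro mult_left_mono) auto
      also have "\<dots> \<le> 1 / z - 1 / c" using inverse_gap[OF z] by simp
      finally show "1 / c + \<alpha> * mean_inverse c \<le> 1 / z + \<alpha> * mean_inverse z"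
        by (simp add: algebra_simps)
    qed
    with limit_le_edge[OF int ne \<alpha>(1)] show "\<Psi> 1 \<alpha> = 1 / c + \<alpha> * inverse_moment c m"
      by (simp add: inverse_moment_eq)
  qed
qed

text \<open>Within distance \<open>d\<close> of the edge \<open>mean_inverse\<close> loses at most
  \<open>e\<close>. Farther away the first term has risen by \<open>d / c^2\<close>, which exceeds
  \<open>\<alpha> * mean_inverse c\<close> once \<open>\<alpha>\<close> is small.\<close>

lemma limit_almost_linear:
  assumes int: "integrable m (\<lambda>r. 1 / (r - c))" and ne: "AE r in m. r \<noteq> c"
  shows "(\<lambda>\<alpha>. \<Psi> 1 \<alpha> - (1 / c + \<alpha> * inverse_moment c m)) \<in> o[at_right 0](\<lambda>\<alpha>. \<alpha>)"
proof (rule landau_o.smallI)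
  fix e :: real assume e: "0 < e"
  obtain d where d: "0 < d" "\<And>z. c - d < z \<Longrightarrow> z < c \<Longrightarrow> mean_inverse c - e \<le> mean_inverse z"
    using mean_inverse_near_edge[OF int ne e] by blast
  have mc: "0 \<le> mean_inverse c" unfolding mean_inverse_def
    by (rule integral_nonneg_AE, use rate_ge in eventually_elim) simp
  have "eventually (\<lambda>\<alpha>. \<alpha> \<in> {0<..<d / (c\<^sup>2 * (mean_inverse c + 1))}) (at_right 0)"
    using d c_pos mc by (intro eventually_at_right_real) simp
  then show "eventually (\<lambda>\<alpha>. norm (\<Psi> 1 \<alpha> - (1 / c + \<alpha> * inverse_moment c m)) \<le> e * norm \<alpha>) (at_right 0)"
  proof eventually_elim
    case (elim \<alpha>)
    then have \<alpha>: "0 < \<alpha>" "\<alpha> * (c\<^sup>2 * (mean_inverse c + 1)) < d"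
      using c_pos mc by (auto simp: pos_less_divide_eq)
    have "\<alpha> * mean_inverse c * c\<^sup>2 \<le> \<alpha> * (c\<^sup>2 * (mean_inverse c + 1))" using \<alpha> by (simp add: algebra_simps)
    then have "\<alpha> * mean_inverse c * c\<^sup>2 \<le> d" using \<alpha>(2) by linarith
    then have far: "\<alpha> * mean_inverse c \<le> d / c\<^sup>2" using c_pos by (simp add: pos_le_divide_eq)
    have "1 / c + \<alpha> * (mean_inverse c - e) \<le> \<Psi> 1 \<alpha>"
    proof (rule limit_geI[OF \<alpha>(1)])
      fix z assume z: "0 < z" "z < c"
      show "1 / c + \<alpha> * (mean_inverse c - e) \<le> 1 / z + \<alpha> * mean_inverse z"
      proof (cases "c - d < z")
        case True
        have "\<alpha> * (mean_inverse c - e) \<le> \<alpha> * mean_inverse z"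
          using d(2)[OF True z(2)] \<alpha> by (intro mult_left_mono) auto
        moreover have "1 / c \<le> 1 / z" using z by (simp add: frac_le)
        ultimately show ?thesis by linarith
      next
        case False
        have "d / c\<^sup>2 \<le> (c - z) / c\<^sup>2" using False by (intro divide_right_mono) auto
        moreover have "0 \<le> \<alpha> * e" "0 \<le> \<alpha> * mean_inverse z" using \<alpha> e mean_inverse_bounds[OF z(2)] by auto
        ultimately show ?thesis using far inverse_gap[OF z] by (simp add: right_diff_distrib)
      qed
    qed
    with limit_le_edge[OF int ne \<alpha>(1)] show ?case
      using \<alpha> by (simp add: inverse_moment_eq abs_le_iff algebra_simps)
  qed
qed

end

section \<open>Logarithmic and power corrections for heavier tails\<close>

locale row_limit_tail = row_limit m c \<Psi> + rate_tail m c \<nu> \<kappa> for m c \<Psi> \<nu> \<kappa>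
begin

lemma limit_log:
  assumes \<nu>0: "\<nu> = 0"
  shows "(\<lambda>\<alpha>. \<Psi> 1 \<alpha> - (1 / c - \<kappa> * \<alpha> * ln \<alpha>)) \<in> o[at_right 0](\<lambda>\<alpha>. \<alpha> * ln \<alpha>)"
proof -
  define K where "K = \<kappa> * c\<^sup>2"
  have K: "0 < K" using \<kappa> c_pos by (simp add: K_def)
  \<comment> \<open>At distance \<open>w \<alpha>\<close> from the edge the cost
    \<open>w \<alpha> / c^2\<close> equals the claimed correction
    \<open>\<kappa> * \<alpha> * ln (1 / \<alpha>)\<close>. Candidates farther away are settled by
    cost alone; for closer ones \<open>mean_inverse z\<close> is at least
    \<open>mean_inverse (c - w \<alpha>)\<close>, where \<open>ln (1 / w \<alpha>)\<close> is
    asymptotic to \<open>ln (1 / \<alpha>)\<close>.\<close>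
  define w where "w \<alpha> = K * (\<alpha> * ln (1 / \<alpha>))" for \<alpha>
  define R where "R \<alpha> = (\<Psi> 1 \<alpha> - 1 / c) / (\<alpha> * ln (1 / \<alpha>))" for \<alpha>
  note lim = mean_inverse_log_limit[OF \<nu>0]
  have small: "eventually (\<lambda>\<alpha>. 0 < \<alpha> \<and> \<alpha> < c \<and> 0 < ln (1 / \<alpha>)) (at_right 0)"
    using eventually_at_right_real[of 0 "min 1 c"] c_pos by (auto elim!: eventually_mono)
  have "(R \<longlongrightarrow> \<kappa>) (at_right 0)"
  proof (rule tendsto_sandwich)
    have w0: "filterlim w (at_right 0) (at_right 0)" unfolding w_def[abs_def] using K by real_asymp
    have r1: "((\<lambda>\<alpha>. ln (1 / w \<alpha>) / ln (1 / \<alpha>)) \<longlongrightarrow> 1) (at_right 0)" unfolding w_def[abs_def] using K by real_asymp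
    have w1: "eventually (\<lambda>\<alpha>. w \<alpha> \<in> {0<..<1}) (at_right 0)"
      using filterlim_iff[THEN iffD1, OF w0, rule_format, OF eventually_at_right_real[OF zero_less_one]] .
    have "((\<lambda>\<alpha>. mean_inverse (c - w \<alpha>) / ln (1 / w \<alpha>) * (ln (1 / w \<alpha>) / ln (1 / \<alpha>))) \<longlongrightarrow> \<kappa> * 1) (at_right 0)"
      by (intro tendsto_mult r1 filterlim_compose[OF lim w0])
    moreover have "eventually (\<lambda>\<alpha>. mean_inverse (c - w \<alpha>) / ln (1 / w \<alpha>) * (ln (1 / w \<alpha>) / ln (1 / \<alpha>)) = mean_inverse (c - w \<alpha>) / ln (1 / \<alpha>)) (at_right 0)"
      using w1
    proof eventually_elim
      case (elim \<alpha>)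
      then have "0 < ln (1 / w \<alpha>)" by simp
      then show ?case by simp
    qed
    ultimately have gw: "((\<lambda>\<alpha>. mean_inverse (c - w \<alpha>) / ln (1 / \<alpha>)) \<longlongrightarrow> \<kappa>) (at_right 0)"
      by (auto intro: Lim_transform_eventually)
    \<comment> \<open>The minimum covers both kinds of candidates: \<open>\<kappa>\<close> for the
      far ones, the ratio for the near ones.\<close>
    show "((\<lambda>\<alpha>. min \<kappa> (mean_inverse (c - w \<alpha>) / ln (1 / \<alpha>))) \<longlongrightarrow> \<kappa>) (at_right 0)"
      using tendsto_min[OF tendsto_const[of \<kappa>] gw] by simp
    show "eventually (\<lambda>\<alpha>. min \<kappa> (mean_inverse (c - w \<alpha>) / ln (1 / \<alpha>)) \<le> R \<alpha>) (at_right 0)"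
      using small
    proof eventually_elim
      case (elim \<alpha>)
      define q where "q = min \<kappa> (mean_inverse (c - w \<alpha>) / ln (1 / \<alpha>))"
      have "1 / c + q * (\<alpha> * ln (1 / \<alpha>)) \<le> \<Psi> 1 \<alpha>"
      proof (rule limit_geI)
        fix z assume z: "0 < z" "z < c"
        show "1 / c + q * (\<alpha> * ln (1 / \<alpha>)) \<le> 1 / z + \<alpha> * mean_inverse z"
        proof (cases "w \<alpha> \<le> c - z")
          case True
          have "q * (\<alpha> * ln (1 / \<alpha>)) \<le> \<kappa> * (\<alpha> * ln (1 / \<alpha>))"
            using elim by (intro mult_right_mono) (auto simp: q_def)
          also have "\<dots> = w \<alpha> / c\<^sup>2" using c_pos by (simp add: w_def K_def)
          also have "\<dots> \<le> (c - z) / c\<^sup>2" using True by (intro divide_right_mono) auto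
          finally have "q * (\<alpha> * ln (1 / \<alpha>)) \<le> 1 / z - 1 / c" using inverse_gap[OF z] by linarith
          moreover have "0 \<le> \<alpha> * mean_inverse z" using elim mean_inverse_bounds[OF z(2)] by simp
          ultimately show ?thesis by linarith
        next
          case False
          have "q * (\<alpha> * ln (1 / \<alpha>)) \<le> (mean_inverse (c - w \<alpha>) / ln (1 / \<alpha>)) * (\<alpha> * ln (1 / \<alpha>))"
            using elim by (intro mult_right_mono) (auto simp: q_def)
          also have "\<dots> = \<alpha> * mean_inverse (c - w \<alpha>)"
          proof -
            have "x / l * (\<alpha> * l) = \<alpha> * x" if "0 < l" for x l :: real using that by simp
            then show ?thesis using elim by blast
          qed
          also have "\<dots> \<le> \<alpha> * mean_inverse z"
            using elim False z by (intro mult_left_mono mean_inverse_mono) auto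
          finally have "q * (\<alpha> * ln (1 / \<alpha>)) \<le> \<alpha> * mean_inverse z" .
          moreover have "1 / c \<le> 1 / z" using z by (simp add: frac_le)
          ultimately show ?thesis by linarith
        qed
      qed (use elim in simp)
      then have "q * (\<alpha> * ln (1 / \<alpha>)) \<le> \<Psi> 1 \<alpha> - 1 / c" by linarith
      moreover have "0 < \<alpha> * ln (1 / \<alpha>)" using elim by (intro mult_pos_pos) auto
      ultimately show ?case unfolding q_def[symmetric] R_def by (simp only: pos_le_divide_eq)
    qed
    \<comment> \<open>The upper bound uses the test point \<open>z = c - \<alpha>\<close>, whose
      cost of order \<open>\<alpha>\<close> is negligible against
      \<open>\<alpha> * ln (1 / \<alpha>)\<close>.\<close>
    have "((\<lambda>\<alpha>. 1 / (c * (c - \<alpha>)) * (1 / ln (1 / \<alpha>)) + mean_inverse (c - \<alpha>) / ln (1 / \<alpha>)) \<longlongrightarrow> 1 / (c * (c - 0)) * 0 + \<kappa>) (at_right 0)"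
    proof (intro tendsto_add tendsto_mult lim)
      show "((\<lambda>\<alpha>. 1 / (c * (c - \<alpha>))) \<longlongrightarrow> 1 / (c * (c - 0))) (at_right 0)"
        using c_pos by (intro tendsto_intros) auto
      show "((\<lambda>\<alpha>. 1 / ln (1 / \<alpha> :: real)) \<longlongrightarrow> 0) (at_right 0)" by real_asymp
    qed
    then show "((\<lambda>\<alpha>. 1 / (c * (c - \<alpha>)) * (1 / ln (1 / \<alpha>)) + mean_inverse (c - \<alpha>) / ln (1 / \<alpha>)) \<longlongrightarrow> \<kappa>) (at_right 0)"
      by simp
    show "eventually (\<lambda>\<alpha>. R \<alpha> \<le> 1 / (c * (c - \<alpha>)) * (1 / ln (1 / \<alpha>)) + mean_inverse (c - \<alpha>) / ln (1 / \<alpha>)) (at_right 0)"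
      using small
    proof eventually_elim
      case (elim \<alpha>)
      have "\<Psi> 1 \<alpha> \<le> 1 / (c - \<alpha>) + \<alpha> * mean_inverse (c - \<alpha>)"
        using elim by (intro variational_upper) auto
      moreover have "1 / (c - \<alpha>) - 1 / c = \<alpha> * (1 / (c * (c - \<alpha>)))"
        using elim c_pos by (simp add: field_simps)
      ultimately have "\<Psi> 1 \<alpha> - 1 / c \<le> \<alpha> * (1 / (c * (c - \<alpha>))) + \<alpha> * mean_inverse (c - \<alpha>)" by linarith
      then have "R \<alpha> \<le> (\<alpha> * (1 / (c * (c - \<alpha>))) + \<alpha> * mean_inverse (c - \<alpha>)) / (\<alpha> * ln (1 / \<alpha>))"
        unfolding R_def using elim by (intro divide_right_mono mult_nonneg_nonneg) auto
      also have "\<dots> = (\<alpha> * (1 / (c * (c - \<alpha>)) + mean_inverse (c - \<alpha>))) / (\<alpha> * ln (1 / \<alpha>))"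
        by (simp only: distrib_left)
      also have "\<dots> = (1 / (c * (c - \<alpha>)) + mean_inverse (c - \<alpha>)) / ln (1 / \<alpha>)"
        using elim by (intro mult_divide_mult_cancel_left) auto
      finally show ?case by (simp only: add_divide_distrib times_divide_eq_right mult_1_right)
    qed
  qed
  then have "((\<lambda>\<alpha>. \<kappa> - R \<alpha>) \<longlongrightarrow> \<kappa> - \<kappa>) (at_right 0)" by (intro tendsto_intros)
  then have R0: "((\<lambda>\<alpha>. \<kappa> - R \<alpha>) \<longlongrightarrow> 0) (at_right 0)" by simp
  show ?thesis
  proof (rule smalloI_tendsto)
    have "eventually (\<lambda>\<alpha>. \<kappa> - R \<alpha> = (\<Psi> 1 \<alpha> - (1 / c - \<kappa> * \<alpha> * ln \<alpha>)) / (\<alpha> * ln \<alpha>)) (at_right 0)"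
      using small
    proof eventually_elim
      case (elim \<alpha>)
      have l: "ln (1 / \<alpha>) = - ln \<alpha>" using elim by (simp add: ln_div)
      then have nz: "\<alpha> * ln \<alpha> \<noteq> 0" using elim by auto
      have "(\<Psi> 1 \<alpha> - (1 / c - \<kappa> * \<alpha> * ln \<alpha>)) / (\<alpha> * ln \<alpha>) = (\<Psi> 1 \<alpha> - 1 / c + \<kappa> * (\<alpha> * ln \<alpha>)) / (\<alpha> * ln \<alpha>)"
        by (simp add: algebra_simps)
      also have "\<dots> = (\<Psi> 1 \<alpha> - 1 / c) / (\<alpha> * ln \<alpha>) + \<kappa>" using nz by (simp add: add_divide_distrib)
      also have "(\<Psi> 1 \<alpha> - 1 / c) / (\<alpha> * ln \<alpha>) = - R \<alpha>" by (simp add: R_def l)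
      finally show ?case by simp
    qed
    with R0 show "((\<lambda>\<alpha>. (\<Psi> 1 \<alpha> - (1 / c - \<kappa> * \<alpha> * ln \<alpha>)) / (\<alpha> * ln \<alpha>)) \<longlongrightarrow> 0) (at_right 0)"
      by (rule Lim_transform_eventually)
    show "eventually (\<lambda>\<alpha>. \<alpha> * ln \<alpha> \<noteq> 0) (at_right (0 :: real))"
      using eventually_at_right_real[OF zero_less_one] by eventually_elim auto
  qed
qed

text \<open>With \<open>c - z = t * \<alpha> powr \<beta>\<close> the cost and the term
  \<open>\<alpha> * mean_inverse z\<close> are of the same order, and to leading order their sum is
  \<open>\<alpha> powr \<beta> * (t / c^2 + D * t powr \<nu>)\<close>. Minimising over
  \<open>t\<close> gives \<open>t = B0_const c \<kappa> \<nu>\<close> and the value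
  \<open>B_const c \<kappa> \<nu>\<close>.\<close>

lemma limit_powr:
  assumes \<nu>0: "\<nu> < 0"
  shows "(\<lambda>\<alpha>. \<Psi> 1 \<alpha> - (1 / c + B_const c \<kappa> \<nu> * \<alpha> powr (1 / (1 - \<nu>)))) \<in> o[at_right 0](\<lambda>\<alpha>. \<alpha> powr (1 / (1 - \<nu>)))"
proof -
  define \<beta> where "\<beta> = 1 / (1 - \<nu>)"
  \<comment> \<open>The identity \<open>1 + \<nu> * \<beta> = \<beta>\<close> is the balance of the
    two terms and fixes the exponent.\<close>
  have \<beta>: "0 < \<beta>" "1 + \<nu> * \<beta> = \<beta>" using \<nu>0 by (simp_all add: \<beta>_def field_simps)
  define D where "D = \<kappa> * A2_const \<nu>"
  have D: "0 < D" using \<kappa> A_const_Beta(4)[OF \<nu> \<nu>0] by (simp add: D_def)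
  define t0 where "t0 = B0_const c \<kappa> \<nu>"
  have "2 * \<kappa> * c\<^sup>2 * A1_const \<nu> = \<kappa> * c\<^sup>2 * (2 * A1_const \<nu>)" by simp
  also have "\<dots> = - \<nu> * c\<^sup>2 * D" unfolding A_const_Beta(3)[OF \<nu> \<nu>0] by (simp add: D_def)
  finally have t0_eq: "t0 = (- \<nu> * c\<^sup>2 * D) powr (1 / (1 - \<nu>))" unfolding t0_def B0_const_def by simp
  have "0 < - \<nu> * c\<^sup>2 * D" using \<nu>0 c_pos D by (intro mult_pos_pos) auto
  then have t0: "0 < t0" unfolding t0_eq by (simp only: powr_gt_zero)
  define B where "B = B_const c \<kappa> \<nu>"
  have B_eq: "B = t0 / c\<^sup>2 + D * t0 powr \<nu>"
    by (simp add: B_def B_const_def t0_def[symmetric] D_def mult_ac)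
  have B_pos: "0 < B" unfolding B_eq using t0 c_pos D by (intro add_pos_pos) auto
  define \<phi> where "\<phi> u = u powr (- \<nu>) * mean_inverse (c - u)" for u
  have \<phi>: "(\<phi> \<longlongrightarrow> D) (at_right 0)" unfolding \<phi>_def[abs_def] D_def by (rule mean_inverse_powr_limit[OF \<nu>0])
  have \<phi>_inv: "mean_inverse (c - u) = u powr \<nu> * \<phi> u" if "0 < u" for u
    using that by (simp add: \<phi>_def powr_add[symmetric] mult.assoc[symmetric])
  define R where "R \<alpha> = (\<Psi> 1 \<alpha> - 1 / c) / \<alpha> powr \<beta>" for \<alpha>
  have scale: "\<alpha> * (t * \<alpha> powr \<beta>) powr \<nu> = t powr \<nu> * \<alpha> powr \<beta>" if "0 < \<alpha>" "0 < t" for \<alpha> t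
  proof -
    have "\<alpha> * (t * \<alpha> powr \<beta>) powr \<nu> = t powr \<nu> * (\<alpha> powr 1 * \<alpha> powr (\<nu> * \<beta>))"
      using that by (simp add: powr_mult powr_powr mult_ac)
    also have "\<alpha> powr 1 * \<alpha> powr (\<nu> * \<beta>) = \<alpha> powr \<beta>" by (simp only: powr_add[symmetric] \<beta>(2))
    finally show ?thesis .
  qed
  have pow0: "((\<lambda>\<alpha>. \<alpha> powr \<beta>) \<longlongrightarrow> 0) (at_right 0)" using \<beta>(1) by real_asymp
  have "(R \<longlongrightarrow> B) (at_right 0)"
  proof (rule order_tendstoI)
    fix b assume b: "b < B"
    define x where "x = b / B"
    have x: "x < 1" using b B_pos by (simp add: x_def pos_divide_less_eq)
    \<comment> \<open>A factor strictly between \<open>b / B\<close> and 1; the maximum with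
      \<open>1 / 2\<close> keeps it positive when \<open>b\<close> is negative. As a factor, the
      loss can be granted to both terms of the minimised function at once.\<close>
    define \<eta> where "\<eta> = max (1 / 2) ((1 + x) / 2)"
    have \<eta>: "0 < \<eta>" "\<eta> < 1" "x < \<eta>" using x by (auto simp: \<eta>_def less_max_iff_disj)
    then have b_less: "b < \<eta> * B" using B_pos by (simp add: x_def pos_divide_less_eq)
    have "eventually (\<lambda>u. \<eta> * D < \<phi> u) (at_right 0)"
      using order_tendstoD(1)[OF \<phi>, of "\<eta> * D"] \<eta> D by simp
    then obtain d where d: "0 < d" "\<And>u. 0 < u \<Longrightarrow> u < d \<Longrightarrow> \<eta> * D < \<phi> u"
      unfolding eventually_at_right_field by auto
    have "eventually (\<lambda>\<alpha>. \<alpha> powr \<beta> < d / c\<^sup>2 / B) (at_right 0)"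
      using d c_pos B_pos by (intro order_tendstoD(2)[OF pow0]) simp
    with eventually_at_right_less[of 0] show "eventually (\<lambda>\<alpha>. b < R \<alpha>) (at_right 0)"
    proof eventually_elim
      case (elim \<alpha>)
      have p: "0 < \<alpha> powr \<beta>" using elim by simp
      have "\<alpha> powr \<beta> * B < d / c\<^sup>2" using elim(2) B_pos by (simp only: pos_less_divide_eq)
      then have far: "B * \<alpha> powr \<beta> \<le> d / c\<^sup>2" by (simp only: mult.commute[of B] less_imp_le)
      have "1 / c + \<eta> * (B * \<alpha> powr \<beta>) \<le> \<Psi> 1 \<alpha>"
      proof (rule limit_geI[OF elim(1)])
        fix z assume z: "0 < z" "z < c"
        define u where "u = c - z"
        have u: "0 < u" using z by (simp add: u_def)
        have zu: "mean_inverse z = u powr \<nu> * \<phi> u" using \<phi>_inv[OF u] by (simp add: u_def)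
        have gap: "u / c\<^sup>2 \<le> 1 / z - 1 / c" using inverse_gap[OF z] by (simp add: u_def)
        have gz: "0 \<le> \<alpha> * mean_inverse z" using elim mean_inverse_bounds[OF z(2)] by simp
        show "1 / c + \<eta> * (B * \<alpha> powr \<beta>) \<le> 1 / z + \<alpha> * mean_inverse z"
        \<comment> \<open>Below \<open>d\<close> the asymptotics of \<open>mean_inverse\<close>
          apply and \<open>linear_plus_powr_min\<close> bounds the sum; from \<open>d\<close> on the
          cost \<open>d / c^2\<close> alone exceeds
          \<open>B * \<alpha> powr \<beta>\<close>.\<close>
        proof (cases "u < d")
          case True
          define t where "t = u / \<alpha> powr \<beta>"
          have t: "0 < t" "u = t * \<alpha> powr \<beta>" using u p by (simp_all add: t_def)
          have "B \<le> t / c\<^sup>2 + D * t powr \<nu>"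
            unfolding B_eq by (rule linear_plus_powr_min[OF c_pos D \<nu>0 t(1) t0_eq])
          then have "B * \<alpha> powr \<beta> \<le> (t / c\<^sup>2 + D * t powr \<nu>) * \<alpha> powr \<beta>"
            using p by (intro mult_right_mono) auto
          also have "\<dots> = u / c\<^sup>2 + D * (\<alpha> * u powr \<nu>)"
            unfolding t(2) scale[OF elim(1) t(1)] by (simp add: distrib_right)
          finally have "\<eta> * (B * \<alpha> powr \<beta>) \<le> \<eta> * (u / c\<^sup>2 + D * (\<alpha> * u powr \<nu>))"
            using \<eta> by (intro mult_left_mono) auto
          also have "\<dots> = \<eta> * (u / c\<^sup>2) + \<alpha> * (u powr \<nu> * (\<eta> * D))" by (simp add: algebra_simps)
          also have "\<dots> \<le> 1 * (u / c\<^sup>2) + \<alpha> * (u powr \<nu> * \<phi> u)"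
            using \<eta> u elim(1) d(2)[OF u True] by (intro add_mono mult_right_mono mult_left_mono) auto
          finally show ?thesis using gap unfolding zu by linarith
        next
          case False
          have "\<eta> * (B * \<alpha> powr \<beta>) \<le> 1 * (B * \<alpha> powr \<beta>)"
            using \<eta> B_pos p by (intro mult_right_mono) auto
          also have "\<dots> \<le> d / c\<^sup>2" using far by simp
          also have "\<dots> \<le> u / c\<^sup>2" using False by (intro divide_right_mono) auto
          finally show ?thesis using gap gz by linarith
        qed
      qed
      then have "\<eta> * B * \<alpha> powr \<beta> \<le> \<Psi> 1 \<alpha> - 1 / c" by (simp add: algebra_simps)
      then have "\<eta> * B \<le> R \<alpha>" unfolding R_def using p by (simp only: pos_le_divide_eq)
      with b_less show ?case by linarith
    qed
  next
    fix b assume b: "B < b"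
    \<comment> \<open>The minimiser \<open>t0\<close> in rescaled form is the test distance for the
      upper bound.\<close>
    define u where "u \<alpha> = t0 * \<alpha> powr \<beta>" for \<alpha>
    have u0: "(u \<longlongrightarrow> 0) (at_right 0)"
      unfolding u_def[abs_def] using tendsto_mult[OF tendsto_const[of t0] pow0] by simp
    have upos: "eventually (\<lambda>\<alpha>. 0 < u \<alpha>) (at_right 0)"
      using eventually_at_right_less[of 0] by eventually_elim (simp add: u_def t0)
    have ur: "filterlim u (at_right 0) (at_right 0)"
      using u0 upos by (rule tendsto_imp_filterlim_at_right)
    have "((\<lambda>\<alpha>. t0 / (c * (c - u \<alpha>)) + t0 powr \<nu> * \<phi> (u \<alpha>)) \<longlongrightarrow> t0 / (c * (c - 0)) + t0 powr \<nu> * D) (at_right 0)"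
      using c_pos by (intro tendsto_intros u0 filterlim_compose[OF \<phi> ur]) auto
    then have "((\<lambda>\<alpha>. t0 / (c * (c - u \<alpha>)) + t0 powr \<nu> * \<phi> (u \<alpha>)) \<longlongrightarrow> B) (at_right 0)"
      by (simp add: B_eq power2_eq_square mult.commute)
    then have "eventually (\<lambda>\<alpha>. t0 / (c * (c - u \<alpha>)) + t0 powr \<nu> * \<phi> (u \<alpha>) < b) (at_right 0)"
      using b by (rule order_tendstoD)
    moreover have "eventually (\<lambda>\<alpha>. u \<alpha> < c) (at_right 0)" using u0 c_pos by (rule order_tendstoD)
    ultimately show "eventually (\<lambda>\<alpha>. R \<alpha> < b) (at_right 0)"
      using eventually_at_right_less[of 0] upos
    proof eventually_elim
      case (elim \<alpha>)
      have p: "0 < \<alpha> powr \<beta>" using elim by simp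
      have "\<Psi> 1 \<alpha> \<le> 1 / (c - u \<alpha>) + \<alpha> * mean_inverse (c - u \<alpha>)"
        using elim by (intro variational_upper) auto
      moreover have "1 / (c - u \<alpha>) - 1 / c = u \<alpha> / (c * (c - u \<alpha>))"
        using elim c_pos by (simp add: field_simps)
      moreover have "\<alpha> * mean_inverse (c - u \<alpha>) = t0 powr \<nu> * \<phi> (u \<alpha>) * \<alpha> powr \<beta>"
      proof -
        have "\<alpha> * mean_inverse (c - u \<alpha>) = \<alpha> * u \<alpha> powr \<nu> * \<phi> (u \<alpha>)" using \<phi>_inv elim by simp
        also have "\<alpha> * u \<alpha> powr \<nu> = t0 powr \<nu> * \<alpha> powr \<beta>" unfolding u_def by (rule scale[OF elim(3) t0])
        finally show ?thesis by simp
      qed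
      moreover have "u \<alpha> / (c * (c - u \<alpha>)) = t0 / (c * (c - u \<alpha>)) * \<alpha> powr \<beta>" by (simp add: u_def)
      ultimately have "\<Psi> 1 \<alpha> - 1 / c \<le> (t0 / (c * (c - u \<alpha>)) + t0 powr \<nu> * \<phi> (u \<alpha>)) * \<alpha> powr \<beta>"
        unfolding distrib_right by linarith
      then have "R \<alpha> \<le> t0 / (c * (c - u \<alpha>)) + t0 powr \<nu> * \<phi> (u \<alpha>)"
        unfolding R_def using p by (simp only: pos_divide_le_eq)
      with elim show ?case by linarith
    qed
  qed
  then have "((\<lambda>\<alpha>. R \<alpha> - B) \<longlongrightarrow> B - B) (at_right 0)" by (intro tendsto_intros)
  then have R0: "((\<lambda>\<alpha>. R \<alpha> - B) \<longlongrightarrow> 0) (at_right 0)" by simp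
  show ?thesis unfolding \<beta>_def[symmetric] B_def[symmetric]
  proof (rule smalloI_tendsto)
    have "eventually (\<lambda>\<alpha>. R \<alpha> - B = (\<Psi> 1 \<alpha> - (1 / c + B * \<alpha> powr \<beta>)) / \<alpha> powr \<beta>) (at_right 0)"
      using eventually_at_right_less[of 0]
    proof eventually_elim
      case (elim \<alpha>)
      then have "\<alpha> powr \<beta> \<noteq> 0" by simp
      then show ?case by (simp add: R_def field_simps)
    qed
    with R0 show "((\<lambda>\<alpha>. (\<Psi> 1 \<alpha> - (1 / c + B * \<alpha> powr \<beta>)) / \<alpha> powr \<beta>) \<longlongrightarrow> 0) (at_right 0)"
      by (rule Lim_transform_eventually)
    show "eventually (\<lambda>\<alpha>. \<alpha> powr \<beta> \<noteq> 0) (at_right 0)"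
      using eventually_at_right_less[of 0] by eventually_elim simp
  qed
qed

end

theorem theorem3p2p3:
  fixes M :: "'a measure"
    and c :: real
    and m :: "real measure"
    and \<xi> :: "nat \<Rightarrow> 'a \<Rightarrow> real"
    and X :: "nat \<times> nat \<Rightarrow> 'a \<Rightarrow> real"
    and \<Psi> :: "real \<Rightarrow> real \<Rightarrow> real"
  assumes model: "random_rate_exponential_model M c m \<xi> X"
    and limit_shape: "is_limit_shape M X \<Psi>"
  shows
    "(inverse_square_moment c m < \<infinity> \<longrightarrow>
        (\<exists>\<alpha>\<^sub>0>0. \<forall>\<alpha>\<in>{0<..\<alpha>\<^sub>0}. \<Psi> 1 \<alpha> = 1 / c + \<alpha> * inverse_moment c m)) \<and>
     (\<forall>\<nu>\<in>{-1..1}. \<forall>\<kappa>>0.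
        ((\<lambda>t. measure m {c..<t} / (t - c) powr (\<nu> + 1)) \<longlongrightarrow> \<kappa>) (at_right c) \<longrightarrow>
          inverse_square_moment c m = \<infinity> \<and>
          (\<nu> > 0 \<longrightarrow>
             (\<lambda>\<alpha>. \<Psi> 1 \<alpha> - (1 / c + \<alpha> * inverse_moment c m)) \<in> o[at_right 0](\<lambda>\<alpha>. \<alpha>)) \<and>
          (\<nu> = 0 \<longrightarrow>
             (\<lambda>\<alpha>. \<Psi> 1 \<alpha> - (1 / c - \<kappa> * \<alpha> * ln \<alpha>)) \<in> o[at_right 0](\<lambda>\<alpha>. \<alpha> * ln \<alpha>)) \<and>
          (\<nu> < 0 \<longrightarrow>
             (\<lambda>\<alpha>. \<Psi> 1 \<alpha> - (1 / c + B_const c \<kappa> \<nu> * \<alpha> powr (1 / (1 - \<nu>))))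
               \<in> o[at_right 0](\<lambda>\<alpha>. \<alpha> powr (1 / (1 - \<nu>)))))"
proof -
  interpret random_rate_exponential_model M c m \<xi> X by (rule model)
  interpret row_limit m c \<Psi>
    by unfold_locales (use c_exact AE_rows_limit_shape[OF limit_shape] in auto)
  show ?thesis
  proof (intro conjI impI ballI allI)
    assume "inverse_square_moment c m < \<infinity>"
    then show "\<exists>\<alpha>\<^sub>0>0. \<forall>\<alpha>\<in>{0<..\<alpha>\<^sub>0}. \<Psi> 1 \<alpha> = 1 / c + \<alpha> * inverse_moment c m"
      by (rule limit_linear)
  next
    fix \<nu> \<kappa> :: real
    assume range: "\<nu> \<in> {-1..1}" and pos: "\<kappa> > 0"
      and tail: "((\<lambda>t. measure m {c..<t} / (t - c) powr (\<nu> + 1)) \<longlongrightarrow> \<kappa>) (at_right c)"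
    interpret row_limit_tail m c \<Psi> \<nu> \<kappa>
      using range pos tail by unfold_locales auto
    show "inverse_square_moment c m = \<infinity>" using range by (intro inverse_square_moment_infinite) simp
    show "(\<lambda>\<alpha>. \<Psi> 1 \<alpha> - (1 / c + \<alpha> * inverse_moment c m)) \<in> o[at_right 0](\<lambda>\<alpha>. \<alpha>)" if "\<nu> > 0"
      by (rule limit_almost_linear[OF inverse_integrable[OF that] AE_rate_neq_edge[OF that]])
    show "(\<lambda>\<alpha>. \<Psi> 1 \<alpha> - (1 / c - \<kappa> * \<alpha> * ln \<alpha>)) \<in> o[at_right 0](\<lambda>\<alpha>. \<alpha> * ln \<alpha>)" if "\<nu> = 0"
      by (rule limit_log[OF that])
    show "(\<lambda>\<alpha>. \<Psi> 1 \<alpha> - (1 / c + B_const c \<kappa> \<nu> * \<alpha> powr (1 / (1 - \<nu>))))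
        \<in> o[at_right 0](\<lambda>\<alpha>. \<alpha> powr (1 / (1 - \<nu>)))" if "\<nu> < 0"
      by (rule limit_powr[OF that])
  qed
qed

end
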